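(* Let $d\in\mathbb{N}$ and let $\{G_i\}_{i=1}^\infty$ be a sequence of finite simple connected graphs with vertex degrees at most $d$, properly edge-colored by the colors $c_1,\dots,c_{d+1}$, with $|V(G_i)|\to\infty$. If $\{G_i\}_{i=1}^\infty$ weakly converges to the $d$-graphing $\mathcal{G}=\{X,T_1,\dots,T_{d+1},\mu\}$ (i.e. $\mathcal{G}$ is a limit graphing of the sequence), then the spectral measures $\lambda_{\Delta_{G_i}}$ of the graph Laplacians converge weakly, as $i\to\infty$, to the KNS-measure $\lambda_{\Delta_{\mathcal{G}}}$ of the Laplacian $\Delta_{\mathcal{G}}$ of the graphing.
   Context: Rooted balls and statistics. A rooted colored $d$-graph is a finite simple graph with a distinguished vertex (root), all degrees at most $d$, and edges properly colored by $c_1,\dots,c_{d+1}$ (edges sharing a vertex have different colors). A rooted $(r,d)$-ball is a rooted colored $d$-graph all of whose vertices are at shortest-path distance at most $r$ from the root. Two are rooted isomorphic if there is a color-preserving graph isomorphism mapping root to root; $\mathcal{C}^{r,d}$ is the finite set of rooted isomorphism classes of rooted $(r,d)$-balls. For a finite properly edge-colored graph $G$ with degrees at most $d$ and $\mathcal{A}\in\mathcal{C}^{r,d}$, $p_G(\mathcal{A})$ is the proportion (out of $|V(G)|$) of vertices $v$ whose $r$-neighborhood $B_r(v)$, rooted at $v$, represents the class $\mathcal{A}$. Graphings. A $d$-graphing $\mathcal{G}=\{X,T_1,\dots,T_{d+1},\mu\}$ consists of a compact metric space $X$ with a probability measure $\mu$ and measure preserving continuous involutions $T_1,\dots,T_{d+1}$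 of $X$ such that: for every $p\in X$, $T_i(p)=p$ for at least one $i$; and if $T_i(p)=T_j(p)$ with $i\ne j$, then $T_i(p)=T_j(p)=p$. Write $x\sim y$ if $y$ can be reached from $x$ by applying finitely many of the maps $T_j$. Each equivalence class carries a graph structure (leafgraph): $x\neq y$ are adjacent if $T_j(x)=y$ for some $j$, and the edge $(x,y)$ is then colored $c_j$. The leafgraph of $x$ is denoted $\mathcal{G}_x$; all leafgraphs have degrees at most $d$. $p_{\mathcal{G}}(\mathcal{A})$ is the $\mu$-measure of the set of $x\in X$ whose rooted colored $r$-neighborhood in its leafgraph is rooted isomorphic to $\mathcal{A}$. The sequence $\{G_i\}$ weakly converges to $\mathcal{G}$ if $\lim_{i\to\infty}p_{G_i}(\mathcal{A})=p_{\mathcal{G}}(\mathcal{A})$ for all $r\geq1$ and $\mathcal{A}\in\mathcal{C}^{r,d}$. Von Neumann algebra and trace. Let $\mathcal{R}=\{(x,y)\in X\times X: x\sim y\}$, with the counting measure $\nu(B)=\int_X|\{y:(x,y)\in B\}|\,d\mu(x)$, so $L^2(\mathcal{R},\nu)=\int_X l^2(V(\mathcal{G}_x))\,d\mu(x)$. For a bounded measurable $\kappa:\mathcal{R}\to\mathbb{C}$ of finite bandwidth (there is $b_\kappa>0$ with $\kappa(x,y)=0$ whenever the leafgraph distance of $x,y$ exceeds $b_\kappa$), define $T_\kappa f(x,y)=\sum_{z\sim x}f(x,z)\kappa(z,y)$ for $f\in L^2(\mathcal{R},\nu)$. The Feldman–Moore algebra $\mathcal{N}_{\mathcal{R}}$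 is the weak closure of the set of operators $T_\kappa$ in $\int_X\mathcal{B}(l^2(V(\mathcal{G}_x)))\,d\mu(x)$ (the von Neumann algebra of essentially bounded measurable fields of bounded operators). It carries a trace $\mathrm{Tr}_{\mathcal{G}}$, the normal trace with $\mathrm{Tr}_{\mathcal{G}}(T_\kappa)=\int_X\kappa(x,x)\,d\mu(x)$. Laplacians and spectral measures. $\Delta_{\mathcal{G}}\in\mathcal{N}_{\mathcal{R}}$ is the operator $\Delta_{\mathcal{G}}f(x,y)=\deg(y)f(x,y)-\sum_{z\text{ adjacent to }y}f(x,z)$ (adjacency and degree in the leafgraph), and $\Delta_{G_i}f(y)=\deg(y)f(y)-\sum_{z\text{ adjacent to }y}f(z)$ on functions on $V(G_i)$. All the spectra lie in a common interval $[0,l]$. $\lambda_{\Delta_{G_i}}$ is the probability measure assigning to a set $A\subseteq[0,\infty)$ the number of eigenvalues of $\Delta_{G_i}$ in $A$, counted with multiplicity, divided by $|V(G_i)|$. The KNS-measure $\lambda_{\Delta_{\mathcal{G}}}$ is the measure on $[0,l]$ given by $\lambda_{\Delta_{\mathcal{G}}}([0,x])=\mathrm{Tr}_{\mathcal{G}}(E_{\Delta_{\mathcal{G}}}([0,x]))$, where $E_{\Delta_{\mathcal{G}}}$ is the projection-valued spectral measure of the bounded self-adjoint operator $\Delta_{\mathcal{G}}$. Weak convergence of measures means convergence of integrals of all continuous functions on $[0,l]$. *)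

theory Defs
  imports "HOL-Probability.Probability" "HOL-Library.Function_Algebras"
begin

section \<open>Edge-coloured graphs and rooted balls\<close>

record 'v cgraph =
  verts :: "'v set"
  edges :: "'v set set"
  colour :: "'v set \<Rightarrow> nat"

definition nbrs :: "'v cgraph \<Rightarrow> 'v \<Rightarrow> 'v set" where
  "nbrs G v = {w. {v, w} \<in> edges G}"

definition vdegree :: "'v cgraph \<Rightarrow> 'v \<Rightarrow> nat" where
  "vdegree G v = card (nbrs G v)"

definition adj_rel :: "'v cgraph \<Rightarrow> ('v \<times> 'v) set" where
  "adj_rel G = {(v, w). {v, w} \<in> edges G}"

text \<open>The colours are the numbers \<open>1, \<dots>, d + 1\<close>. The vertex set may be infinite.\<close>

definition coloured_dgraph :: "nat \<Rightarrow> 'v cgraph \<Rightarrow> bool" where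
  "coloured_dgraph d G \<longleftrightarrow>
     (\<forall>e\<in>edges G. \<exists>v\<in>verts G. \<exists>w\<in>verts G. v \<noteq> w \<and> e = {v, w}) \<and>
     (\<forall>v\<in>verts G. finite (nbrs G v) \<and> vdegree G v \<le> d) \<and>
     (\<forall>e\<in>edges G. colour G e \<in> {1..d + 1}) \<and>
     (\<forall>e\<in>edges G. \<forall>e'\<in>edges G. e \<noteq> e' \<and> e \<inter> e' \<noteq> {} \<longrightarrow> colour G e \<noteq> colour G e')"

definition gconnected :: "'v cgraph \<Rightarrow> bool" where
  "gconnected G \<longleftrightarrow> verts G \<noteq> {} \<and> (\<forall>v\<in>verts G. \<forall>w\<in>verts G. (v, w) \<in> (adj_rel G)\<^sup>*)"

text \<open>Shortest-path distance at most \<open>r\<close>: some walk has at most \<open>r\<close> edges.\<close>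

definition gdist_le :: "'v cgraph \<Rightarrow> nat \<Rightarrow> 'v \<Rightarrow> 'v \<Rightarrow> bool" where
  "gdist_le G r v w \<longleftrightarrow> (\<exists>n\<le>r. (v, w) \<in> adj_rel G ^^ n)"

type_synonym 'v rooted = "'v cgraph \<times> 'v"

definition rooted_ball :: "nat \<Rightarrow> nat \<Rightarrow> 'v rooted \<Rightarrow> bool" where
  "rooted_ball r d A \<longleftrightarrow>
     coloured_dgraph d (fst A) \<and> finite (verts (fst A)) \<and> snd A \<in> verts (fst A) \<and>
     (\<forall>v\<in>verts (fst A). gdist_le (fst A) r (snd A) v)"

definition nbhd :: "'v cgraph \<Rightarrow> nat \<Rightarrow> 'v \<Rightarrow> 'v rooted" where
  "nbhd G r v =
     (let B = {w \<in> verts G. gdist_le G r v w}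
      in (\<lparr>verts = B, edges = {e \<in> edges G. e \<subseteq> B}, colour = colour G\<rparr>, v))"

definition rooted_iso :: "'v rooted \<Rightarrow> 'w rooted \<Rightarrow> bool" where
  "rooted_iso A B \<longleftrightarrow>
     (\<exists>f. bij_betw f (verts (fst A)) (verts (fst B)) \<and> f (snd A) = snd B \<and>
        (\<forall>v\<in>verts (fst A). \<forall>w\<in>verts (fst A).
           ({v, w} \<in> edges (fst A) \<longleftrightarrow> {f v, f w} \<in> edges (fst B)) \<and>
           ({v, w} \<in> edges (fst A) \<longrightarrow> colour (fst B) {f v, f w} = colour (fst A) {v, w})))"

text \<open>An isomorphism class of rooted balls is given by a representative, which may always be
  chosen with natural numbers as vertices.\<close>

definition ball_freq :: "'v cgraph \<Rightarrow> nat \<Rightarrow> nat rooted \<Rightarrow> real" where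
  "ball_freq G r A = real (card {v \<in> verts G. rooted_iso (nbhd G r v) A}) / real (card (verts G))"


section \<open>Graphings\<close>

record 'a graphing =
  invol :: "nat \<Rightarrow> 'a \<Rightarrow> 'a"
  gmeas :: "'a measure"

text \<open>The compact metric space is the whole type. Second countability is implied by
  compactness; the class constraint excludes no space and makes the product Borel lemmas applicable.\<close>

definition is_graphing ::
  "nat \<Rightarrow> 'a::{metric_space, second_countable_topology} graphing \<Rightarrow> bool" where
  "is_graphing d \<G> \<longleftrightarrow>
     compact (UNIV :: 'a set) \<and>
     sets (gmeas \<G>) = sets borel \<and> prob_space (gmeas \<G>) \<and>
     (\<forall>j\<in>{1..d + 1}. continuous_on UNIV (invol \<G> j) \<and>
        (\<forall>p. invol \<G> j (invol \<G> j p) = p) \<and>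
        distr (gmeas \<G>) (gmeas \<G>) (invol \<G> j) = gmeas \<G>) \<and>
     (\<forall>p. \<exists>j\<in>{1..d + 1}. invol \<G> j p = p) \<and>
     (\<forall>p. \<forall>i\<in>{1..d + 1}. \<forall>j\<in>{1..d + 1}.
        i \<noteq> j \<and> invol \<G> i p = invol \<G> j p \<longrightarrow> invol \<G> i p = p \<and> invol \<G> j p = p)"

definition orbit_rel :: "nat \<Rightarrow> 'a graphing \<Rightarrow> ('a \<times> 'a) set" where
  "orbit_rel d \<G> = {(x, invol \<G> j x) | x j. j \<in> {1..d + 1}}\<^sup>*"

definition orbit_of :: "nat \<Rightarrow> 'a graphing \<Rightarrow> 'a \<Rightarrow> 'a set" where
  "orbit_of d \<G> x = {y. (x, y) \<in> orbit_rel d \<G>}"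

definition leafgraph :: "nat \<Rightarrow> 'a graphing \<Rightarrow> 'a \<Rightarrow> 'a cgraph" where
  "leafgraph d \<G> x =
     \<lparr>verts = orbit_of d \<G> x,
      edges = {{y, invol \<G> j y} | y j. y \<in> orbit_of d \<G> x \<and> j \<in> {1..d + 1} \<and> invol \<G> j y \<noteq> y},
      colour = (\<lambda>e. THE j. j \<in> {1..d + 1} \<and> (\<exists>y. invol \<G> j y \<noteq> y \<and> e = {y, invol \<G> j y}))\<rparr>"

definition graphing_freq :: "nat \<Rightarrow> 'a graphing \<Rightarrow> nat \<Rightarrow> nat rooted \<Rightarrow> real" where
  "graphing_freq d \<G> r A =
     measure (gmeas \<G>) {x \<in> space (gmeas \<G>). rooted_iso (nbhd (leafgraph d \<G> x) r x) A}"

definition weakly_converges :: "nat \<Rightarrow> (nat \<Rightarrow> 'v cgraph) \<Rightarrow> 'a graphing \<Rightarrow> bool" where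
  "weakly_converges d G \<G> \<longleftrightarrow>
     (\<forall>r\<ge>1. \<forall>A. rooted_ball r d A \<longrightarrow>
        (\<lambda>i. ball_freq (G i) r A) \<longlonglongrightarrow> graphing_freq d \<G> r A)"


section \<open>Operators on complex square-integrable functions\<close>

text \<open>Elements of \<open>L\<^sup>2(M)\<close> are represented by functions, operators by maps between such
  functions, and everything is understood up to equality almost everywhere. Linearity and
  boundedness make an operator compatible with this equality.\<close>

type_synonym 'b oper = "('b \<Rightarrow> complex) \<Rightarrow> 'b \<Rightarrow> complex"

definition L2 :: "'b measure \<Rightarrow> ('b \<Rightarrow> complex) set" where
  "L2 M = {f \<in> borel_measurable M. integrable M (\<lambda>p. (cmod (f p))\<^sup>2)}"

definition l2_inner :: "'b measure \<Rightarrow> ('b \<Rightarrow> complex) \<Rightarrow> ('b \<Rightarrow> complex) \<Rightarrow> complex" where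
  "l2_inner M f g = (LINT p|M. f p * cnj (g p))"

definition l2_norm :: "'b measure \<Rightarrow> ('b \<Rightarrow> complex) \<Rightarrow> real" where
  "l2_norm M f = sqrt (LINT p|M. (cmod (f p))\<^sup>2)"

definition op_eq :: "'b measure \<Rightarrow> 'b oper \<Rightarrow> 'b oper \<Rightarrow> bool" where
  "op_eq M S T \<longleftrightarrow> (\<forall>f\<in>L2 M. AE p in M. S f p = T f p)"

definition bounded_op_by :: "'b measure \<Rightarrow> real \<Rightarrow> 'b oper \<Rightarrow> bool" where
  "bounded_op_by M C S \<longleftrightarrow>
     (\<forall>f\<in>L2 M. S f \<in> L2 M \<and> l2_norm M (S f) \<le> C * l2_norm M f) \<and>
     (\<forall>f\<in>L2 M. \<forall>g\<in>L2 M. \<forall>a b. AE p in M.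
        S (\<lambda>q. a * f q + b * g q) p = a * S f p + b * S g p)"

definition bounded_op :: "'b measure \<Rightarrow> 'b oper \<Rightarrow> bool" where
  "bounded_op M S \<longleftrightarrow> (\<exists>C. bounded_op_by M C S)"

definition self_adjoint :: "'b measure \<Rightarrow> 'b oper \<Rightarrow> bool" where
  "self_adjoint M S \<longleftrightarrow> (\<forall>f\<in>L2 M. \<forall>g\<in>L2 M. l2_inner M (S f) g = l2_inner M f (S g))"

definition op_pos :: "'b measure \<Rightarrow> 'b oper \<Rightarrow> bool" where
  "op_pos M S \<longleftrightarrow> (\<forall>f\<in>L2 M. l2_inner M (S f) f \<in> \<real>\<^sub>\<ge>\<^sub>0)"

definition op_le :: "'b measure \<Rightarrow> 'b oper \<Rightarrow> 'b oper \<Rightarrow> bool" where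
  "op_le M S T \<longleftrightarrow> op_pos M (\<lambda>f p. T f p - S f p)"

definition op_spectrum :: "'b measure \<Rightarrow> 'b oper \<Rightarrow> complex set" where
  "op_spectrum M S =
     {z. \<not> (\<exists>Q. bounded_op M Q \<and>
              op_eq M (\<lambda>f. Q (\<lambda>p. S f p - z * f p)) (\<lambda>f. f) \<and>
              op_eq M (\<lambda>f p. S (Q f) p - z * Q f p) (\<lambda>f. f))}"

definition projection_valued_measure :: "'b measure \<Rightarrow> (real set \<Rightarrow> 'b oper) \<Rightarrow> bool" where
  "projection_valued_measure M E \<longleftrightarrow>
     (\<forall>B\<in>sets borel. bounded_op M (E B) \<and> self_adjoint M (E B)) \<and>
     op_eq M (E {}) (\<lambda>f p. 0) \<and> op_eq M (E UNIV) (\<lambda>f. f) \<and>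
     (\<forall>A\<in>sets borel. \<forall>B\<in>sets borel. op_eq M (E (A \<inter> B)) (\<lambda>f. E A (E B f))) \<and>
     (\<forall>A :: nat \<Rightarrow> real set. range A \<subseteq> sets borel \<longrightarrow> disjoint_family A \<longrightarrow>
        (\<forall>f\<in>L2 M. \<forall>g\<in>L2 M.
           (\<lambda>n. l2_inner M (E (A n) f) g) sums l2_inner M (E (\<Union>n. A n) f) g))"

definition scalar_spectral_measure ::
  "'b measure \<Rightarrow> (real set \<Rightarrow> 'b oper) \<Rightarrow> ('b \<Rightarrow> complex) \<Rightarrow> real measure" where
  "scalar_spectral_measure M E f =
     measure_of UNIV (sets borel) (\<lambda>B. ennreal (Re (l2_inner M (E B f) f)))"

text \<open>\<open>S = \<integral> t dE(t)\<close>, in the weak sense. By polarization the diagonal matrix coefficients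
  suffice.\<close>

definition is_spectral_measure_of ::
  "'b measure \<Rightarrow> 'b oper \<Rightarrow> (real set \<Rightarrow> 'b oper) \<Rightarrow> bool" where
  "is_spectral_measure_of M S E \<longleftrightarrow>
     projection_valued_measure M E \<and>
     (\<forall>f\<in>L2 M. integrable (scalar_spectral_measure M E f) (\<lambda>t. t) \<and>
        l2_inner M (S f) f = of_real (LINT t|scalar_spectral_measure M E f. t))"


section \<open>The Feldman--Moore algebra of a graphing and its trace\<close>

definition rel_measure ::
  "nat \<Rightarrow> 'a::{metric_space, second_countable_topology} graphing \<Rightarrow> ('a \<times> 'a) measure" where
  "rel_measure d \<G> =
     measure_of (orbit_rel d \<G>) (sets (restrict_space borel (orbit_rel d \<G>)))
       (\<lambda>B. \<integral>\<^sup>+x. emeasure (count_space UNIV) {y. (x, y) \<in> B} \<partial>gmeas \<G>)"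

definition fb_kernel ::
  "nat \<Rightarrow> 'a::{metric_space, second_countable_topology} graphing \<Rightarrow> ('a \<times> 'a \<Rightarrow> complex) \<Rightarrow> bool"
  where
  "fb_kernel d \<G> \<kappa> \<longleftrightarrow>
     \<kappa> \<in> borel_measurable (rel_measure d \<G>) \<and>
     (\<exists>C. \<forall>p\<in>orbit_rel d \<G>. cmod (\<kappa> p) \<le> C) \<and>
     (\<exists>b. \<forall>(x, y)\<in>orbit_rel d \<G>. \<not> gdist_le (leafgraph d \<G> x) b x y \<longrightarrow> \<kappa> (x, y) = 0)"

text \<open>For a finite-bandwidth kernel the sum below has only finitely many nonzero terms.\<close>

definition kernel_op :: "nat \<Rightarrow> 'a graphing \<Rightarrow> ('a \<times> 'a \<Rightarrow> complex) \<Rightarrow> ('a \<times> 'a) oper" where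
  "kernel_op d \<G> \<kappa> f = (\<lambda>(x, y). \<Sum>\<^sub>\<infinity>z\<in>orbit_of d \<G> x. f (x, z) * \<kappa> (z, y))"

text \<open>Essentially bounded measurable fields \<open>s\<close> of bounded operators on the spaces
  \<open>l\<^sup>2(V(\<G>\<^sub>x))\<close>, viewed as operators on \<open>L\<^sup>2(\<R>, \<nu>)\<close>. Measurability of the field is the
  requirement that it maps square-integrable sections to measurable ones, which is part of
  boundedness of \<open>S\<close>.\<close>

definition decomposable_op ::
  "nat \<Rightarrow> 'a::{metric_space, second_countable_topology} graphing \<Rightarrow> ('a \<times> 'a) oper \<Rightarrow> bool" where
  "decomposable_op d \<G> S \<longleftrightarrow>
     bounded_op (rel_measure d \<G>) S \<and>
     (\<exists>s C. (AE x in gmeas \<G>. bounded_op_by (count_space (orbit_of d \<G> x)) C (s x)) \<and>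
        (\<forall>f\<in>L2 (rel_measure d \<G>). AE x in gmeas \<G>.
           \<forall>y\<in>orbit_of d \<G> x. S f (x, y) = s x (\<lambda>z. f (x, z)) y))"

text \<open>Weak closure: every basic neighbourhood in the weak operator topology contains some
  \<open>T\<^sub>\<kappa>\<close>.\<close>

definition feldman_moore ::
  "nat \<Rightarrow> 'a::{metric_space, second_countable_topology} graphing \<Rightarrow> ('a \<times> 'a) oper set" where
  "feldman_moore d \<G> =
     {S. decomposable_op d \<G> S \<and>
         (\<forall>F \<epsilon>. finite F \<and> F \<subseteq> L2 (rel_measure d \<G>) \<times> L2 (rel_measure d \<G>) \<and> 0 < \<epsilon> \<longrightarrow>
            (\<exists>\<kappa>. fb_kernel d \<G> \<kappa> \<and>
               (\<forall>(f, g)\<in>F. cmod (l2_inner (rel_measure d \<G>) (S f) g -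
                  l2_inner (rel_measure d \<G>) (kernel_op d \<G> \<kappa> f) g) < \<epsilon>)))}"

text \<open>A functional on a set \<open>N\<close> of operators is normal if it preserves least upper bounds of
  upward directed families of positive operators.\<close>

definition normal_functional :: "'b measure \<Rightarrow> 'b oper set \<Rightarrow> ('b oper \<Rightarrow> complex) \<Rightarrow> bool" where
  "normal_functional M N \<tau> \<longleftrightarrow>
     (\<forall>D S. D \<noteq> {} \<and> D \<subseteq> N \<and> S \<in> N \<and> (\<forall>U\<in>D. op_pos M U) \<and>
        (\<forall>U\<in>D. \<forall>V\<in>D. \<exists>W\<in>D. op_le M U W \<and> op_le M V W) \<and>
        (\<forall>U\<in>D. op_le M U S) \<and>
        (\<forall>W\<in>N. self_adjoint M W \<and> (\<forall>U\<in>D. op_le M U W) \<longrightarrow> op_le M S W) \<longrightarrow>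
        Re (\<tau> S) = (SUP U\<in>D. Re (\<tau> U)))"

definition normal_trace :: "'b measure \<Rightarrow> 'b oper set \<Rightarrow> ('b oper \<Rightarrow> complex) \<Rightarrow> bool" where
  "normal_trace M N \<tau> \<longleftrightarrow>
     (\<forall>S\<in>N. \<forall>T\<in>N. op_eq M S T \<longrightarrow> \<tau> S = \<tau> T) \<and>
     (\<forall>S\<in>N. \<forall>T\<in>N. \<forall>a b. \<tau> (\<lambda>f p. a * S f p + b * T f p) = a * \<tau> S + b * \<tau> T) \<and>
     (\<forall>S\<in>N. op_pos M S \<longrightarrow> \<tau> S \<in> \<real>\<^sub>\<ge>\<^sub>0) \<and>
     (\<forall>S\<in>N. \<forall>T\<in>N. \<tau> (\<lambda>f. S (T f)) = \<tau> (\<lambda>f. T (S f))) \<and>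
     normal_functional M N \<tau>"

definition is_graphing_trace ::
  "nat \<Rightarrow> 'a::{metric_space, second_countable_topology} graphing \<Rightarrow> (('a \<times> 'a) oper \<Rightarrow> complex) \<Rightarrow> bool"
  where
  "is_graphing_trace d \<G> \<tau> \<longleftrightarrow>
     normal_trace (rel_measure d \<G>) (feldman_moore d \<G>) \<tau> \<and>
     (\<forall>\<kappa>. fb_kernel d \<G> \<kappa> \<longrightarrow> \<tau> (kernel_op d \<G> \<kappa>) = (LINT x|gmeas \<G>. \<kappa> (x, x)))"


section \<open>Laplacians and their spectral distributions\<close>

definition graph_laplacian :: "'v cgraph \<Rightarrow> 'v oper" where
  "graph_laplacian G f y = of_nat (vdegree G y) * f y - (\<Sum>z\<in>nbrs G y. f z)"

definition graphing_laplacian :: "nat \<Rightarrow> 'a graphing \<Rightarrow> ('a \<times> 'a) oper" where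
  "graphing_laplacian d \<G> f = (\<lambda>(x, y). graph_laplacian (leafgraph d \<G> x) (\<lambda>z. f (x, z)) y)"

text \<open>Functions on \<open>V(G)\<close> are functions vanishing outside \<open>V(G)\<close>. The multiplicity of an
  eigenvalue of the self-adjoint Laplacian is the dimension of its eigenspace.\<close>

definition laplacian_mult :: "'v cgraph \<Rightarrow> real \<Rightarrow> nat" where
  "laplacian_mult G t =
     vector_space.dim (\<lambda>(c :: complex) (f :: 'v \<Rightarrow> complex) v. c * f v)
       {f. (\<forall>v. v \<notin> verts G \<longrightarrow> f v = 0) \<and>
           (\<forall>v\<in>verts G. graph_laplacian G f v = of_real t * f v)}"

definition graph_spectral_measure :: "'v cgraph \<Rightarrow> real measure" where
  "graph_spectral_measure G =
     point_measure UNIV (\<lambda>t. ennreal (real (laplacian_mult G t) / real (card (verts G))))"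

text \<open>The Lebesgue--Stieltjes measure of \<open>x \<mapsto> \<tau>(E([0,x]))\<close>. This function vanishes for
  \<open>x < 0\<close>, where \<open>[0,x]\<close> is empty, so that the measure gives \<open>[0,x]\<close> the mass
  \<open>\<tau>(E([0,x]))\<close>, including the possible atom at \<open>0\<close>.\<close>

definition KNS_measure :: "('b oper \<Rightarrow> complex) \<Rightarrow> (real set \<Rightarrow> 'b oper) \<Rightarrow> real measure" where
  "KNS_measure \<tau> E = interval_measure (\<lambda>x. Re (\<tau> (E {0..x})))"

definition converge_weakly_on :: "real \<Rightarrow> (nat \<Rightarrow> real measure) \<Rightarrow> real measure \<Rightarrow> bool" where
  "converge_weakly_on l Ms M \<longleftrightarrow>
     (\<forall>f :: real \<Rightarrow> real. continuous_on {0..l} f \<longrightarrow>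
        (\<lambda>i. LINT t:{0..l}|Ms i. f t) \<longlonglongrightarrow> (LINT t:{0..l}|M. f t))"

end

theory Submission
  imports Defs "HOL-Computational_Algebra.Fundamental_Theorem_Algebra"
begin

text \<open>Write \<open>N = d + 1\<close>. On a graph coloured by \<open>N\<close> colours each colour defines an involution \<open>T\<^sub>j\<close>
  (fixing the vertices without an edge of that colour), and the Laplacian is \<open>N - A\<close> with
  \<open>(A f)(v) = \<Sum>\<^sub>j f (T\<^sub>j v)\<close>; the same formula holds on the graphing. Hence the trace of \<open>A\<^sup>k\<close>
  counts the words \<open>w\<close> of length \<open>k\<close> in the involutions with \<open>w v = v\<close>, an event visible in a ball of
  bounded radius, so that weak convergence of the graphs gives convergence of the moments of the spectral
  measures.

  It remains to identify the KNS measure with the scalar spectral measure \<open>m\<close> of the indicator of the diagonal,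
  whose moments are the integrals of the diagonal kernel of \<open>A\<^sup>k\<close>. The trace is only known on
  finite-band operators and is normal. Polynomials \<open>p\<^sub>n\<close> decreasing pointwise on the interval \<open>[-N, N]\<close> to the
  indicator of the relevant half line make \<open>p\<^sub>n(A)\<close> decrease strongly to \<open>E([0,x])\<close>, and also converge in
  every fibre, which puts \<open>E([0,x])\<close> in the Feldman--Moore algebra; normality then evaluates its trace.\<close>

section \<open>Square-integrable functions\<close>

text \<open>The obstacle is how little is known about \<open>E\<close>: for each \<open>f\<close>
  only the first moment of its scalar spectral measure is given, and no functional calculus comes
  with it. Polarization shows that \<open>A\<close> commutes with every \<open>E B\<close>; on a
  thin slab of the spectrum \<open>A\<close> is then close to a scalar, and summing over slabs shows
  that passing from \<open>f\<close> to \<open>A f\<close> multiplies the spectral measure by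
  \<open>(N - t)^2\<close>. This yields all moments. Positivity of \<open>q(A)\<close> for
  \<open>q\<close> nonnegative on \<open>[-N, N]\<close> is obtained independently of
  \<open>E\<close>, by Bernstein polynomials, and therefore also holds on each single orbit, where
  no spectral measure is given. Normality concerns increasing families, so the decreasing
  approximants enter as \<open>5 - p_n(A)\<close>, where 5 is a common upper bound of the
  \<open>p_n\<close>. That the limit measure is carried by \<open>[0, l]\<close> is not read off the
  operator: it follows from the convergence of the moments, because the eigenvalues lie
  there.\<close>

lemma borel_measurable_cnj [measurable (raw)]:
  "f \<in> borel_measurable M \<Longrightarrow> (\<lambda>x. cnj (f x)) \<in> borel_measurable M"
  by (rule measurable_compose[of f M borel cnj borel])
     (auto intro!: borel_measurable_continuous_onI continuous_intros)

lemma L2D: "f \<in> L2 M \<Longrightarrow> f \<in> borel_measurable M" "f \<in> L2 M \<Longrightarrow> integrable M (\<lambda>p. (cmod (f p))\<^sup>2)"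
  by (auto simp: L2_def)

lemma L2_mult_integrable:
  assumes "f \<in> L2 M" "g \<in> L2 M"
  shows "integrable M (\<lambda>p. f p * cnj (g p))" "integrable M (\<lambda>p. cmod (f p) * cmod (g p))"
proof -
  have [measurable]: "f \<in> borel_measurable M" "g \<in> borel_measurable M"
    using assms L2D by auto
  have i: "integrable M (\<lambda>p. (cmod (f p))\<^sup>2 + (cmod (g p))\<^sup>2)"
    using assms by (intro Bochner_Integration.integrable_add L2D)
  have b: "x * y \<le> x\<^sup>2 + y\<^sup>2" if "0 \<le> x" "0 \<le> y" for x y :: real
    using sum_squares_bound[of x y] that mult_nonneg_nonneg[of x y] by linarith
  show "integrable M (\<lambda>p. f p * cnj (g p))"
    by (rule Bochner_Integration.integrable_bound[OF i]) (auto simp: norm_mult b)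
  show "integrable M (\<lambda>p. cmod (f p) * cmod (g p))"
    by (rule Bochner_Integration.integrable_bound[OF i]) (auto simp: norm_mult b)
qed

lemma L2_scale: "f \<in> L2 M \<Longrightarrow> (\<lambda>p. c * f p) \<in> L2 M"
  by (auto simp: L2_def norm_mult power_mult_distrib)

lemma L2_add:
  assumes "f \<in> L2 M" "g \<in> L2 M" shows "(\<lambda>p. f p + g p) \<in> L2 M"
proof -
  have [measurable]: "f \<in> borel_measurable M" "g \<in> borel_measurable M"
    using assms L2D by auto
  have i: "integrable M (\<lambda>p. (cmod (f p))\<^sup>2 + (cmod (g p))\<^sup>2 + 2 * (cmod (f p) * cmod (g p)))"
    using assms L2D(2) L2_mult_integrable(2) by (intro Bochner_Integration.integrable_add) auto
  have "integrable M (\<lambda>p. (cmod (f p + g p))\<^sup>2)"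
  proof (rule Bochner_Integration.integrable_bound[OF i])
    have "(cmod (f p + g p))\<^sup>2 \<le> (cmod (f p))\<^sup>2 + (cmod (g p))\<^sup>2 + 2 * (cmod (f p) * cmod (g p))" for p
      using power_mono[OF norm_triangle_ineq, of "f p" "g p" 2] by (simp add: power2_sum mult.assoc)
    then show "AE p in M. norm ((cmod (f p + g p))\<^sup>2) \<le> norm ((cmod (f p))\<^sup>2 + (cmod (g p))\<^sup>2 + 2 * (cmod (f p) * cmod (g p)))"
      by auto
  qed auto
  then show ?thesis by (auto simp: L2_def)
qed

lemma L2_diff: "f \<in> L2 M \<Longrightarrow> g \<in> L2 M \<Longrightarrow> (\<lambda>p. f p - g p) \<in> L2 M"
  using L2_add[OF _ L2_scale, of f M g "-1"] by simp

lemma L2_zero: "(\<lambda>p. 0) \<in> L2 M"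
  by (simp add: L2_def)

lemma L2_sum: "(\<And>i. i \<in> I \<Longrightarrow> f i \<in> L2 M) \<Longrightarrow> (\<lambda>p. \<Sum>i\<in>I. f i p) \<in> L2 M"
  by (induction I rule: infinite_finite_induct) (auto simp: L2_zero intro: L2_add)

lemma L2_cong_space:
  assumes "\<And>p. p \<in> space M \<Longrightarrow> f p = g p" shows "f \<in> L2 M \<longleftrightarrow> g \<in> L2 M"
proof -
  have "f \<in> borel_measurable M \<longleftrightarrow> g \<in> borel_measurable M"
    using assms by (rule measurable_cong)
  moreover have "integrable M (\<lambda>p. (cmod (f p))\<^sup>2) \<longleftrightarrow> integrable M (\<lambda>p. (cmod (g p))\<^sup>2)"
    by (rule Bochner_Integration.integrable_cong) (auto simp: assms)
  ultimately show ?thesis by (auto simp: L2_def)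
qed

lemma l2_inner_add_left:
  "f \<in> L2 M \<Longrightarrow> g \<in> L2 M \<Longrightarrow> h \<in> L2 M \<Longrightarrow>
    l2_inner M (\<lambda>p. f p + g p) h = l2_inner M f h + l2_inner M g h"
  by (simp add: l2_inner_def distrib_right L2_mult_integrable)

lemma l2_inner_diff_left:
  "f \<in> L2 M \<Longrightarrow> g \<in> L2 M \<Longrightarrow> h \<in> L2 M \<Longrightarrow>
    l2_inner M (\<lambda>p. f p - g p) h = l2_inner M f h - l2_inner M g h"
  by (simp add: l2_inner_def left_diff_distrib L2_mult_integrable)

lemma l2_inner_scale_left: "l2_inner M (\<lambda>p. c * f p) h = c * l2_inner M f h"
  by (simp add: l2_inner_def mult.assoc)

lemma l2_inner_commute: "l2_inner M f g = cnj (l2_inner M g f)"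
proof -
  have "cnj (l2_inner M g f) = (LINT p|M. cnj (g p * cnj (f p)))"
    unfolding l2_inner_def by (simp only: Bochner_Integration.integral_cnj)
  then show ?thesis by (simp add: l2_inner_def mult.commute)
qed

lemma l2_inner_add_right:
  "f \<in> L2 M \<Longrightarrow> g \<in> L2 M \<Longrightarrow> h \<in> L2 M \<Longrightarrow>
    l2_inner M h (\<lambda>p. f p + g p) = l2_inner M h f + l2_inner M h g"
  using arg_cong[OF l2_inner_add_left[of f M g h], of cnj]
  by (simp add: l2_inner_commute[of M h])

lemma l2_inner_diff_right:
  "f \<in> L2 M \<Longrightarrow> g \<in> L2 M \<Longrightarrow> h \<in> L2 M \<Longrightarrow>
    l2_inner M h (\<lambda>p. f p - g p) = l2_inner M h f - l2_inner M h g"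
  using arg_cong[OF l2_inner_diff_left[of f M g h], of cnj]
  by (simp add: l2_inner_commute[of M h])

lemma l2_inner_scale_right: "l2_inner M h (\<lambda>p. c * f p) = cnj c * l2_inner M h f"
  using arg_cong[OF l2_inner_scale_left[of M c f h], of cnj]
  by (simp add: l2_inner_commute[of M h])

lemma l2_inner_sum_left:
  assumes "\<And>i. i \<in> I \<Longrightarrow> f i \<in> L2 M" "h \<in> L2 M"
  shows "l2_inner M (\<lambda>p. \<Sum>i\<in>I. f i p) h = (\<Sum>i\<in>I. l2_inner M (f i) h)"
  using assms
proof (induction I rule: infinite_finite_induct)
  case (insert i I)
  then show ?case
    using l2_inner_add_left[of "f i" M "\<lambda>p. \<Sum>i\<in>I. f i p" h] by (simp add: L2_sum)
qed (auto simp: l2_inner_def)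

lemma l2_inner_cong_AE:
  assumes "f \<in> L2 M" "g \<in> L2 M" "f' \<in> L2 M" "g' \<in> L2 M"
    and "AE p in M. f p = f' p" "AE p in M. g p = g' p"
  shows "l2_inner M f g = l2_inner M f' g'"
proof -
  have [measurable]: "f \<in> borel_measurable M" "g \<in> borel_measurable M"
      "f' \<in> borel_measurable M" "g' \<in> borel_measurable M"
    using assms L2D by auto
  show ?thesis unfolding l2_inner_def
    by (rule integral_cong_AE) (use assms(5,6) in auto)
qed

section \<open>The norm and the Cauchy-Schwarz inequality\<close>

lemma l2_norm_nonneg [simp]: "0 \<le> l2_norm M f"
  by (simp add: l2_norm_def)

lemma l2_norm_sq: "(l2_norm M f)\<^sup>2 = (LINT p|M. (cmod (f p))\<^sup>2)"
  by (simp add: l2_norm_def)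

lemma l2_inner_self: "l2_inner M f f = of_real ((l2_norm M f)\<^sup>2)"
  unfolding l2_norm_sq l2_inner_def by (simp add: complex_norm_square[symmetric] del: of_real_power)

lemma l2_norm_sq_add:
  assumes "f \<in> L2 M" "g \<in> L2 M"
  shows "(l2_norm M (\<lambda>p. f p + g p))\<^sup>2 = (l2_norm M f)\<^sup>2 + (l2_norm M g)\<^sup>2 + 2 * Re (l2_inner M f g)"
proof -
  have "complex_of_real ((l2_norm M (\<lambda>p. f p + g p))\<^sup>2) =
      l2_inner M f f + l2_inner M g g + (l2_inner M f g + cnj (l2_inner M f g))"
    unfolding l2_inner_self[symmetric]
    using assms by (simp add: l2_inner_add_left l2_inner_add_right L2_add l2_inner_commute[of M g f])
  also have "\<dots> = of_real ((l2_norm M f)\<^sup>2 + (l2_norm M g)\<^sup>2 + 2 * Re (l2_inner M f g))"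
    by (simp add: l2_inner_self complex_add_cnj)
  finally show ?thesis using of_real_eq_iff by blast
qed

lemma l2_norm_scale: "l2_norm M (\<lambda>p. c * f p) = cmod c * l2_norm M f"
  by (simp add: l2_norm_def norm_mult power_mult_distrib real_sqrt_mult)

lemma l2_norm_sq_diff:
  assumes "f \<in> L2 M" "g \<in> L2 M"
  shows "(l2_norm M (\<lambda>p. f p - g p))\<^sup>2 = (l2_norm M f)\<^sup>2 + (l2_norm M g)\<^sup>2 - 2 * Re (l2_inner M f g)"
  using l2_norm_sq_add[OF assms(1) L2_scale[OF assms(2)], of "-1"]
    l2_norm_scale[of M "-1" g] l2_inner_scale_right[of M f "-1" g] by simp

lemma l2_norm_cong_AE:
  assumes "f \<in> L2 M" "g \<in> L2 M" "AE p in M. f p = g p"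
  shows "l2_norm M f = l2_norm M g"
  using l2_inner_cong_AE[OF assms(1,1,2,2) assms(3,3)] unfolding l2_inner_self
  by (metis l2_norm_nonneg of_real_eq_iff power2_eq_iff_nonneg)

lemma l2_norm_0_AE:
  assumes "f \<in> L2 M" "l2_norm M f = 0" shows "AE p in M. f p = 0"
proof -
  have "(LINT p|M. (cmod (f p))\<^sup>2) = 0" using assms l2_norm_sq[of M f] by simp
  then have "AE p in M. (cmod (f p))\<^sup>2 = 0"
    using integral_nonneg_eq_0_iff_AE[OF L2D(2)[OF assms(1)]] by auto
  then show ?thesis by auto
qed

lemma l2_Cauchy_Schwarz:
  assumes f: "f \<in> L2 M" and g: "g \<in> L2 M"
  shows "cmod (l2_inner M f g) \<le> l2_norm M f * l2_norm M g"
proof (cases "l2_norm M f = 0")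
  case True
  then have "l2_inner M f g = l2_inner M (\<lambda>p. 0) g"
    using l2_norm_0_AE[OF f True] f g by (intro l2_inner_cong_AE) (auto simp: L2_zero)
  then show ?thesis using True by (simp add: l2_inner_def)
next
  case False
  then have F: "(l2_norm M f)\<^sup>2 > 0" by simp
  \<comment> \<open>\<open>c * f\<close> is the projection of \<open>g\<close> onto the line spanned
    by \<open>f\<close>; the claim is the nonnegativity of the squared norm of what remains.\<close>
  define c where "c = l2_inner M g f / of_real ((l2_norm M f)\<^sup>2)"
  have "0 \<le> (l2_norm M (\<lambda>p. g p - c * f p))\<^sup>2" by simp
  also have "\<dots> = (l2_norm M g)\<^sup>2 + (cmod c * l2_norm M f)\<^sup>2 - 2 * Re (cnj c * l2_inner M g f)"
    by (subst l2_norm_sq_diff) (auto simp: g L2_scale f l2_norm_scale l2_inner_scale_right)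
  also have "cnj c * l2_inner M g f = of_real ((cmod (l2_inner M g f))\<^sup>2 / (l2_norm M f)\<^sup>2)"
    by (simp add: c_def complex_norm_square mult.commute del: of_real_power)
  also have "(cmod c * l2_norm M f)\<^sup>2 = (cmod (l2_inner M g f))\<^sup>2 / (l2_norm M f)\<^sup>2"
  proof -
    have "cmod c = cmod (l2_inner M g f) / (l2_norm M f)\<^sup>2"
      by (simp add: c_def norm_divide norm_power)
    then show ?thesis using F by (simp add: power_mult_distrib power_divide power2_eq_square)
  qed
  finally have "(cmod (l2_inner M g f))\<^sup>2 \<le> (l2_norm M f * l2_norm M g)\<^sup>2"
    using F by (simp add: field_simps power_mult_distrib)
  then have "cmod (l2_inner M g f) \<le> l2_norm M f * l2_norm M g"
    by (rule power2_le_imp_le) simp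
  then show ?thesis unfolding l2_inner_commute[of M f g] by simp
qed

lemma l2_norm_triangle:
  assumes "f \<in> L2 M" "g \<in> L2 M"
  shows "l2_norm M (\<lambda>p. f p + g p) \<le> l2_norm M f + l2_norm M g"
proof (rule power2_le_imp_le)
  have "Re (l2_inner M f g) \<le> l2_norm M f * l2_norm M g"
    using l2_Cauchy_Schwarz[OF assms] complex_Re_le_cmod order_trans by blast
  then show "(l2_norm M (\<lambda>p. f p + g p))\<^sup>2 \<le> (l2_norm M f + l2_norm M g)\<^sup>2"
    unfolding l2_norm_sq_add[OF assms] by (simp add: power2_sum)
qed simp

section \<open>Bounded operators and polarization\<close>

lemma bounded_opD:
  assumes "bounded_op M S"
  shows "f \<in> L2 M \<Longrightarrow> S f \<in> L2 M"
    and "\<lbrakk>f \<in> L2 M; g \<in> L2 M\<rbrakk> \<Longrightarrow> AE p in M. S (\<lambda>q. a * f q + b * g q) p = a * S f p + b * S g p"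
  using assms by (auto simp: bounded_op_def bounded_op_by_def)

lemma l2_inner_op_lincomb:
  assumes S: "bounded_op M S" and f: "f \<in> L2 M" and g: "g \<in> L2 M" and h: "h \<in> L2 M"
  shows "l2_inner M (S (\<lambda>q. a * f q + b * g q)) h = a * l2_inner M (S f) h + b * l2_inner M (S g) h"
proof -
  note [simp] = bounded_opD(1)[OF S] L2_scale L2_add f g h
  have "l2_inner M (S (\<lambda>q. a * f q + b * g q)) h = l2_inner M (\<lambda>p. a * S f p + b * S g p) h"
    using bounded_opD(2)[OF S f g] by (intro l2_inner_cong_AE) auto
  then show ?thesis by (simp add: l2_inner_add_left l2_inner_scale_left)
qed

lemma l2_inner_op_add:
  assumes S: "bounded_op M S" and f: "f \<in> L2 M" and g: "g \<in> L2 M"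
  shows "l2_inner M (S (\<lambda>q. f q + c * g q)) (\<lambda>q. f q + c * g q) =
    l2_inner M (S f) f + cnj c * l2_inner M (S f) g + c * l2_inner M (S g) f
      + c * cnj c * l2_inner M (S g) g"
  using l2_inner_op_lincomb[OF S f g, of "\<lambda>q. f q + c * g q" 1 c]
  by (simp add: L2_scale L2_add l2_inner_add_right l2_inner_scale_right bounded_opD(1)[OF S] f g algebra_simps)

lemma sum_fourth_roots_unity:
  fixes F :: "complex \<Rightarrow> 'b::comm_monoid_add"
  shows "(\<Sum>c\<in>{1, -1, \<i>, -\<i>}. F c) = F 1 + F (-1) + F \<i> + F (-\<i>)"
  by (simp add: complex_eq_iff add.assoc)

text \<open>The weight \<open>c\<close> keeps only the term that carries \<open>cnj c\<close>: over
  the fourth roots of unity the sums of \<open>c\<close> and of \<open>c * c\<close> vanish.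
  Identities between diagonal forms, the only ones that the definition of a spectral measure offers,
  thereby pass to all coefficients.\<close>

lemma l2_polarization:
  assumes S: "bounded_op M S" and f: "f \<in> L2 M" and g: "g \<in> L2 M"
  shows "4 * l2_inner M (S f) g =
    (\<Sum>c\<in>{1, -1, \<i>, -\<i>}. c * l2_inner M (S (\<lambda>q. f q + c * g q)) (\<lambda>q. f q + c * g q))"
  unfolding l2_inner_op_add[OF S f g] sum_fourth_roots_unity by (simp add: algebra_simps)

text \<open>Polarization bounds a mixed coefficient by four diagonal ones; the cross terms of the
  four squared norms cancel and a sum of two squares remains. Rescaling \<open>g\<close> in an
  application turns this into an operator norm bound of \<open>2 * \<epsilon>\<close>.\<close>

lemma numerical_range_bound:
  assumes S: "bounded_op M S" and f: "f \<in> L2 M" and g: "g \<in> L2 M"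
    and b: "\<And>c. cmod (l2_inner M (S (\<lambda>q. f q + c * g q)) (\<lambda>q. f q + c * g q))
      \<le> \<epsilon> * (l2_norm M (\<lambda>q. f q + c * g q))\<^sup>2"
  shows "cmod (l2_inner M (S f) g) \<le> \<epsilon> * ((l2_norm M f)\<^sup>2 + (l2_norm M g)\<^sup>2)"
proof -
  define h where "h = (\<lambda>c q. f q + c * g q)"
  have "4 * cmod (l2_inner M (S f) g) = cmod (4 * l2_inner M (S f) g)" by (simp add: norm_mult)
  also have "\<dots> \<le> (\<Sum>c\<in>{1, -1, \<i>, -\<i>}. cmod (c * l2_inner M (S (h c)) (h c)))"
    unfolding l2_polarization[OF S f g] h_def by (rule norm_sum)
  also have "\<dots> \<le> (\<Sum>c\<in>{1, -1, \<i>, -\<i>}. \<epsilon> * (l2_norm M (h c))\<^sup>2)"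
  proof (rule sum_mono)
    fix c :: complex assume "c \<in> {1, -1, \<i>, -\<i>}"
    then have "cmod c = 1" by auto
    then show "cmod (c * l2_inner M (S (h c)) (h c)) \<le> \<epsilon> * (l2_norm M (h c))\<^sup>2"
      using b[of c] by (simp add: norm_mult h_def)
  qed
  also have "\<dots> = (\<Sum>c\<in>{1, -1, \<i>, -\<i>}. \<epsilon> * ((l2_norm M f)\<^sup>2 + (l2_norm M g)\<^sup>2 + 2 * Re (cnj c * l2_inner M f g)))"
  proof (rule sum.cong, rule refl)
    fix c :: complex assume "c \<in> {1, -1, \<i>, -\<i>}"
    then have "cmod c = 1" by auto
    then show "\<epsilon> * (l2_norm M (h c))\<^sup>2 = \<epsilon> * ((l2_norm M f)\<^sup>2 + (l2_norm M g)\<^sup>2 + 2 * Re (cnj c * l2_inner M f g))"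
      unfolding h_def by (simp add: l2_norm_sq_add f g L2_scale l2_norm_scale l2_inner_scale_right)
  qed
  also have "\<dots> = 4 * (\<epsilon> * ((l2_norm M f)\<^sup>2 + (l2_norm M g)\<^sup>2))"
    unfolding sum_fourth_roots_unity by (simp add: algebra_simps)
  finally show ?thesis by simp
qed

section \<open>Polynomials on an interval\<close>

text \<open>The ratio of binomials is the product of \<open>(k - i) / (n - i)\<close> over
  \<open>i < m\<close>. Each factor differs from \<open>k / n\<close> by
  \<open>i * (n - k) / ((n - i) * n)\<close>, and \<open>2 * m \<le> n\<close> keeps
  \<open>n - i\<close> above \<open>n / 2\<close>; all factors lie in \<open>[0, 1]\<close>, so the
  \<open>m\<close> errors just add up.\<close>

lemma falling_ratio_bound:
  fixes n k m :: nat
  assumes "m \<le> k" "k \<le> n" "2 * m \<le> n" "0 < n"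
  shows "\<bar>real ((n - m) choose (k - m)) / real (n choose k) - (real k / real n) ^ m\<bar> \<le> 2 * (real m)\<^sup>2 / real n"
proof -
  have r: "real ((n - m) choose (k - m)) / real (n choose k) = (\<Prod>i<m. real (k - i) / real (n - i))"
    using assms(1,3)
  proof (induction m)
    case 0 then show ?case using assms by simp
  next
    case (Suc m)
    have "(n - m) * ((n - Suc m) choose (k - Suc m)) = (k - m) * ((n - m) choose (k - m))"
      using Suc.prems assms(2) binomial_absorption[of "k - Suc m" "n - m"]
      by (simp add: Suc_diff_Suc)
    then have "real (n - m) * real ((n - Suc m) choose (k - Suc m)) = real (k - m) * real ((n - m) choose (k - m))"
      by (metis of_nat_mult)
    moreover have "real (n - m) > 0" using Suc.prems by simp
    ultimately have "real ((n - Suc m) choose (k - Suc m)) = real (k - m) / real (n - m) * real ((n - m) choose (k - m))"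
      by (simp add: field_simps)
    then have "real ((n - Suc m) choose (k - Suc m)) / real (n choose k) =
        real (k - m) / real (n - m) * (real ((n - m) choose (k - m)) / real (n choose k))" by simp
    also have "\<dots> = real (k - m) / real (n - m) * (\<Prod>i<m. real (k - i) / real (n - i))"
      using Suc by simp
    finally show ?case by (simp add: mult.commute del: of_nat_diff)
  qed
  have f: "\<bar>real (k - i) / real (n - i) - real k / real n\<bar> \<le> 2 * real m / real n" if "i < m" for i
  proof -
    have "real (k - i) / real (n - i) - real k / real n = - (real i * (real n - real k) / (real (n - i) * real n))"
      using that assms by (simp add: field_simps of_nat_diff)
    then have "\<bar>real (k - i) / real (n - i) - real k / real n\<bar> = real i * (real n - real k) / (real (n - i) * real n)"
      using assms by simp
    also have "\<dots> \<le> real m * real n / ((real n / 2) * real n)"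
      using that assms by (intro frac_le mult_mono mult_pos_pos) (auto simp: of_nat_diff)
    also have "\<dots> = 2 * real m / real n" using assms by simp
    finally show ?thesis .
  qed
  have "\<bar>(\<Prod>i<m. real (k - i) / real (n - i)) - (\<Prod>i<m. real k / real n)\<bar>
      \<le> (\<Sum>i<m. \<bar>real (k - i) / real (n - i) - real k / real n\<bar>)"
    unfolding real_norm_def[symmetric] by (rule norm_prod_diff) (use assms in \<open>auto simp: divide_simps\<close>)
  also have "\<dots> \<le> (\<Sum>i<m. 2 * real m / real n)" by (rule sum_mono) (use f in auto)
  also have "\<dots> = 2 * (real m)\<^sup>2 / real n" by (simp add: power2_eq_square)
  finally show ?thesis unfolding r by simp
qed

text \<open>Covers the indices \<open>k < m\<close>, at which the Bernstein expansion of
  \<open>t^m\<close> has coefficient zero while the value at \<open>k / n\<close> is not zero but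
  small.\<close>

lemma falling_ratio_bound_small:
  fixes n k m :: nat
  assumes "k < m" "2 * m \<le> n"
  shows "(real k / real n) ^ m \<le> 2 * (real m)\<^sup>2 / real n"
proof -
  have "(real k / real n) ^ m \<le> (real k / real n) ^ 1"
    using assms by (intro power_decreasing) (auto simp: divide_simps)
  also have "\<dots> \<le> real m * 2 * real m / real n"
    using assms by (auto intro!: divide_right_mono) (smt (verit) mult_left_mono mult_le_cancel_left1 of_nat_0_le_iff of_nat_less_iff One_nat_def Suc_leI of_nat_1 of_nat_mono le_less_trans zero_le)
  finally show ?thesis by (simp add: power2_eq_square algebra_simps)
qed

text \<open>Multiply the binomial expansion of \<open>1 = (t + (1 - t))^(n - m)\<close> by
  \<open>t^m\<close> and shift the index by \<open>m\<close>.\<close>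

lemma monom_Bernstein:
  fixes n m :: nat assumes "m \<le> n"
  shows "monom (1::real) m = (\<Sum>k\<in>{m..n}. smult (real ((n - m) choose (k - m))) (monom 1 k * [:1, -1:] ^ (n - k)))"
proof -
  have "[:0,1:] + [:1,-1:] = (1::real poly)" by (simp add: one_pCons)
  then have "(1::real poly) = ([:0,1:] + [:1,-1:]) ^ (n - m)" by (simp only: power_one)
  also have "\<dots> = (\<Sum>j\<le>n - m. of_nat ((n - m) choose j) * [:0,1:] ^ j * [:1,-1:] ^ (n - m - j))"
    by (rule binomial_ring)
  finally have 1: "(1::real poly) = \<dots>" .
  have "monom (1::real) m = monom 1 m * 1" by simp
  also have "\<dots> = (\<Sum>j\<le>n - m. monom 1 m * (of_nat ((n - m) choose j) * [:0,1:] ^ j * [:1,-1:] ^ (n - m - j)))"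
    by (subst 1) (simp only: sum_distrib_left)
  also have "\<dots> = (\<Sum>k\<in>{m..n}. smult (real ((n - m) choose (k - m))) (monom 1 k * [:1, -1:] ^ (n - k)))"
  proof (rule sum.reindex_bij_witness[of _ "\<lambda>k. k - m" "\<lambda>j. j + m"])
    fix j assume "j \<in> {..n - m}"
    then have "n - (j + m) = n - m - j" by simp
    then show "smult (real ((n - m) choose (j + m - m))) (monom 1 (j + m) * [:1, -1:] ^ (n - (j + m))) =
        monom 1 m * (of_nat ((n - m) choose j) * [:0,1:] ^ j * [:1,-1:] ^ (n - m - j))"
      by (simp add: monom_altdef of_nat_poly power_add algebra_simps)
  qed (use assms in auto)
  finally show ?thesis .
qed

text \<open>Bernstein's argument: a linear functional that is nonnegative on all \<open>t\<^sup>i (1 - t)\<^sup>j\<close> is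
  nonnegative on the polynomials that are nonnegative on \<open>[0,1]\<close>. The coefficients of \<open>p\<close> in the
  Bernstein basis of order \<open>n\<close> differ from the values \<open>p (k/n)\<close> by \<open>O(1/n)\<close>.\<close>

lemma Bernstein_nonneg:
  fixes \<phi> :: "real poly \<Rightarrow> real"
  assumes add: "\<And>p q. \<phi> (p + q) = \<phi> p + \<phi> q" and smult: "\<And>c p. \<phi> (smult c p) = c * \<phi> p"
    and pos: "\<And>i j. 0 \<le> \<phi> (monom 1 i * [:1, -1:] ^ j)"
    and p: "\<And>t. 0 \<le> t \<Longrightarrow> t \<le> 1 \<Longrightarrow> 0 \<le> poly p t"
  shows "0 \<le> \<phi> p"
proof -
  have zero: "\<phi> 0 = 0" using smult[of 0 0] by simp
  have sum: "\<phi> (\<Sum>i\<in>I. f i) = (\<Sum>i\<in>I. \<phi> (f i))" for I :: "nat set" and f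
    by (induction I rule: infinite_finite_induct) (auto simp: add zero)
  define D where "D = degree p"
  \<comment> \<open>\<open>K / n\<close> is the total of the two ratio bounds over all coefficients
    of \<open>p\<close>, hence a bound for the distance between the Bernstein coefficient
    \<open>c k\<close> and the value of \<open>p\<close> at \<open>k / n\<close>.\<close>
  define K where "K = (\<Sum>m\<le>D. \<bar>coeff p m\<bar> * (2 * (real m)\<^sup>2))"
  have b: "- (K / real n * \<phi> 1) \<le> \<phi> p" if n: "n > 0" "n \<ge> 2 * D" for n
  proof -
    define B where "B k = (monom 1 k * [:1, -1:] ^ (n - k) :: real poly)" for k
    define c where "c k = (\<Sum>m\<le>D. coeff p m * (if m \<le> k then real ((n - m) choose (k - m)) / real (n choose k) else 0))" for k
    have "p = (\<Sum>m\<le>D. smult (coeff p m) (monom 1 m))"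
      unfolding D_def by (simp add: poly_as_sum_of_monoms smult_monom)
    then have "\<phi> p = (\<Sum>m\<le>D. coeff p m * \<phi> (monom 1 m))"
      by (metis (no_types, lifting) sum smult sum.cong)
    also have "\<dots> = (\<Sum>m\<le>D. coeff p m * (\<Sum>k\<in>{m..n}. real ((n - m) choose (k - m)) * \<phi> (B k)))"
    proof (rule sum.cong, rule refl)
      fix m assume "m \<in> {..D}"
      then have mn: "m \<le> n" using n by simp
      show "coeff p m * \<phi> (monom 1 m) = coeff p m * (\<Sum>k\<in>{m..n}. real ((n - m) choose (k - m)) * \<phi> (B k))"
        by (subst monom_Bernstein[OF mn]) (simp add: sum smult B_def)
    qed
    also have "\<dots> = (\<Sum>m\<le>D. \<Sum>k\<le>n. coeff p m * (if m \<le> k then real ((n - m) choose (k - m)) else 0) * \<phi> (B k))"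
    proof (rule sum.cong, rule refl)
      fix m assume "m \<in> {..D}"
      have "(\<Sum>k\<in>{m..n}. real ((n - m) choose (k - m)) * \<phi> (B k))
        = (\<Sum>k\<le>n. if m \<le> k then real ((n - m) choose (k - m)) * \<phi> (B k) else 0)"
        by (rule sum.mono_neutral_cong_left) auto
      then show "coeff p m * (\<Sum>k\<in>{m..n}. real ((n - m) choose (k - m)) * \<phi> (B k)) =
        (\<Sum>k\<le>n. coeff p m * (if m \<le> k then real ((n - m) choose (k - m)) else 0) * \<phi> (B k))"
        by (auto simp: sum_distrib_left intro!: sum.cong)
    qed
    also have "\<dots> = (\<Sum>k\<le>n. \<Sum>m\<le>D. coeff p m * (if m \<le> k then real ((n - m) choose (k - m)) else 0) * \<phi> (B k))"
      by (rule sum.swap)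
    also have "\<dots> = (\<Sum>k\<le>n. c k * (real (n choose k) * \<phi> (B k)))"
      unfolding c_def sum_distrib_right by (intro sum.cong refl) auto
    finally have 1: "\<phi> p = (\<Sum>k\<le>n. c k * (real (n choose k) * \<phi> (B k)))" .
    have "(1::real poly) = monom 1 0" by (simp add: monom_altdef)
    also have "\<dots> = (\<Sum>k\<in>{0..n}. smult (real (n choose k)) (B k))"
      using monom_Bernstein[of 0 n] by (simp add: B_def)
    finally have 2: "\<phi> 1 = (\<Sum>k\<le>n. real (n choose k) * \<phi> (B k))"
      by (metis (no_types, lifting) sum smult sum.cong atMost_atLeast0)
    have ck: "- (K / real n) \<le> c k" if "k \<le> n" for k
    proof -
      define g where "g m = (if m \<le> k then real ((n - m) choose (k - m)) / real (n choose k) else 0)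
        - (real k / real n) ^ m" for m
      have g: "\<bar>g m\<bar> \<le> 2 * (real m)\<^sup>2 / real n" if "m \<le> D" for m
      proof (cases "m \<le> k")
        case True
        then show ?thesis using falling_ratio_bound[of m k n] that n \<open>k \<le> n\<close> by (simp add: g_def)
      next
        case False
        then show ?thesis using falling_ratio_bound_small[of k m n] that n \<open>k \<le> n\<close> by (simp add: g_def)
      qed
      have "c k - poly p (real k / real n) = (\<Sum>m\<le>D. coeff p m * g m)"
        unfolding c_def poly_altdef D_def g_def by (simp add: sum_subtractf right_diff_distrib)
      then have "\<bar>c k - poly p (real k / real n)\<bar> \<le> (\<Sum>m\<le>D. \<bar>coeff p m * g m\<bar>)"
        by (simp only: sum_abs)
      also have "\<dots> \<le> (\<Sum>m\<le>D. \<bar>coeff p m\<bar> * (2 * (real m)\<^sup>2) / real n)"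
      proof (rule sum_mono)
        fix m assume "m \<in> {..D}"
        then have "\<bar>coeff p m\<bar> * \<bar>g m\<bar> \<le> \<bar>coeff p m\<bar> * (2 * (real m)\<^sup>2 / real n)"
          by (intro mult_left_mono g) auto
        then show "\<bar>coeff p m * g m\<bar> \<le> \<bar>coeff p m\<bar> * (2 * (real m)\<^sup>2) / real n"
          by (simp add: abs_mult)
      qed
      also have "\<dots> = K / real n" unfolding K_def sum_divide_distrib ..
      finally have "poly p (real k / real n) - K / real n \<le> c k" by linarith
      moreover have "0 \<le> poly p (real k / real n)" using that n by (intro p) (auto simp: divide_simps)
      ultimately show ?thesis by linarith
    qed
    have "- (K / real n * \<phi> 1) = (\<Sum>k\<le>n. - (K / real n) * (real (n choose k) * \<phi> (B k)))"
      unfolding 2 by (simp add: sum_distrib_left sum_negf)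
    also have "\<dots> \<le> \<phi> p"
      unfolding 1 by (intro sum_mono mult_right_mono ck) (auto simp: B_def pos)
    finally show ?thesis .
  qed
  have "(\<lambda>n. - (K / real n * \<phi> 1)) \<longlonglongrightarrow> - (0 * \<phi> 1)"
    by (intro tendsto_intros lim_const_over_n)
  then have "(\<lambda>n. - (K / real n * \<phi> 1)) \<longlonglongrightarrow> 0" by simp
  then show ?thesis
    by (rule LIMSEQ_le_const2) (intro exI[of _ "Suc (2 * D)"] allI impI b, auto)
qed

lemma interval_nonneg_functional:
  fixes \<phi> :: "real poly \<Rightarrow> real" and N :: real
  assumes N: "N > 0"
    and add: "\<And>p q. \<phi> (p + q) = \<phi> p + \<phi> q" and smult: "\<And>c p. \<phi> (smult c p) = c * \<phi> p"
    and pos: "\<And>i j. 0 \<le> \<phi> ([:N, 1:] ^ i * [:N, -1:] ^ j)"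
    and p: "\<And>t. \<bar>t\<bar> \<le> N \<Longrightarrow> 0 \<le> poly p t"
  shows "0 \<le> \<phi> p"
proof -
  \<comment> \<open>The functional is transported by the affine map \<open>(N + t) / (2 * N)\<close>
    from \<open>[-N, N]\<close> onto \<open>[0, 1]\<close>; the generators \<open>t\<close> and
    \<open>1 - t\<close> become positive multiples of \<open>N + t\<close> and
    \<open>N - t\<close>.\<close>
  define \<phi>' where "\<phi>' q = \<phi> (pcompose q [:1/2, 1/(2*N):])" for q
  have "0 \<le> \<phi>' (pcompose p [:-N, 2 * N:])"
  proof (rule Bernstein_nonneg)
    fix i j
    have "pcompose (monom 1 i * [:1, -1:] ^ j) [:1/2, 1/(2*N):] = smult ((1/(2*N)) ^ (i + j)) ([:N, 1:] ^ i * [:N, -1:] ^ j)"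
    proof -
      have 1: "[:1/2, 1/(2*N):] = smult (1/(2*N)) [:N, 1:]" using N by simp
      have 2: "pcompose [:1, -1:] [:1/2, 1/(2*N):] = smult (1/(2*N)) [:N, -1:]"
        using N by (simp add: pcompose_pCons one_pCons)
      have pw: "pcompose (q ^ k) r = pcompose q r ^ k" for q r :: "real poly" and k
        by (induction k) (simp_all add: pcompose_mult pcompose_1)
      have "pcompose (monom 1 i * [:1, -1:] ^ j) [:1/2, 1/(2*N):] = [:1/2, 1/(2*N):] ^ i * pcompose [:1, -1:] [:1/2, 1/(2*N):] ^ j"
        by (simp add: pcompose_mult monom_altdef pw) (simp add: pcompose_pCons)
      then show ?thesis unfolding 2 unfolding 1
        by (simp only: smult_power power_add mult_smult_left mult_smult_right smult_smult mult.commute)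
    qed
    then show "0 \<le> \<phi>' (monom 1 i * [:1, -1:] ^ j)" using pos N by (simp add: \<phi>'_def smult)
  next
    fix t :: real assume "0 \<le> t" "t \<le> 1"
    then have "\<bar>2 * N * t - N\<bar> \<le> N"
      using N mult_left_le[of t "2*N"] by (auto simp: abs_le_iff)
    then show "0 \<le> poly (pcompose p [:-N, 2 * N:]) t" using p by (simp add: poly_pcompose mult.commute)
  qed (simp_all add: \<phi>'_def pcompose_add pcompose_smult add smult)
  also have "pcompose (pcompose p [:-N, 2 * N:]) [:1/2, 1/(2*N):] = p"
    using N by (simp add: pcompose_assoc[symmetric] pcompose_pCons)
  then have "\<phi>' (pcompose p [:-N, 2 * N:]) = \<phi> p" by (simp add: \<phi>'_def)
  finally show ?thesis .
qed

section \<open>Polynomial approximation of continuous functions and of indicators\<close>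

lemma Weierstrass_poly:
  fixes f :: "real \<Rightarrow> real"
  assumes "continuous_on {a..b} f" "0 < e"
  obtains p :: "real poly" where "\<And>x. x \<in> {a..b} \<Longrightarrow> \<bar>f x - poly p x\<bar> < e"
proof -
  obtain g where g: "real_polynomial_function g" "\<And>x. x \<in> {a..b} \<Longrightarrow> \<bar>f x - g x\<bar> < e"
    using Stone_Weierstrass_real_polynomial_function[of "{a..b}" f e] assms by auto
  then obtain c n where "g = (\<lambda>x. \<Sum>i\<le>n. c i * x ^ i)" using real_polynomial_function_iff_sum by auto
  then have "g x = poly (\<Sum>i\<le>n. monom (c i) i) x" for x by (simp add: poly_sum poly_monom)
  then show ?thesis using g(2) that by metis
qed

text \<open>The continuous ramps \<open>h n\<close> decrease to the indicator. With
  \<open>e n = 2^(-n)\<close>, the polynomial approximates \<open>h n + 3 * e n\<close> within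
  \<open>e n\<close>, so it lies between \<open>h n + 2 * e n\<close> and
  \<open>h n + 4 * e n\<close>. The upper bound at \<open>n + 1\<close> is
  \<open>h (n + 1) + 2 * e n\<close>, hence not above the lower bound at \<open>n\<close>: the
  sequence decreases. As \<open>h\<close> and \<open>e\<close> are at most 1, the bound is
  \<open>1 + 4 = 5\<close>.\<close>

lemma decreasing_polys_to_indicator:
  fixes c N :: real
  obtains p :: "nat \<Rightarrow> real poly" where
    "\<And>n s. \<bar>s\<bar> \<le> N \<Longrightarrow> 0 \<le> poly (p n) s" "\<And>n s. \<bar>s\<bar> \<le> N \<Longrightarrow> poly (p n) s \<le> 5"
    "\<And>n s. \<bar>s\<bar> \<le> N \<Longrightarrow> poly (p (Suc n)) s \<le> poly (p n) s"
    "\<And>s. \<bar>s\<bar> \<le> N \<Longrightarrow> (\<lambda>n. poly (p n) s) \<longlonglongrightarrow> (if c \<le> s then 1 else 0)"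
proof -
  define h where "h n s = max 0 (1 - real n * max 0 (c - s))" for n :: nat and s :: real
  define e where "e n = (1/2::real) ^ n" for n :: nat
  have e: "0 < e n" "e n \<le> 1" "e (Suc n) = e n / 2" for n by (auto simp: e_def power_le_one)
  have h: "0 \<le> h n s" "h n s \<le> 1" "h (Suc n) s \<le> h n s" for n s
    unfolding h_def using mult_right_mono[of "real n" "real (Suc n)" "max 0 (c - s)"] by auto
  have "\<exists>p. \<forall>s\<in>{-N..N}. \<bar>h n s + 3 * e n - poly p s\<bar> < e n" for n
  proof -
    have "continuous_on {-N..N} (\<lambda>s. h n s + 3 * e n)"
      unfolding h_def by (intro continuous_intros)
    then show ?thesis using Weierstrass_poly[of "-N" N "\<lambda>s. h n s + 3 * e n" "e n"] e(1) by metis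
  qed
  then obtain p where p: "\<And>n s. s \<in> {-N..N} \<Longrightarrow> \<bar>h n s + 3 * e n - poly (p n) s\<bar> < e n" by metis
  show ?thesis
  proof (rule that[of p])
    fix n :: nat and s :: real assume s: "\<bar>s\<bar> \<le> N"
    then have s': "s \<in> {-N..N}" by auto
    show "0 \<le> poly (p n) s" "poly (p n) s \<le> 5" "poly (p (Suc n)) s \<le> poly (p n) s"
      using p[OF s', of n] p[OF s', of "Suc n"] h[of n s] e[of n] by (auto simp: abs_if split: if_splits)
  next
    fix s :: real assume s: "\<bar>s\<bar> \<le> N"
    then have s': "s \<in> {-N..N}" by auto
    have e0: "e \<longlonglongrightarrow> 0" unfolding e_def by (rule LIMSEQ_power_zero) simp
    have "(\<lambda>n. h n s) \<longlonglongrightarrow> (if c \<le> s then 1 else 0)"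
    proof (cases "c \<le> s")
      case True then show ?thesis by (simp add: h_def)
    next
      case False
      obtain n0 :: nat where "1 / (c - s) \<le> real n0" using real_arch_simple by blast
      then have "1 \<le> real n * (c - s)" if "n \<ge> n0" for n
        using False that by (smt (verit) divide_le_eq of_nat_mono mult_right_mono)
      then have "h n s = 0" if "n \<ge> n0" for n using that False by (auto simp: h_def)
      then show ?thesis using False by (auto intro!: tendsto_eventually eventually_sequentiallyI[of n0])
    qed
    then have "(\<lambda>n. h n s + 3 * e n) \<longlonglongrightarrow> (if c \<le> s then 1 else 0) + 3 * 0"
      using e0 by (intro tendsto_intros)
    moreover have "(\<lambda>n. poly (p n) s - (h n s + 3 * e n)) \<longlonglongrightarrow> 0"
      by (rule tendsto_rabs_zero_cancel, rule tendsto_sandwich[OF _ _ tendsto_const e0])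
         (use p[OF s'] in \<open>auto simp: abs_minus_commute less_imp_le\<close>)
    ultimately show "(\<lambda>n. poly (p n) s) \<longlonglongrightarrow> (if c \<le> s then 1 else 0)"
      using tendsto_add by fastforce
  qed
qed

section \<open>Operators generated by measure-preserving involutions\<close>

definition walk :: "nat \<Rightarrow> (nat \<Rightarrow> 'b \<Rightarrow> 'b) \<Rightarrow> 'b oper" where
  "walk N \<rho> f p = (\<Sum>j\<in>{1..N}. f (\<rho> j p))"

text \<open>Defined pointwise on all functions and not on classes modulo null sets, so the algebraic
  rules hold at every point. The same operator can thus be read on the relation and on each of its
  fibres.\<close>

definition poly_op :: "nat \<Rightarrow> (nat \<Rightarrow> 'b \<Rightarrow> 'b) \<Rightarrow> real poly \<Rightarrow> 'b oper" where
  "poly_op N \<rho> q f p = (\<Sum>i\<le>degree q. of_real (coeff q i) * (walk N \<rho> ^^ i) f p)"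

lemma walk_lincomb: "walk N \<rho> (\<lambda>p. a * f p + b * g p) = (\<lambda>p. a * walk N \<rho> f p + b * walk N \<rho> g p)"
  by (simp add: walk_def fun_eq_iff sum.distrib sum_distrib_left)

lemma walk_sum: "walk N \<rho> (\<lambda>p. \<Sum>i\<in>I. c i * f i p) = (\<lambda>p. \<Sum>i\<in>I. c i * walk N \<rho> (f i) p)"
  by (rule ext) (simp add: walk_def sum_distrib_left sum.swap[of _ I])

lemma poly_op_extend:
  "degree q \<le> n \<Longrightarrow> poly_op N \<rho> q f p = (\<Sum>i\<le>n. of_real (coeff q i) * (walk N \<rho> ^^ i) f p)"
  unfolding poly_op_def by (rule sum.mono_neutral_left) (auto simp: coeff_eq_0)

lemma poly_op_add: "poly_op N \<rho> (q + r) f p = poly_op N \<rho> q f p + poly_op N \<rho> r f p"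
proof -
  define n where "n = max (degree q) (degree r)"
  have "degree (q + r) \<le> n" "degree q \<le> n" "degree r \<le> n"
    by (auto simp: n_def degree_add_le)
  then show ?thesis by (simp add: poly_op_extend[of _ n] sum.distrib distrib_right)
qed

lemma poly_op_smult: "poly_op N \<rho> (smult c q) f p = of_real c * poly_op N \<rho> q f p"
  by (simp add: poly_op_extend[of "smult c q" "degree q"] degree_smult_le poly_op_def sum_distrib_left mult.assoc)

lemma poly_op_0 [simp]: "poly_op N \<rho> 0 f p = 0"
  by (simp add: poly_op_def)

lemma poly_op_const [simp]: "poly_op N \<rho> [:c:] f p = of_real c * f p"
  by (simp add: poly_op_def)

lemma poly_op_pCons: "poly_op N \<rho> (pCons a q) f p = of_real a * f p + walk N \<rho> (poly_op N \<rho> q f) p"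
proof -
  have "poly_op N \<rho> (pCons a q) f p = (\<Sum>i\<le>Suc (degree q). of_real (coeff (pCons a q) i) * (walk N \<rho> ^^ i) f p)"
    by (rule poly_op_extend) (rule degree_pCons_le)
  also have "\<dots> = of_real a * f p + (\<Sum>i\<le>degree q. of_real (coeff q i) * walk N \<rho> ((walk N \<rho> ^^ i) f) p)"
    by (subst sum.atMost_Suc_shift) simp
  also have "(\<Sum>i\<le>degree q. of_real (coeff q i) * walk N \<rho> ((walk N \<rho> ^^ i) f) p) = walk N \<rho> (poly_op N \<rho> q f) p"
    unfolding poly_op_def using walk_sum[of N \<rho> "\<lambda>i. of_real (coeff q i)" "\<lambda>i. (walk N \<rho> ^^ i) f" "{..degree q}"]
    by (simp add: fun_eq_iff)
  finally show ?thesis .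
qed

lemma poly_op_X: "poly_op N \<rho> [:0, 1:] = walk N \<rho>"
  by (simp add: poly_op_def fun_eq_iff)

lemma poly_op_mult: "poly_op N \<rho> (q * r) f = poly_op N \<rho> q (poly_op N \<rho> r f)"
proof (induction q)
  case (pCons a q)
  show ?case
    by (rule ext) (simp add: poly_op_add poly_op_smult poly_op_pCons pCons.IH)
qed (simp add: fun_eq_iff)

lemma poly_op_lincomb:
  "poly_op N \<rho> q (\<lambda>p. a * f p + b * g p) = (\<lambda>p. a * poly_op N \<rho> q f p + b * poly_op N \<rho> q g p)"
proof (induction q)
  case (pCons c q)
  show ?case
    by (rule ext, unfold poly_op_pCons pCons.IH walk_lincomb) (simp add: algebra_simps)
qed (simp add: fun_eq_iff)

text \<open>Three instances occur: \<open>rel_measure\<close> on the orbit relation, counting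
  measure on a single orbit, and counting measure on the vertices of a finite graph.\<close>

locale walk_system =
  fixes M :: "'b measure" and N :: nat and \<rho> :: "nat \<Rightarrow> 'b \<Rightarrow> 'b"
  assumes N_pos: "0 < N"
    and \<rho>_meas: "j \<in> {1..N} \<Longrightarrow> \<rho> j \<in> measurable M M"
    and \<rho>_invol: "j \<in> {1..N} \<Longrightarrow> p \<in> space M \<Longrightarrow> \<rho> j (\<rho> j p) = p"
    and \<rho>_pres: "j \<in> {1..N} \<Longrightarrow> distr M M (\<rho> j) = M"
begin

abbreviation "A \<equiv> walk N \<rho>"
abbreviation "pA \<equiv> poly_op N \<rho>"

lemma \<rho>_L2:
  assumes j: "j \<in> {1..N}" and f: "f \<in> L2 M" shows "(\<lambda>p. f (\<rho> j p)) \<in> L2 M"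
proof -
  note [measurable] = \<rho>_meas[OF j] L2D(1)[OF f]
  have "integrable (distr M M (\<rho> j)) (\<lambda>p. (cmod (f p))\<^sup>2)"
    unfolding \<rho>_pres[OF j] by (rule L2D(2)[OF f])
  then have "integrable M (\<lambda>p. (cmod (f (\<rho> j p)))\<^sup>2)"
    by (subst (asm) integrable_distr_eq) auto
  then show ?thesis by (simp add: L2_def)
qed

lemma \<rho>_inner:
  assumes j: "j \<in> {1..N}" and f: "f \<in> L2 M" and g: "g \<in> L2 M"
  shows "l2_inner M (\<lambda>p. f (\<rho> j p)) (\<lambda>p. g (\<rho> j p)) = l2_inner M f g"
proof -
  note [measurable] = \<rho>_meas[OF j] L2D(1)[OF f] L2D(1)[OF g]
  have "l2_inner M f g = (LINT p|distr M M (\<rho> j). f p * cnj (g p))"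
    unfolding l2_inner_def \<rho>_pres[OF j] ..
  also have "\<dots> = l2_inner M (\<lambda>p. f (\<rho> j p)) (\<lambda>p. g (\<rho> j p))"
    unfolding l2_inner_def by (subst integral_distr) auto
  finally show ?thesis ..
qed

lemma \<rho>_adjoint:
  assumes j: "j \<in> {1..N}" and f: "f \<in> L2 M" and g: "g \<in> L2 M"
  shows "l2_inner M (\<lambda>p. f (\<rho> j p)) g = l2_inner M f (\<lambda>p. g (\<rho> j p))"
proof -
  have "l2_inner M f (\<lambda>p. g (\<rho> j p)) = l2_inner M (\<lambda>p. f (\<rho> j p)) (\<lambda>p. g (\<rho> j (\<rho> j p)))"
    using \<rho>_inner[OF j f \<rho>_L2[OF j g]] by simp
  also have "\<dots> = l2_inner M (\<lambda>p. f (\<rho> j p)) g"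
    unfolding l2_inner_def by (rule Bochner_Integration.integral_cong) (auto simp: \<rho>_invol[OF j])
  finally show ?thesis ..
qed

lemma walk_L2: "f \<in> L2 M \<Longrightarrow> A f \<in> L2 M"
  unfolding walk_def by (intro L2_sum \<rho>_L2)

lemma walk_inner: "f \<in> L2 M \<Longrightarrow> g \<in> L2 M \<Longrightarrow> l2_inner M (A f) g = (\<Sum>j\<in>{1..N}. l2_inner M (\<lambda>p. f (\<rho> j p)) g)"
  unfolding walk_def by (rule l2_inner_sum_left) (auto intro: \<rho>_L2)

lemma walk_self_adjoint:
  assumes "f \<in> L2 M" "g \<in> L2 M" shows "l2_inner M (A f) g = l2_inner M f (A g)"
proof -
  have "l2_inner M f (A g) = cnj (l2_inner M (A g) f)" by (rule l2_inner_commute)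
  also have "\<dots> = (\<Sum>j\<in>{1..N}. cnj (l2_inner M (\<lambda>p. g (\<rho> j p)) f))"
    by (simp add: walk_inner assms)
  also have "\<dots> = (\<Sum>j\<in>{1..N}. l2_inner M (\<lambda>p. f (\<rho> j p)) g)"
  proof (rule sum.cong, rule refl)
    fix j assume j: "j \<in> {1..N}"
    show "cnj (l2_inner M (\<lambda>p. g (\<rho> j p)) f) = l2_inner M (\<lambda>p. f (\<rho> j p)) g"
      unfolding \<rho>_adjoint[OF j assms] by (rule l2_inner_commute[symmetric])
  qed
  finally show ?thesis using assms by (simp add: walk_inner)
qed

lemma poly_op_L2: "f \<in> L2 M \<Longrightarrow> pA q f \<in> L2 M"
proof (induction q)
  case (pCons a q)
  then have "(\<lambda>p. of_real a * f p + A (pA q f) p) \<in> L2 M"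
    by (intro L2_add L2_scale walk_L2) auto
  then show ?case by (simp add: poly_op_pCons[abs_def] fun_eq_iff[symmetric])
qed (simp add: L2_zero poly_op_def[abs_def])

lemma poly_op_self_adjoint:
  assumes "f \<in> L2 M" "g \<in> L2 M" shows "l2_inner M (pA q f) g = l2_inner M f (pA q g)"
  using assms
proof (induction q arbitrary: f g)
  case (pCons a q)
  have r: "pA (pCons a q) f = (\<lambda>p. of_real a * f p + A (pA q f) p)" for f
    by (simp add: fun_eq_iff poly_op_pCons)
  have c: "A (pA q g) = pA q (A g)"
    using poly_op_mult[of N \<rho> "[:0, 1:]" q g] poly_op_mult[of N \<rho> q "[:0, 1:]" g]
    by (simp only: poly_op_X mult.commute[of q])
  show ?case unfolding r
    using pCons by (simp add: l2_inner_add_left l2_inner_add_right L2_scale walk_L2 poly_op_L2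
        l2_inner_scale_left l2_inner_scale_right walk_self_adjoint c)
qed (simp add: l2_inner_def)

text \<open>Each letter is isometric, so the nonnegative squared norms of \<open>f\<close> composed
  with \<open>\<rho> j\<close>, plus and minus \<open>f\<close>, bound its form by the squared norm
  of \<open>f\<close>; there are \<open>N\<close> letters.\<close>

lemma walk_form_bounds:
  assumes f: "f \<in> L2 M"
  shows "\<bar>Re (l2_inner M (A f) f)\<bar> \<le> N * (l2_norm M f)\<^sup>2"
proof -
  have b: "\<bar>Re (l2_inner M (\<lambda>p. f (\<rho> j p)) f)\<bar> \<le> (l2_norm M f)\<^sup>2" if j: "j \<in> {1..N}" for j
  proof -
    have "complex_of_real ((l2_norm M (\<lambda>p. f (\<rho> j p)))\<^sup>2) = of_real ((l2_norm M f)\<^sup>2)"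
      unfolding l2_inner_self[symmetric] by (rule \<rho>_inner[OF j f f])
    then have "(l2_norm M (\<lambda>p. f (\<rho> j p)))\<^sup>2 = (l2_norm M f)\<^sup>2" using of_real_eq_iff by blast
    then show ?thesis
      using l2_norm_sq_add[OF \<rho>_L2[OF j f] f] l2_norm_sq_diff[OF \<rho>_L2[OF j f] f]
        zero_le_power2[of "l2_norm M (\<lambda>p. f (\<rho> j p) + f p)"] zero_le_power2[of "l2_norm M (\<lambda>p. f (\<rho> j p) - f p)"]
      by linarith
  qed
  have "\<bar>Re (l2_inner M (A f) f)\<bar> \<le> (\<Sum>j\<in>{1..N}. \<bar>Re (l2_inner M (\<lambda>p. f (\<rho> j p)) f)\<bar>)"
    unfolding walk_inner[OF f f] Re_sum by (rule sum_abs)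
  also have "\<dots> \<le> (\<Sum>j\<in>{1..N}. (l2_norm M f)\<^sup>2)" by (rule sum_mono) (use b in auto)
  finally show ?thesis by simp
qed

section \<open>Positivity and norm bounds for polynomials in the walk operator\<close>

lemma poly_op_form_real:
  assumes f: "f \<in> L2 M" shows "l2_inner M (pA q f) f = of_real (Re (l2_inner M (pA q f) f))"
  using poly_op_self_adjoint[OF f f, of q] l2_inner_commute[of M f "pA q f"]
  by (metis Reals_cnj_iff of_real_Re)

definition form :: "('b \<Rightarrow> complex) \<Rightarrow> real poly \<Rightarrow> real" where
  "form f q = Re (l2_inner M (pA q f) f)"

lemma form_add: "f \<in> L2 M \<Longrightarrow> form f (q + r) = form f q + form f r"
  by (simp add: form_def poly_op_add[abs_def] l2_inner_add_left poly_op_L2)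

lemma form_smult: "f \<in> L2 M \<Longrightarrow> form f (smult c q) = c * form f q"
  by (simp add: form_def poly_op_smult[abs_def] l2_inner_scale_left)

lemma form_diff: "f \<in> L2 M \<Longrightarrow> form f (q - r) = form f q - form f r"
  using form_add[of f q "smult (-1) r"] form_smult[of f "-1" r] by simp

lemma form_const: "form f [:c:] = c * (l2_norm M f)\<^sup>2"
  by (simp add: form_def poly_op_const[abs_def] l2_inner_scale_left l2_inner_self)

lemma form_sq: "f \<in> L2 M \<Longrightarrow> form f (q * q) = (l2_norm M (pA q f))\<^sup>2"
  by (simp add: form_def poly_op_mult poly_op_self_adjoint poly_op_L2 l2_inner_self)

text \<open>Self-adjointness moves one factor \<open>r\<close> to the other side, so a squared
  factor is absorbed into the vector. Positivity of a polynomial at all vectors therefore survives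
  multiplication by squares.\<close>

lemma form_square_mult:
  assumes f: "f \<in> L2 M" shows "form f (r\<^sup>2 * q) = form (pA r f) q"
proof -
  have "l2_inner M (pA (r * (q * r)) f) f = l2_inner M (pA q (pA r f)) (pA r f)"
    unfolding poly_op_mult by (rule poly_op_self_adjoint) (auto intro: poly_op_L2 f)
  then show ?thesis by (simp add: form_def power2_eq_square ac_simps)
qed

lemma form_linear_nonneg:
  assumes f: "f \<in> L2 M" shows "0 \<le> form f [:real N, 1:]" "0 \<le> form f [:real N, -1:]"
proof -
  have 1: "pA [:real N, 1:] f = (\<lambda>p. of_real (real N) * f p + 1 * A f p)"
    "pA [:real N, -1:] f = (\<lambda>p. of_real (real N) * f p + (-1) * A f p)"
    using walk_lincomb[of N \<rho> "-1" f 0 f]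
    by (auto simp: fun_eq_iff poly_op_pCons poly_op_const[abs_def])
  show "0 \<le> form f [:real N, 1:]" unfolding form_def 1
    using walk_form_bounds[OF f] by (subst l2_inner_add_left[OF L2_scale[OF f] L2_scale[OF walk_L2[OF f]] f])
       (simp only: l2_inner_scale_left l2_inner_self, simp)
  show "0 \<le> form f [:real N, -1:]" unfolding form_def 1
    using walk_form_bounds[OF f] by (subst l2_inner_add_left[OF L2_scale[OF f] L2_scale[OF walk_L2[OF f]] f])
       (simp only: l2_inner_scale_left l2_inner_self, simp)
qed

text \<open>Even powers are absorbed into \<open>f\<close> by \<open>form_square_mult\<close>, which
  leaves exponents 0 or 1; only the mixed product of the two linear factors then needs an
  argument.\<close>

lemma form_product_nonneg:
  assumes f: "f \<in> L2 M" shows "0 \<le> form f ([:real N, 1:] ^ i * [:real N, -1:] ^ j)"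
proof -
  let ?P = "[:real N, 1:]" and ?Q = "[:real N, -1:]"
  have 0: "0 \<le> form g (?P * ?Q)" if g: "g \<in> L2 M" for g
  proof -
    \<comment> \<open>The factors add up to the constant \<open>2 * N\<close>, so multiplying
      \<open>P * Q\<close> by \<open>P + Q\<close> writes it as a sum of squares times nonnegative
      linear factors.\<close>
    have "smult (2 * real N) (?P * ?Q) = ?P\<^sup>2 * ?Q + ?Q\<^sup>2 * ?P"
      by (simp add: power2_eq_square algebra_simps)
    then have "2 * real N * form g (?P * ?Q) = form (pA ?P g) ?Q + form (pA ?Q g) ?P"
      by (metis form_smult form_add form_square_mult g)
    then show ?thesis
      using form_linear_nonneg poly_op_L2[OF g] N_pos
      by (metis add_nonneg_nonneg mult_pos_pos of_nat_0_less_iff zero_le_mult_iff zero_less_numeral not_less)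
  qed
  define a b where "a = i div 2" "b = j div 2"
  let ?g = "pA (?P ^ a * ?Q ^ b) f"
  have g: "?g \<in> L2 M" by (rule poly_op_L2[OF f])
  have "?P ^ i * ?Q ^ j = (?P ^ a * ?Q ^ b)\<^sup>2 * (?P ^ (i mod 2) * ?Q ^ (j mod 2))"
  proof -
    have "i = 2 * a + i mod 2" "j = 2 * b + j mod 2" by (auto simp: a_b_def)
    then have "?P ^ i = (?P ^ a)\<^sup>2 * ?P ^ (i mod 2)" "?Q ^ j = (?Q ^ b)\<^sup>2 * ?Q ^ (j mod 2)"
      by (metis power_add power_even_eq)+
    then show ?thesis by (simp only: power_mult_distrib mult.assoc mult.left_commute)
  qed
  then have "form f (?P ^ i * ?Q ^ j) = form ?g (?P ^ (i mod 2) * ?Q ^ (j mod 2))"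
    by (simp only: form_square_mult[OF f])
  moreover have "i mod 2 = 0 \<or> i mod 2 = 1" "j mod 2 = 0 \<or> j mod 2 = 1" by auto
  moreover have "0 \<le> form ?g 1" unfolding one_pCons form_const by simp
  ultimately show ?thesis using 0[OF g] form_linear_nonneg[OF g] by auto
qed

text \<open>The positive functional calculus, obtained without any spectral measure:
  \<open>form f\<close> is linear and nonnegative on the products of \<open>N + t\<close> and
  \<open>N - t\<close>, so Bernstein's argument applies.\<close>

lemma form_nonneg:
  assumes f: "f \<in> L2 M" and q: "\<And>t. \<bar>t\<bar> \<le> real N \<Longrightarrow> 0 \<le> poly q t"
  shows "0 \<le> form f q"
  by (rule interval_nonneg_functional[of "real N"])
     (use f q N_pos form_product_nonneg in \<open>auto simp: form_add form_smult\<close>)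

lemma form_mono:
  assumes f: "f \<in> L2 M" and q: "\<And>t. \<bar>t\<bar> \<le> real N \<Longrightarrow> poly r t \<le> poly q t"
  shows "form f r \<le> form f q"
  using form_nonneg[OF f, of "q - r"] q by (simp add: form_diff[OF f])

lemma poly_op_norm_le:
  assumes f: "f \<in> L2 M" and q: "\<And>t. \<bar>t\<bar> \<le> real N \<Longrightarrow> \<bar>poly q t\<bar> \<le> C"
  shows "l2_norm M (pA q f) \<le> C * l2_norm M f"
proof -
  have C: "0 \<le> C" using q[of 0] by simp
  \<comment> \<open>Comparing squares turns the bound on the interval into a norm bound, since
    \<open>form f (q * q)\<close> is the squared norm of \<open>pA q f\<close>.\<close>
  have "form f (q * q) \<le> form f [:C\<^sup>2:]"
    using q C by (intro form_mono[OF f]) (simp add: power2_eq_square[symmetric] abs_le_square_iff[symmetric])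
  then have "(l2_norm M (pA q f))\<^sup>2 \<le> (C * l2_norm M f)\<^sup>2"
    by (simp add: form_sq[OF f] form_const power_mult_distrib)
  then show ?thesis using C by (intro power2_le_imp_le[of "l2_norm M (pA q f)"]) auto
qed

lemma poly_bounded_on_interval:
  obtains C where "\<And>t. \<bar>t\<bar> \<le> real N \<Longrightarrow> \<bar>poly q t\<bar> \<le> C"
proof -
  have "compact (poly q ` {- real N..real N})"
    by (intro compact_continuous_image continuous_intros compact_Icc)
  then obtain C where "\<forall>x\<in>poly q ` {- real N..real N}. norm x \<le> C"
    using compact_imp_bounded bounded_iff by metis
  then show ?thesis using that[of C] by (auto simp: abs_le_iff)
qed

lemma poly_op_bounded: "bounded_op M (pA q)"
proof -
  obtain C where C: "\<And>t. \<bar>t\<bar> \<le> real N \<Longrightarrow> \<bar>poly q t\<bar> \<le> C" using poly_bounded_on_interval by blast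
  show ?thesis unfolding bounded_op_def bounded_op_by_def
    by (intro exI[of _ C]) (auto simp: poly_op_L2 poly_op_norm_le[OF _ C] poly_op_lincomb)
qed

text \<open>Diagonal forms are decreasing and bounded below by positivity, hence converge;
  polarization carries this to all coefficients. No limit operator is named, which is what makes the
  result usable on fibres.\<close>

lemma poly_op_decreasing_convergent:
  assumes f: "f \<in> L2 M" and g: "g \<in> L2 M"
    and nonneg: "\<And>n s. \<bar>s\<bar> \<le> real N \<Longrightarrow> 0 \<le> poly (p n) s"
    and decr: "\<And>n s. \<bar>s\<bar> \<le> real N \<Longrightarrow> poly (p (Suc n)) s \<le> poly (p n) s"
  shows "convergent (\<lambda>n. l2_inner M (pA (p n) f) g)"
proof -
  have diag: "convergent (\<lambda>n. l2_inner M (pA (p n) h) h)" if h: "h \<in> L2 M" for h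
  proof -
    have "monoseq (\<lambda>n. form h (p n))"
      by (rule mono_SucI2) (use form_mono[OF h] decr in auto)
    moreover have "Bseq (\<lambda>n. form h (p n))"
    proof (rule BseqI'[of _ "form h (p 0)"])
      fix n
      have "form h (p n) \<le> form h (p 0)"
        by (induction n) (auto intro: order_trans[OF form_mono[OF h decr]])
      then show "norm (form h (p n)) \<le> form h (p 0)" using form_nonneg[OF h nonneg] by simp
    qed
    ultimately have "convergent (\<lambda>n. form h (p n))" by (blast intro: Bseq_monoseq_convergent)
    then have "convergent (\<lambda>n. complex_of_real (form h (p n)))"
      unfolding convergent_def by (auto intro: tendsto_of_real)
    then show ?thesis unfolding form_def using poly_op_form_real[OF h] by simp
  qed
  have "convergent (\<lambda>n. \<Sum>c\<in>{1, -1, \<i>, -\<i>}. c * l2_inner M (pA (p n) (\<lambda>q. f q + c * g q)) (\<lambda>q. f q + c * g q))"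
    by (intro convergent_sum convergent_mult_const_iff[THEN iffD2] diag convergent_mult convergent_const)
       (auto intro!: L2_add L2_scale f g)
  then have "convergent (\<lambda>n. 4 * l2_inner M (pA (p n) f) g)"
    by (simp only: l2_polarization[OF poly_op_bounded f g])
  then show ?thesis by (simp add: convergent_mult_const_iff)
qed

end

section \<open>Moments of a projection-valued measure\<close>

text \<open>Cutting \<open>B\<close> into the slabs where \<open>a\<close> varies by at most
  \<open>\<epsilon>\<close> reduces the comparison to slabs; the bound on \<open>a\<close> makes
  finitely many of them sufficient, and additivity of \<open>m3\<close> sums the errors without
  loss.\<close>

lemma measures_close_of_level_sets:
  fixes m1 m2 m3 :: "real measure" and a :: "real \<Rightarrow> real"
  assumes fin: "finite_measure m1" "finite_measure m2" "finite_measure m3"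
    and sets: "sets m1 = sets borel" "sets m2 = sets borel" "sets m3 = sets borel"
    and a: "a \<in> borel_measurable borel" and eps: "0 < \<epsilon>"
    and ae: "AE t in m1. \<bar>a t\<bar> \<le> N" "AE t in m2. \<bar>a t\<bar> \<le> N"
    and close: "\<And>B c. B \<in> sets borel \<Longrightarrow> (\<And>t. t \<in> B \<Longrightarrow> c \<le> a t \<and> a t \<le> c + \<epsilon>) \<Longrightarrow>
      \<bar>measure m1 B - measure m2 B\<bar> \<le> K * measure m3 B"
    and K: "0 \<le> K" and B: "B \<in> sets borel"
  shows "\<bar>measure m1 B - measure m2 B\<bar> \<le> K * measure m3 B"
proof -
  note [measurable] = a B
  define J where "J = {\<lfloor>- N / \<epsilon>\<rfloor>..\<lfloor>N / \<epsilon>\<rfloor>}"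
  define L where "L j = {t \<in> B. \<lfloor>a t / \<epsilon>\<rfloor> = j}" for j :: int
  have L [measurable]: "L j \<in> sets borel" for j unfolding L_def by measurable
  have disj: "disjoint_family_on L J" by (auto simp: disjoint_family_on_def L_def)
  have fJ: "finite J" by (simp add: J_def)
  have cover: "measure m B = (\<Sum>j\<in>J. measure m (L j))"
    if "finite_measure m" "sets m = sets borel" "AE t in m. \<bar>a t\<bar> \<le> N" for m
  proof -
    interpret finite_measure m by fact
    have "measure m B = measure m (\<Union>j\<in>J. L j)"
    proof (rule finite_measure_eq_AE)
      show "AE t in m. t \<in> B \<longleftrightarrow> t \<in> (\<Union>j\<in>J. L j)" using that(3)
      proof eventually_elim
        case (elim t)
        have "- N / \<epsilon> \<le> a t / \<epsilon>" "a t / \<epsilon> \<le> N / \<epsilon>"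
          using elim eps divide_right_mono[of "- N" "a t" \<epsilon>] divide_right_mono[of "a t" N \<epsilon>]
          by (auto simp: abs_le_iff)
        then have "\<lfloor>a t / \<epsilon>\<rfloor> \<in> J" unfolding J_def by (auto intro: floor_mono)
        then show ?case by (auto simp: L_def)
      qed
    qed (use that(2) fJ in auto)
    also have "\<dots> = (\<Sum>j\<in>J. measure m (L j))"
      by (rule finite_measure_finite_Union[OF fJ _ disj]) (simp add: that(2) image_subset_iff)
    finally show ?thesis .
  qed
  have lev: "\<bar>measure m1 (L j) - measure m2 (L j)\<bar> \<le> K * measure m3 (L j)" for j
  proof (rule close[of _ "of_int j * \<epsilon>"])
    fix t assume "t \<in> L j"
    then have "\<lfloor>a t / \<epsilon>\<rfloor> = j" by (simp add: L_def)
    then have "of_int j \<le> a t / \<epsilon>" "a t / \<epsilon> < of_int j + 1" by linarith+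
    then show "of_int j * \<epsilon> \<le> a t \<and> a t \<le> of_int j * \<epsilon> + \<epsilon>"
      using eps by (auto simp: field_simps)
  qed simp
  have "\<bar>measure m1 B - measure m2 B\<bar> = \<bar>\<Sum>j\<in>J. measure m1 (L j) - measure m2 (L j)\<bar>"
    by (simp add: cover[OF fin(1) sets(1) ae(1)] cover[OF fin(2) sets(2) ae(2)] sum_subtractf)
  also have "\<dots> \<le> (\<Sum>j\<in>J. \<bar>measure m1 (L j) - measure m2 (L j)\<bar>)" by (rule sum_abs)
  also have "\<dots> \<le> (\<Sum>j\<in>J. K * measure m3 (L j))" by (rule sum_mono) (rule lev)
  also have "\<dots> = K * measure m3 (\<Union>j\<in>J. L j)"
    by (subst finite_measure.finite_measure_finite_Union[OF fin(3) fJ _ disj])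
       (simp_all add: sets(3) image_subset_iff sum_distrib_left)
  also have "\<dots> \<le> K * measure m3 B"
    by (intro mult_left_mono K finite_measure.finite_measure_mono[OF fin(3)]) (use sets(3) in \<open>auto simp: L_def\<close>)
  finally show ?thesis .
qed

locale pvm =
  fixes M :: "'b measure" and E :: "real set \<Rightarrow> 'b oper"
  assumes pvm: "projection_valued_measure M E"
begin

abbreviation "\<mu> \<equiv> scalar_spectral_measure M E"

lemma E_bounded: "B \<in> sets borel \<Longrightarrow> bounded_op M (E B)"
  using pvm by (simp add: projection_valued_measure_def)

lemma E_L2: "B \<in> sets borel \<Longrightarrow> f \<in> L2 M \<Longrightarrow> E B f \<in> L2 M"
  using E_bounded bounded_opD(1) by blast

lemma E_adjoint: "B \<in> sets borel \<Longrightarrow> f \<in> L2 M \<Longrightarrow> g \<in> L2 M \<Longrightarrow> l2_inner M (E B f) g = l2_inner M f (E B g)"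
  using pvm by (simp add: projection_valued_measure_def self_adjoint_def)

lemma E_Int: "B \<in> sets borel \<Longrightarrow> C \<in> sets borel \<Longrightarrow> f \<in> L2 M \<Longrightarrow> AE p in M. E (B \<inter> C) f p = E B (E C f) p"
  using pvm by (simp add: projection_valued_measure_def op_eq_def)

lemma E_empty: "f \<in> L2 M \<Longrightarrow> AE p in M. E {} f p = 0"
  using pvm by (simp add: projection_valued_measure_def op_eq_def)

lemma E_UNIV: "f \<in> L2 M \<Longrightarrow> AE p in M. E UNIV f p = f p"
  using pvm by (simp add: projection_valued_measure_def op_eq_def)

lemma E_Int_inner:
  assumes "B \<in> sets borel" "C \<in> sets borel" "f \<in> L2 M" "g \<in> L2 M"
  shows "l2_inner M (E B f) (E C g) = l2_inner M (E (B \<inter> C) f) g"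
proof -
  have "l2_inner M (E B f) (E C g) = l2_inner M (E C (E B f)) g"
    using assms by (simp add: E_adjoint E_L2)
  also have "\<dots> = l2_inner M (E (C \<inter> B) f) g"
    using E_Int[of C B f] assms by (intro l2_inner_cong_AE) (auto simp: E_L2)
  finally show ?thesis by (simp add: Int_commute)
qed

lemma E_form: "B \<in> sets borel \<Longrightarrow> f \<in> L2 M \<Longrightarrow> l2_inner M (E B f) f = of_real ((l2_norm M (E B f))\<^sup>2)"
  using E_Int_inner[of B B f f] by (simp add: l2_inner_self)

lemma emeasure_\<mu>:
  assumes f: "f \<in> L2 M" and B: "B \<in> sets borel"
  shows "emeasure (\<mu> f) B = ennreal ((l2_norm M (E B f))\<^sup>2)"
proof -
  have "emeasure (\<mu> f) B = ennreal (Re (l2_inner M (E B f) f))"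
    unfolding scalar_spectral_measure_def
  proof (rule emeasure_measure_of_sigma)
    show "sigma_algebra UNIV (sets (borel :: real measure))"
      using sets.sigma_algebra_axioms[of "borel :: real measure"] by simp
    show "positive (sets borel) (\<lambda>B. ennreal (Re (l2_inner M (E B f) f)))"
      using l2_inner_cong_AE[OF E_L2 f L2_zero f E_empty[OF f]] f
      by (auto simp: positive_def l2_inner_def[of M "\<lambda>p. 0"])
    show "countably_additive (sets borel) (\<lambda>B. ennreal (Re (l2_inner M (E B f) f)))"
    proof (rule countably_additiveI)
      fix C :: "nat \<Rightarrow> real set"
      assume C: "range C \<subseteq> sets borel" "disjoint_family C" "(\<Union>i. C i) \<in> sets borel"
      have "(\<lambda>n. l2_inner M (E (C n) f) f) sums l2_inner M (E (\<Union>n. C n) f) f"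
        using pvm C f by (auto simp: projection_valued_measure_def)
      then have "(\<lambda>n. Re (l2_inner M (E (C n) f) f)) sums Re (l2_inner M (E (\<Union>n. C n) f) f)"
        by (rule sums_Re)
      then show "(\<Sum>i. ennreal (Re (l2_inner M (E (C i) f) f))) = ennreal (Re (l2_inner M (E (\<Union>i. C i) f) f))"
        by (rule suminf_ennreal_eq[rotated]) (use C f in \<open>auto simp: E_form\<close>)
    qed
  qed fact
  then show ?thesis by (simp add: E_form f B)
qed

lemma sets_\<mu> [measurable_cong]: "sets (\<mu> f) = sets borel"
  unfolding scalar_spectral_measure_def
  using sets.sigma_sets_eq[of "borel :: real measure"] by simp

lemma space_\<mu> [simp]: "space (\<mu> f) = UNIV"
  using sets_eq_imp_space_eq[OF sets_\<mu>] by simp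

lemma finite_measure_\<mu>: "f \<in> L2 M \<Longrightarrow> finite_measure (\<mu> f)"
  by (rule finite_measureI) (simp add: emeasure_\<mu>)

lemma measure_\<mu>: "f \<in> L2 M \<Longrightarrow> B \<in> sets borel \<Longrightarrow> measure (\<mu> f) B = (l2_norm M (E B f))\<^sup>2"
  by (simp add: measure_def emeasure_\<mu>)

lemma measure_\<mu>': "f \<in> L2 M \<Longrightarrow> B \<in> sets borel \<Longrightarrow> measure (\<mu> f) B = Re (l2_inner M (E B f) f)"
  by (simp add: measure_\<mu> E_form)

lemma measure_\<mu>_UNIV: "f \<in> L2 M \<Longrightarrow> measure (\<mu> f) UNIV = (l2_norm M f)\<^sup>2"
  using l2_norm_cong_AE[OF E_L2 _ E_UNIV, of f] by (simp add: measure_\<mu>)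

lemma \<mu>_E:
  assumes f: "f \<in> L2 M" and B: "B \<in> sets borel"
  shows "\<mu> (E B f) = density (\<mu> f) (indicator B)"
proof (rule measure_eqI)
  fix C assume "C \<in> sets (\<mu> (E B f))"
  then have C: "C \<in> sets borel" by (simp add: sets_\<mu>)
  have "emeasure (\<mu> (E B f)) C = emeasure (\<mu> f) (C \<inter> B)"
    using l2_norm_cong_AE[OF _ _ E_Int[OF C B f]] f B C by (simp add: emeasure_\<mu> E_L2)
  also have "\<dots> = emeasure (density (\<mu> f) (indicator B)) C"
    using B C by (subst emeasure_density) (auto simp: sets_\<mu> indicator_inter_arith[symmetric] Int_commute)
  finally show "emeasure (\<mu> (E B f)) C = emeasure (density (\<mu> f) (indicator B)) C" .
qed (simp add: sets_\<mu>)

lemma integral_\<mu>_E: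
  fixes g :: "real \<Rightarrow> real"
  assumes f: "f \<in> L2 M" and B [measurable]: "B \<in> sets borel" and g [measurable]: "g \<in> borel_measurable borel"
  shows "(LINT t|\<mu> (E B f). g t) = (LINT t|\<mu> f. indicator B t * g t)"
proof -
  have "\<mu> (E B f) = density (\<mu> f) (\<lambda>t. ennreal (indicator B t))"
    unfolding \<mu>_E[OF f B] by (simp add: ennreal_indicator)
  then show ?thesis by (simp only:) (subst integral_density, auto)
qed

lemma AE_\<mu>_iff: "B \<in> sets borel \<Longrightarrow> f \<in> L2 M \<Longrightarrow> (AE t in \<mu> f. t \<in> B) \<longleftrightarrow> measure (\<mu> f) (- B) = 0"
  using AE_iff_measurable[of "- B" "\<mu> f" "\<lambda>t. t \<in> B"]
    finite_measure.emeasure_eq_measure[OF finite_measure_\<mu>, of f]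
  by (auto simp: sets_\<mu>)

lemma measure_\<mu>_fixed:
  assumes f: "f \<in> L2 M" and B: "B \<in> sets borel" and fx: "AE p in M. E B f p = f p"
  shows "AE t in \<mu> f. t \<in> B"
proof -
  interpret finite_measure "\<mu> f" by (rule finite_measure_\<mu>[OF f])
  have "measure (\<mu> f) B = measure (\<mu> f) UNIV"
    using l2_norm_cong_AE[OF E_L2[OF B f] f fx] by (simp add: measure_\<mu>[OF f B] measure_\<mu>_UNIV[OF f])
  then have "measure (\<mu> f) (- B) = 0"
    using finite_measure_compl[of B] B by (simp add: sets_\<mu> Compl_eq_Diff_UNIV)
  then show ?thesis using AE_\<mu>_iff[OF B f] by simp
qed

text \<open>Additivity of \<open>E\<close> is postulated for coefficients only. That the two
  projections add up to the identity follows because the remainder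
  \<open>f - E B f - E (- B) f\<close> has norm zero.\<close>

lemma E_split:
  assumes f: "f \<in> L2 M" and g: "g \<in> L2 M" and B: "B \<in> sets borel"
  shows "l2_inner M g f = l2_inner M g (E B f) + l2_inner M g (E (- B) f)"
proof -
  have B': "- B \<in> sets borel" using B by auto
  let ?D = "\<lambda>p. f p - E B f p - E (- B) f p"
  note [simp] = E_L2 f g B B' L2_diff
  have c: "l2_inner M h (E C f) = l2_inner M (E C h) f" if "C \<in> sets borel" "h \<in> L2 M" for C h
    using that by (simp add: E_adjoint)
  have s: "l2_inner M (E B h) h + l2_inner M (E (- B) h) h = l2_inner M h h" if h: "h \<in> L2 M" for h
  proof -
    interpret finite_measure "\<mu> h" by (rule finite_measure_\<mu>[OF h])
    have "measure (\<mu> h) (- B) = measure (\<mu> h) UNIV - measure (\<mu> h) B"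
      using finite_measure_compl[of B] B by (simp add: sets_\<mu> Compl_eq_Diff_UNIV)
    then show ?thesis using h
      by (simp add: measure_\<mu>[OF h B] measure_\<mu>[OF h B'] measure_\<mu>_UNIV[OF h] E_form l2_inner_self del: of_real_power flip: of_real_add)
  qed
  have "(l2_norm M ?D)\<^sup>2 = Re (l2_inner M ?D ?D)" by (simp add: l2_inner_self)
  also have "l2_inner M ?D ?D = l2_inner M f f - l2_inner M (E B f) f - l2_inner M (E (- B) f) f"
  proof -
    have z: "l2_inner M (E B f) (E (- B) f) = 0" "l2_inner M (E (- B) f) (E B f) = 0"
      using l2_inner_cong_AE[OF _ f L2_zero f E_empty[OF f]]
      by (simp_all add: E_Int_inner l2_inner_def[of M "\<lambda>p. 0"])
    have "l2_inner M (E B f) (E B f) = l2_inner M (E B f) f" "l2_inner M (E (-B) f) (E (-B) f) = l2_inner M (E (-B) f) f"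
      by (simp_all add: E_Int_inner)
    then show ?thesis
      by (simp add: l2_inner_diff_left l2_inner_diff_right z c E_form)
  qed
  also have "\<dots> = 0" by (simp add: s[OF f, symmetric])
  finally have "l2_norm M ?D = 0" by simp
  then have "AE p in M. ?D p = 0" by (intro l2_norm_0_AE) auto
  then have "AE p in M. f p = E B f p + E (- B) f p" by eventually_elim (simp add: algebra_simps)
  then have "l2_inner M g f = l2_inner M g (\<lambda>p. E B f p + E (- B) f p)"
    by (intro l2_inner_cong_AE) (auto simp: L2_add)
  then show ?thesis by (simp add: l2_inner_add_right)
qed

end

section \<open>The spectral measure of the walk operator and its moments\<close>

locale spectral_walk = walk_system M N \<rho> + pvm M E
  for M :: "'b measure" and N \<rho> E +
  assumes id_integrable: "f \<in> L2 M \<Longrightarrow> integrable (\<mu> f) (\<lambda>t. t)"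
    and walk_form: "f \<in> L2 M \<Longrightarrow> l2_inner M (A f) f = of_real (LINT t|\<mu> f. real N - t)"
begin

text \<open>The spectral variable of \<open>A\<close>, where \<open>t\<close> is that of the
  Laplacian.\<close>

definition a :: "real \<Rightarrow> real" where "a t = real N - t"

lemma a_measurable [measurable]: "a \<in> borel_measurable borel"
  unfolding a_def[abs_def] by measurable

lemma walk_bounded: "bounded_op M A"
  using poly_op_bounded[of "[:0, 1:]"] by (simp add: poly_op_X)

lemma a_integrable: "f \<in> L2 M \<Longrightarrow> integrable (\<mu> f) a"
  unfolding a_def[abs_def] using id_integrable finite_measure.integrable_const[OF finite_measure_\<mu>]
  by (intro Bochner_Integration.integrable_diff) auto

lemma walk_form_a: "f \<in> L2 M \<Longrightarrow> l2_inner M (A f) f = of_real (LINT t|\<mu> f. a t)"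
  by (simp add: a_def walk_form)

text \<open>For \<open>u = E B f\<close> and \<open>v = E (- B) g\<close> the mixed coefficients of
  every \<open>E C\<close> vanish, so for \<open>c\<close> of modulus one the spectral measure of
  \<open>u + c v\<close> is the sum of those of \<open>u\<close> and \<open>v\<close>. The form of
  \<open>A\<close> at \<open>u + c v\<close> is then independent of \<open>c\<close>, and
  polarization, whose weights sum to zero, gives orthogonality.\<close>

lemma walk_E_orthogonal:
  assumes f: "f \<in> L2 M" and g: "g \<in> L2 M" and B [measurable]: "B \<in> sets borel"
  shows "l2_inner M (A (E B f)) (E (- B) g) = 0"
proof -
  let ?u = "E B f" and ?v = "E (- B) g"
  have B' [measurable]: "- B \<in> sets borel" using B by auto
  note [simp] = E_L2 f g B B' L2_scale L2_add
  have cross: "l2_inner M (E C ?u) ?v = 0" "l2_inner M (E C ?v) ?u = 0" if C: "C \<in> sets borel" for C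
  proof -
    have z: "l2_inner M (E {} h) k = 0" if "h \<in> L2 M" "k \<in> L2 M" for h k
      using l2_inner_cong_AE[OF _ that(2) L2_zero that(2) E_empty[OF that(1)]] that
      by (simp add: l2_inner_def[of M "\<lambda>p. 0"])
    have "l2_inner M (E C ?u) ?v = l2_inner M (E (C \<inter> - B) ?u) g"
      using C by (simp add: E_Int_inner)
    also have "\<dots> = l2_inner M ?u (E (C \<inter> - B) g)" using C by (intro E_adjoint) auto
    also have "\<dots> = l2_inner M (E (B \<inter> (C \<inter> - B)) f) g" using C by (intro E_Int_inner) auto
    also have "B \<inter> (C \<inter> - B) = {}" by auto
    finally show 1: "l2_inner M (E C ?u) ?v = 0" using z by simp
    have "l2_inner M (E C ?v) ?u = l2_inner M ?v (E C ?u)" using C by (intro E_adjoint) auto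
    also have "\<dots> = cnj (l2_inner M (E C ?u) ?v)" by (rule l2_inner_commute)
    finally show "l2_inner M (E C ?v) ?u = 0" using 1 by simp
  qed
  have form: "l2_inner M (A (\<lambda>q. ?u q + c * ?v q)) (\<lambda>q. ?u q + c * ?v q) =
      of_real ((LINT t|\<mu> ?u. a t) + (LINT t|\<mu> ?v. a t))" if c: "c \<in> {1, -1, \<i>, -\<i>}" for c
  proof -
    let ?h = "\<lambda>q. ?u q + c * ?v q"
    have c1: "cmod c = 1" using c by auto
    have h: "?h \<in> L2 M" by simp
    have m: "measure (\<mu> ?h) C = measure (\<mu> ?u) C + measure (\<mu> ?v) C" if C: "C \<in> sets borel" for C
    proof -
      have "l2_inner M (E C ?h) ?h = l2_inner M (E C ?u) ?u + l2_inner M (E C ?v) ?v"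
        using l2_inner_op_add[OF E_bounded[OF C], of ?u ?v c] C c1
        by (simp add: cross complex_norm_square[symmetric])
      then show ?thesis using C by (simp add: measure_\<mu>' h)
    qed
    \<comment> \<open>Restricting the spectral measure of the combination to \<open>B\<close> and to
      its complement recovers the two summands, so that the integral of \<open>a\<close> splits
      accordingly.\<close>
    have dens: "density (\<mu> ?h) (indicator B) = \<mu> ?u" "density (\<mu> ?h) (indicator (- B)) = \<mu> ?v"
    proof -
      have eE: "emeasure (density (\<mu> k) (indicator C)) D = ennreal (measure (\<mu> k) (C \<inter> D))"
        if "k \<in> L2 M" "C \<in> sets borel" "D \<in> sets borel" for k C D
        using that finite_measure.emeasure_eq_measure[OF finite_measure_\<mu>[OF that(1)]]
        by (subst emeasure_density) (auto simp: sets_\<mu> indicator_inter_arith[symmetric])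
      have m0: "measure (\<mu> ?v) (B \<inter> C) = 0" "measure (\<mu> ?u) (- B \<inter> C) = 0"
        "measure (\<mu> ?u) (B \<inter> C) = measure (\<mu> ?u) C" "measure (\<mu> ?v) (- B \<inter> C) = measure (\<mu> ?v) C"
        if C: "C \<in> sets borel" for C
      proof -
        have r: "measure (\<mu> (E D k)) F = measure (\<mu> k) (D \<inter> F)"
          if "k \<in> L2 M" "D \<in> sets borel" "F \<in> sets borel" for k D F
          unfolding \<mu>_E[OF that(1,2)] measure_def using eE[OF that] by (simp add: measure_def)
        show "measure (\<mu> ?v) (B \<inter> C) = 0" "measure (\<mu> ?u) (- B \<inter> C) = 0"
          "measure (\<mu> ?u) (B \<inter> C) = measure (\<mu> ?u) C" "measure (\<mu> ?v) (- B \<inter> C) = measure (\<mu> ?v) C"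
          using C by (simp_all add: r Int_assoc[symmetric])
      qed
      show "density (\<mu> ?h) (indicator B) = \<mu> ?u"
        by (rule measure_eqI)
           (auto simp: sets_\<mu> eE m m0 finite_measure.emeasure_eq_measure[OF finite_measure_\<mu>])
      show "density (\<mu> ?h) (indicator (- B)) = \<mu> ?v"
        by (rule measure_eqI)
           (auto simp: sets_\<mu> eE m m0 finite_measure.emeasure_eq_measure[OF finite_measure_\<mu>])
    qed
    have i: "(LINT t|density (\<mu> ?h) (indicator C). a t) = (LINT t|\<mu> ?h. indicator C t * a t)"
      "integrable (\<mu> ?h) (\<lambda>t. indicator C t * a t)" if [measurable]: "C \<in> sets borel" for C
    proof -
      have "density (\<mu> ?h) (indicator C) = density (\<mu> ?h) (\<lambda>t. ennreal (indicator C t))"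
        by (simp add: ennreal_indicator)
      then show "(LINT t|density (\<mu> ?h) (indicator C). a t) = (LINT t|\<mu> ?h. indicator C t * a t)"
        by (simp only:) (subst integral_density, auto)
      show "integrable (\<mu> ?h) (\<lambda>t. indicator C t * a t)"
        using integrable_mult_indicator[OF _ a_integrable[OF h], of C] by (simp add: sets_\<mu>)
    qed
    have "(LINT t|\<mu> ?h. a t) = (LINT t|\<mu> ?h. indicator B t * a t + indicator (- B) t * a t)"
      by (rule Bochner_Integration.integral_cong) (auto simp: indicator_def)
    also have "\<dots> = (LINT t|\<mu> ?u. a t) + (LINT t|\<mu> ?v. a t)"
      by (subst Bochner_Integration.integral_add[OF i(2) i(2)]) (auto simp: i(1)[symmetric] dens)
    finally show ?thesis by (simp add: walk_form_a[OF h])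
  qed
  have "4 * l2_inner M (A ?u) ?v =
    (\<Sum>c\<in>{1, -1, \<i>, -\<i>}. c * of_real ((LINT t|\<mu> ?u. a t) + (LINT t|\<mu> ?v. a t)))"
    unfolding l2_polarization[OF walk_bounded E_L2[OF B f] E_L2[OF B' g]]
    by (rule sum.cong[OF refl]) (simp only: form)
  also have "\<dots> = 0" unfolding sum_fourth_roots_unity by simp
  finally show ?thesis by simp
qed

text \<open>By orthogonality \<open>A\<close> respects the splitting into the ranges of
  \<open>E B\<close> and \<open>E (- B)\<close>. Splitting the vectors by \<open>E_split\<close>
  equates all coefficients of the two sides, and the difference, tested against itself, has norm
  zero.\<close>

lemma walk_E_commute:
  assumes f: "f \<in> L2 M" and B: "B \<in> sets borel"
  shows "AE p in M. E B (A f) p = A (E B f) p"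
proof -
  have B': "- B \<in> sets borel" using B by auto
  note [simp] = E_L2 f B B' walk_L2 L2_diff
  have eq: "l2_inner M (E B (A f)) g = l2_inner M (A (E B f)) g" if g [simp]: "g \<in> L2 M" for g
  proof -
    have "l2_inner M (E B (A f)) g = l2_inner M f (A (E B g))"
      by (simp add: E_adjoint walk_self_adjoint)
    also have "\<dots> = cnj (l2_inner M (A (E B g)) f)" by (rule l2_inner_commute)
    also have "\<dots> = cnj (l2_inner M (A (E B g)) (E B f))"
      by (simp add: E_split[of f "A (E B g)" B] walk_E_orthogonal)
    also have "\<dots> = l2_inner M (E B f) (A (E B g))" by (rule l2_inner_commute[symmetric])
    also have "\<dots> = l2_inner M (A (E B f)) (E B g)" by (simp add: walk_self_adjoint)
    also have "\<dots> = l2_inner M (A (E B f)) g"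
      by (simp add: E_split[of g "A (E B f)" B] walk_E_orthogonal)
    finally show ?thesis .
  qed
  let ?D = "\<lambda>p. E B (A f) p - A (E B f) p"
  have "l2_inner M ?D ?D = 0" using eq[of ?D] by (simp add: l2_inner_diff_left)
  then have "l2_norm M ?D = 0" by (simp add: l2_inner_self)
  then have "AE p in M. ?D p = 0" by (intro l2_norm_0_AE) auto
  then show ?thesis by auto
qed

lemma norm_E_walk:
  assumes f: "f \<in> L2 M" and B: "B \<in> sets borel"
  shows "measure (\<mu> (A f)) B = (l2_norm M (A (E B f)))\<^sup>2"
  using l2_norm_cong_AE[OF _ _ walk_E_commute[OF f B]] f B by (simp add: measure_\<mu> walk_L2 E_L2)

text \<open>If the set where \<open>s * a\<close> exceeds \<open>N\<close> had positive mass, the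
  projection of \<open>f\<close> to it would be a vector at which the form of \<open>s * A\<close>
  exceeds \<open>N\<close> times the squared norm, against \<open>walk_form_bounds\<close>.\<close>

lemma AE_\<mu>_a_bound:
  assumes f: "f \<in> L2 M" shows "AE t in \<mu> f. \<bar>a t\<bar> \<le> real N"
proof -
  have *: "AE t in \<mu> f. s * a t \<le> real N" if s: "s = 1 \<or> s = - 1" for s
  proof -
    define C where "C = {t. real N < s * a t}"
    have C [measurable]: "C \<in> sets borel" unfolding C_def by measurable
    define h where "h = E C f"
    have h: "h \<in> L2 M" by (simp add: h_def E_L2 f)
    interpret h: finite_measure "\<mu> h" by (rule finite_measure_\<mu>[OF h])
    have fixed: "AE t in \<mu> h. t \<in> C"
      by (rule measure_\<mu>_fixed[OF h C]) (use E_Int[OF C C f] in \<open>auto simp: h_def\<close>)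
    have "(LINT t|\<mu> h. s * a t - real N) = s * Re (l2_inner M (A h) h) - real N * (l2_norm M h)\<^sup>2"
      using a_integrable[OF h] by (simp add: walk_form_a[OF h] measure_\<mu>_UNIV[OF h])
    also have "\<dots> \<le> 0" using walk_form_bounds[OF h] s by auto
    finally have le: "(LINT t|\<mu> h. s * a t - real N) \<le> 0" .
    have nn: "AE t in \<mu> h. 0 \<le> s * a t - real N" using fixed by eventually_elim (auto simp: C_def)
    then have "(LINT t|\<mu> h. s * a t - real N) = 0"
      using le integral_nonneg_AE[OF nn] by simp
    then have "AE t in \<mu> h. s * a t - real N = 0"
      using integral_nonneg_eq_0_iff_AE[OF _ nn] a_integrable[OF h] by auto
    with fixed have "AE t in \<mu> h. t \<in> {}" by eventually_elim (auto simp: C_def)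
    then have "measure (\<mu> h) UNIV = 0" using AE_\<mu>_iff[OF _ h, of "{}"] by simp
    then have "measure (\<mu> f) C = 0" by (simp add: measure_\<mu>_UNIV h) (simp add: measure_\<mu> f h_def)
    then have "AE t in \<mu> f. t \<in> - C" using AE_\<mu>_iff[OF _ f, of "- C"] C by auto
    then show ?thesis by eventually_elim (auto simp: C_def)
  qed
  show ?thesis using *[of 1] *[of "-1"] by (auto elim: eventually_elim2)
qed

lemma poly_a_integrable:
  assumes f: "f \<in> L2 M" shows "integrable (\<mu> f) (\<lambda>t. poly q (a t))"
proof -
  obtain C where C: "\<And>t. \<bar>t\<bar> \<le> real N \<Longrightarrow> \<bar>poly q t\<bar> \<le> C" using poly_bounded_on_interval by blast
  have [measurable]: "poly q \<in> borel_measurable borel"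
    by (intro borel_measurable_continuous_onI continuous_intros)
  show ?thesis
    by (rule finite_measure.integrable_const_bound[OF finite_measure_\<mu>[OF f], of _ C])
       (use AE_\<mu>_a_bound[OF f] C in \<open>auto elim!: eventually_mono\<close>)
qed

text \<open>On the range of \<open>E B\<close>, which \<open>A\<close> preserves, the numerical
  range of \<open>A - c\<close> is bounded by \<open>\<epsilon>\<close>. An operator norm is at most
  twice such a bound, whence the factor 4 after squaring.\<close>

lemma local_walk_bound:
  assumes f: "f \<in> L2 M" and B [measurable]: "B \<in> sets borel" and eps: "0 < \<epsilon>"
    and lev: "\<And>t. t \<in> B \<Longrightarrow> c \<le> a t \<and> a t \<le> c + \<epsilon>"
  shows "(l2_norm M (pA [:-c, 1:] (E B f)))\<^sup>2 \<le> 4 * \<epsilon>\<^sup>2 * (l2_norm M (E B f))\<^sup>2"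
proof -
  define D where "D = pA [:-c, 1:]"
  have D: "D h = (\<lambda>p. of_real (- c) * h p + 1 * A h p)" for h
    using poly_op_add[of N \<rho> "[:-c:]" "[:0,1:]" h] by (auto simp: D_def fun_eq_iff poly_op_X)
  note Dbd = poly_op_bounded[of "[:-c, 1:]", folded D_def]
  define u where "u = E B f"
  define w where "w = E B (D u)"
  note [simp] = E_L2 B f walk_L2 L2_scale L2_add poly_op_L2
  have uL [simp]: "u \<in> L2 M" and DuL [simp]: "D u \<in> L2 M" and wL [simp]: "w \<in> L2 M"
    by (auto simp: u_def w_def D_def)
  have uf: "AE p in M. E B u p = u p" using E_Int[OF B B f] by (auto simp: u_def)
  have wf: "AE p in M. E B w p = w p" using E_Int[OF B B DuL] by (auto simp: w_def)
  \<comment> \<open>\<open>D u\<close> stays in the range of \<open>E B\<close> because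
    \<open>A\<close> commutes with \<open>E B\<close>; so the numerical range bound, valid in that
    range only, may be applied to combinations of \<open>u\<close> and \<open>D u\<close>.\<close>
  have wD: "AE p in M. w p = D u p"
  proof -
    have e1: "AE p in M. E B (D u) p = of_real (- c) * E B u p + 1 * E B (A u) p"
      unfolding D by (rule bounded_opD(2)[OF E_bounded[OF B]]) auto
    have e2: "AE p in M. E B (A u) p = A u p"
    proof -
      have "AE p in M. E B (A f) p = A u p" using walk_E_commute[OF f B] by (simp add: u_def)
      moreover have "AE p in M. E B (A u) p = A (E B u) p" by (rule walk_E_commute) auto
      \<comment> \<open>Operators act on functions, so equality almost everywhere of the arguments
        is passed to the images through the norm bound of \<open>A\<close>.\<close>
      moreover have "AE p in M. A (E B u) p = A u p"
      proof -
        have "l2_norm M (A (\<lambda>p. 1 * E B u p + (-1) * u p)) \<le> real N * l2_norm M (\<lambda>p. 1 * E B u p + (-1) * u p)"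
          using poly_op_norm_le[of "\<lambda>p. 1 * E B u p + (-1) * u p" "[:0, 1:]" "real N"] by (simp add: poly_op_X L2_diff)
        also have "l2_norm M (\<lambda>p. 1 * E B u p + (-1) * u p) = l2_norm M (\<lambda>p. 0)"
          using uf by (intro l2_norm_cong_AE) (auto simp: L2_diff L2_zero)
        finally have "l2_norm M (\<lambda>p. 1 * A (E B u) p + (-1) * A u p) = 0"
          unfolding walk_lincomb using l2_norm_nonneg[of M] by (simp add: l2_norm_def[of M "\<lambda>p. 0"] antisym)
        then have "AE p in M. 1 * A (E B u) p + (-1) * A u p = 0" by (intro l2_norm_0_AE) (auto simp: L2_diff)
        then show ?thesis by auto
      qed
      ultimately show ?thesis by auto
    qed
    from e1 e2 uf show ?thesis unfolding w_def D by eventually_elim simp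
  qed
  have range: "cmod (l2_inner M (D h) h) \<le> \<epsilon> * (l2_norm M h)\<^sup>2"
    if h: "h \<in> L2 M" and hf: "AE p in M. E B h p = h p" for h
  proof -
    interpret finite_measure "\<mu> h" by (rule finite_measure_\<mu>[OF h])
    have "l2_inner M (D h) h = of_real (LINT t|\<mu> h. a t - c)"
    proof -
      have "D h = (\<lambda>p. A h p - of_real c * h p)" by (simp add: D fun_eq_iff)
      then have "l2_inner M (D h) h = l2_inner M (A h) h - of_real c * l2_inner M h h"
        using h by (simp add: l2_inner_diff_left l2_inner_scale_left)
      then show ?thesis
        using h a_integrable[OF h]
        by (simp add: l2_inner_self walk_form_a measure_\<mu>_UNIV mult.commute flip: of_real_mult of_real_diff del: of_real_power)
    qed
    moreover have "\<bar>LINT t|\<mu> h. a t - c\<bar> \<le> \<epsilon> * (l2_norm M h)\<^sup>2"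
    proof -
      have "(LINT t|\<mu> h. \<bar>a t - c\<bar>) \<le> (LINT t|\<mu> h. \<epsilon>)"
      proof (rule integral_mono_AE)
        show "AE t in \<mu> h. \<bar>a t - c\<bar> \<le> \<epsilon>"
          using measure_\<mu>_fixed[OF h B hf] by eventually_elim (use lev in \<open>smt (verit)\<close>)
      qed (use a_integrable[OF h] in auto)
      then have "(LINT t|\<mu> h. \<bar>a t - c\<bar>) \<le> \<epsilon> * (l2_norm M h)\<^sup>2"
        by (simp add: measure_\<mu>_UNIV[OF h] mult.commute)
      then show ?thesis by (rule order_trans[OF integral_abs_bound])
    qed
    ultimately show ?thesis by (simp only: norm_of_real)
  qed
  \<comment> \<open>The bound will read
    \<open>s |Du|^2 \<le> \<epsilon> (|u|^2 + s^2 |Du|^2)\<close>; this value maximizes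
    \<open>s - \<epsilon> s^2\<close> and leaves \<open>|Du|^2 / (4 \<epsilon>)\<close> on the
    left.\<close>
  define s where "s = 1 / (2 * \<epsilon>)"
  have "cmod (l2_inner M (D u) (\<lambda>p. of_real s * w p)) \<le> \<epsilon> * ((l2_norm M u)\<^sup>2 + (l2_norm M (\<lambda>p. of_real s * w p))\<^sup>2)"
  proof (rule numerical_range_bound[OF Dbd])
    fix z
    let ?h = "\<lambda>q. u q + z * (of_real s * w q)"
    show "cmod (l2_inner M (D ?h) ?h) \<le> \<epsilon> * (l2_norm M ?h)\<^sup>2"
    proof (rule range)
      have "AE p in M. E B (\<lambda>q. 1 * u q + (z * of_real s) * w q) p = 1 * E B u p + (z * of_real s) * E B w p"
        by (rule bounded_opD(2)[OF E_bounded[OF B]]) auto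
      with uf wf show "AE p in M. E B ?h p = ?h p" by eventually_elim (simp add: mult.assoc)
    qed auto
  qed auto
  also have "l2_inner M (D u) (\<lambda>p. of_real s * w p) = of_real (s * (l2_norm M (D u))\<^sup>2)"
  proof -
    have "l2_inner M (D u) w = l2_inner M (D u) (D u)" using wD by (intro l2_inner_cong_AE) auto
    then show ?thesis by (simp add: l2_inner_scale_right l2_inner_self)
  qed
  also have "l2_norm M (\<lambda>p. of_real s * w p) = s * l2_norm M (D u)"
    unfolding l2_norm_scale using l2_norm_cong_AE[OF wL DuL wD] eps by (simp add: s_def norm_divide)
  finally have "s * (l2_norm M (D u))\<^sup>2 \<le> \<epsilon> * ((l2_norm M u)\<^sup>2 + (s * l2_norm M (D u))\<^sup>2)"
    unfolding norm_of_real using eps by (simp add: s_def)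
  then have "(l2_norm M (D u))\<^sup>2 \<le> 4 * \<epsilon>\<^sup>2 * (l2_norm M u)\<^sup>2"
    using eps by (simp add: s_def power_mult_distrib field_simps power2_eq_square)
  then show ?thesis by (simp add: D_def u_def)
qed

text \<open>This is the step from first to second moments. On a slab where \<open>a\<close> lies in
  \<open>[c, c + \<epsilon>]\<close>, write the squared norm of \<open>A u\<close> and the integral
  of \<open>a^2\<close> as the second moment around \<open>c\<close> plus terms of first order. The
  latter agree by \<open>walk_form\<close>, and the former are at most
  \<open>4 * \<epsilon>^2\<close> and \<open>\<epsilon>^2\<close> times the squared norm of
  \<open>u\<close>. Summing over slabs gives an error \<open>4 * \<epsilon>^2\<close> times the mass
  of \<open>B\<close> under \<open>\<mu> f\<close>, and \<open>\<epsilon>\<close> tends to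
  zero.\<close>

lemma \<mu>_walk:
  assumes f: "f \<in> L2 M"
  shows "\<mu> (A f) = density (\<mu> f) (\<lambda>t. ennreal ((a t)\<^sup>2))"
proof (rule measure_eqI)
  let ?\<nu> = "density (\<mu> f) (\<lambda>t. ennreal ((a t)\<^sup>2))"
  interpret f: finite_measure "\<mu> f" by (rule finite_measure_\<mu>[OF f])
  interpret Af: finite_measure "\<mu> (A f)" by (rule finite_measure_\<mu>[OF walk_L2[OF f]])
  have sq: "integrable (\<mu> h) (\<lambda>t. (a t)\<^sup>2)" if "h \<in> L2 M" for h
    using poly_a_integrable[OF that, of "[:0, 1:]\<^sup>2"] by simp
  have em: "emeasure ?\<nu> B = ennreal (LINT t|\<mu> f. indicator B t * (a t)\<^sup>2)"
    if [measurable]: "B \<in> sets borel" for B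
  proof -
    have "integrable (\<mu> f) (\<lambda>t. indicator B t * (a t)\<^sup>2)"
      using integrable_mult_indicator[OF _ sq[OF f], of B] by (simp add: sets_\<mu>)
    then have "(\<integral>\<^sup>+ t. ennreal (indicator B t * (a t)\<^sup>2) \<partial>\<mu> f) = ennreal (LINT t|\<mu> f. indicator B t * (a t)\<^sup>2)"
      by (intro nn_integral_eq_integral) auto
    moreover have "emeasure ?\<nu> B = (\<integral>\<^sup>+ t. ennreal (indicator B t * (a t)\<^sup>2) \<partial>\<mu> f)"
      by (subst emeasure_density) (auto simp: indicator_def intro!: nn_integral_cong)
    ultimately show ?thesis by simp
  qed
  have fin: "finite_measure ?\<nu>"
    by (rule finite_measureI) (simp add: em)
  have me: "measure ?\<nu> B = (LINT t|\<mu> (E B f). (a t)\<^sup>2)" if "B \<in> sets borel" for B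
    using that by (subst integral_\<mu>_E) (auto simp: measure_def em f intro!: integral_nonneg_AE)
  have close: "\<bar>measure (\<mu> (A f)) B - measure ?\<nu> B\<bar> \<le> (4 * \<epsilon>\<^sup>2) * measure (\<mu> f) B"
    if eps: "0 < \<epsilon>" and B: "B \<in> sets borel" for \<epsilon> B
  proof (rule measures_close_of_level_sets[of _ _ _ a \<epsilon> "real N"])
    show "AE t in \<mu> (A f). \<bar>a t\<bar> \<le> real N" by (rule AE_\<mu>_a_bound[OF walk_L2[OF f]])
    show "AE t in ?\<nu>. \<bar>a t\<bar> \<le> real N"
      using AE_\<mu>_a_bound[OF f] by (subst AE_density) auto
    fix B c assume B: "B \<in> sets borel" and lev: "\<And>t. t \<in> B \<Longrightarrow> c \<le> a t \<and> a t \<le> c + \<epsilon>"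
    define u where "u = E B f"
    have u [simp]: "u \<in> L2 M" by (simp add: u_def E_L2 B f)
    interpret u: finite_measure "\<mu> u" by (rule finite_measure_\<mu>[OF u])
    have "AE p in M. E B u p = u p" using E_Int[OF B B f] by (auto simp: u_def)
    then have uB: "AE t in \<mu> u. t \<in> B" by (rule measure_\<mu>_fixed[OF u B])
    have "(LINT t|\<mu> u. (a t - c)\<^sup>2) \<le> (LINT t|\<mu> u. \<epsilon>\<^sup>2)"
    proof (rule integral_mono_AE)
      show "integrable (\<mu> u) (\<lambda>t. (a t - c)\<^sup>2)"
        using poly_a_integrable[OF u, of "[:-c, 1:]\<^sup>2"] by simp
      show "AE t in \<mu> u. (a t - c)\<^sup>2 \<le> \<epsilon>\<^sup>2"
        using uB by eventually_elim (use lev in \<open>force intro!: power_mono\<close>)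
    qed auto
    then have b1: "(LINT t|\<mu> u. (a t - c)\<^sup>2) \<le> \<epsilon>\<^sup>2 * (l2_norm M u)\<^sup>2"
      by (simp add: measure_\<mu>_UNIV mult.commute)
    have "(LINT t|\<mu> u. (a t - c)\<^sup>2) = (LINT t|\<mu> u. (a t)\<^sup>2 - 2 * c * a t + c\<^sup>2)"
      by (simp add: power2_diff algebra_simps)
    also have "\<dots> = (LINT t|\<mu> u. (a t)\<^sup>2) - 2 * c * (LINT t|\<mu> u. a t) + c\<^sup>2 * (l2_norm M u)\<^sup>2"
      using sq[OF u] a_integrable[OF u] by (simp add: measure_\<mu>_UNIV mult.commute)
    finally have e1: "(LINT t|\<mu> u. (a t - c)\<^sup>2) = \<dots>" .
    have Dc: "pA [:-c, 1:] u = (\<lambda>p. A u p - of_real c * u p)"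
      using poly_op_add[of N \<rho> "[:-c:]" "[:0,1:]" u] by (auto simp: fun_eq_iff poly_op_X)
    have e2: "(l2_norm M (pA [:-c, 1:] u))\<^sup>2 = (l2_norm M (A u))\<^sup>2 - 2 * c * (LINT t|\<mu> u. a t) + c\<^sup>2 * (l2_norm M u)\<^sup>2"
      unfolding Dc by (subst l2_norm_sq_diff)
        (auto simp: walk_L2 L2_scale l2_norm_scale l2_inner_scale_right walk_form_a power_mult_distrib)
    have "(l2_norm M (pA [:-c, 1:] u))\<^sup>2 \<le> 4 * \<epsilon>\<^sup>2 * (l2_norm M u)\<^sup>2"
      unfolding u_def by (rule local_walk_bound[OF f B eps lev])
    moreover have "0 \<le> (l2_norm M (pA [:-c, 1:] u))\<^sup>2" "0 \<le> (LINT t|\<mu> u. (a t - c)\<^sup>2)" by auto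
    moreover have "0 \<le> \<epsilon>\<^sup>2 * (l2_norm M u)\<^sup>2" by simp
    ultimately have "\<bar>(l2_norm M (A u))\<^sup>2 - (LINT t|\<mu> u. (a t)\<^sup>2)\<bar> \<le> 4 * \<epsilon>\<^sup>2 * (l2_norm M u)\<^sup>2"
      using b1 e1 e2 by linarith
    then show "\<bar>measure (\<mu> (A f)) B - measure ?\<nu> B\<bar> \<le> (4 * \<epsilon>\<^sup>2) * measure (\<mu> f) B"
      by (simp add: norm_E_walk[OF f B] me[OF B] measure_\<mu>[OF f B] u_def)
  qed (use eps B fin Af.finite_measure_axioms f.finite_measure_axioms in \<open>auto simp: sets_\<mu>\<close>)
  fix B assume "B \<in> sets (\<mu> (A f))"
  then have B: "B \<in> sets borel" by (simp add: sets_\<mu>)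
  have "(\<lambda>n. (4 * (1 / real (Suc n))\<^sup>2) * measure (\<mu> f) B) \<longlonglongrightarrow> (4 * 0\<^sup>2) * measure (\<mu> f) B"
    by (intro tendsto_intros LIMSEQ_Suc[OF lim_1_over_n])
  then have "\<bar>measure (\<mu> (A f)) B - measure ?\<nu> B\<bar> \<le> (4 * 0\<^sup>2) * measure (\<mu> f) B"
    by (rule LIMSEQ_le_const) (intro exI[of _ 0] allI impI close B, simp)
  then have "measure (\<mu> (A f)) B = measure ?\<nu> B" by simp
  then show "emeasure (\<mu> (A f)) B = emeasure ?\<nu> B"
    by (simp add: Af.emeasure_eq_measure finite_measure.emeasure_eq_measure[OF fin])
qed (simp add: sets_\<mu>)

lemma walk_pow_L2: "f \<in> L2 M \<Longrightarrow> (A ^^ k) f \<in> L2 M"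
  by (induction k) (auto simp: walk_L2)

lemma \<mu>_walk_pow:
  assumes f: "f \<in> L2 M"
  shows "\<mu> ((A ^^ k) f) = density (\<mu> f) (\<lambda>t. ennreal ((a t) ^ (2 * k)))"
proof (induction k)
  case 0
  then show ?case by (simp add: density_1)
next
  case (Suc k)
  have "\<mu> ((A ^^ Suc k) f) = density (\<mu> ((A ^^ k) f)) (\<lambda>t. ennreal ((a t)\<^sup>2))"
    using \<mu>_walk[OF walk_pow_L2[OF f]] by simp
  also have "\<dots> = density (\<mu> f) (\<lambda>t. ennreal ((a t) ^ (2 * k)) * ennreal ((a t)\<^sup>2))"
    unfolding Suc by (rule density_density_eq) auto
  also have "\<dots> = density (\<mu> f) (\<lambda>t. ennreal ((a t) ^ (2 * Suc k)))"
  proof -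
    have "ennreal (x ^ (2 * k)) * ennreal (x\<^sup>2) = ennreal (x ^ (2 * Suc k))" for x :: real
    proof -
      have "x ^ (2 * Suc k) = x ^ (2 * k) * x\<^sup>2" by (simp add: power2_eq_square)
      then show ?thesis by (simp only:) (rule ennreal_mult[symmetric], simp_all)
    qed
    then show ?thesis by simp
  qed
  finally show ?case .
qed

lemma walk_pow_adjoint:
  "f \<in> L2 M \<Longrightarrow> g \<in> L2 M \<Longrightarrow> l2_inner M ((A ^^ k) f) g = l2_inner M f ((A ^^ k) g)"
proof (induction k arbitrary: g)
  case (Suc k)
  then have "l2_inner M ((A ^^ Suc k) f) g = l2_inner M f ((A ^^ k) (A g))"
    by (simp add: walk_self_adjoint walk_pow_L2 walk_L2)
  then show ?case by (simp add: funpow_swap1[symmetric])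
qed simp

text \<open>Split the power evenly between the two arguments. For \<open>k = 2m\<close> the
  coefficient is the total mass of the spectral measure of \<open>A^m f\<close>; for
  \<open>k = 2m + 1\<close> one factor \<open>A\<close> is left and the first moment of that measure
  appears.\<close>

lemma walk_pow_moment:
  assumes f: "f \<in> L2 M"
  shows "Re (l2_inner M ((A ^^ k) f) f) = (LINT t|\<mu> f. (a t) ^ k)"
proof (cases "even k")
  case True
  then obtain m where k: "k = m + m" by (metis evenE mult_2)
  have "l2_inner M ((A ^^ k) f) f = l2_inner M ((A ^^ m) f) ((A ^^ m) f)"
    by (simp add: k funpow_add walk_pow_adjoint[OF walk_pow_L2[OF f] f])
  then have "Re (l2_inner M ((A ^^ k) f) f) = measure (\<mu> ((A ^^ m) f)) UNIV"
    by (simp add: l2_inner_self measure_\<mu>_UNIV walk_pow_L2 f)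
  also have "\<dots> = (LINT t|\<mu> ((A ^^ m) f). 1)" by simp
  also have "\<dots> = (LINT t|\<mu> f. (a t) ^ k)"
    unfolding \<mu>_walk_pow[OF f] by (subst integral_density) (auto simp: k mult_2[symmetric])
  finally show ?thesis .
next
  case False
  then obtain m where k: "k = Suc (m + m)" by (metis oddE mult_2 Suc_eq_plus1)
  have "l2_inner M ((A ^^ k) f) f = l2_inner M ((A ^^ m) (A ((A ^^ m) f))) f"
    by (simp add: k funpow_add funpow_swap1)
  also have "\<dots> = l2_inner M (A ((A ^^ m) f)) ((A ^^ m) f)"
    by (rule walk_pow_adjoint) (auto simp: walk_L2 walk_pow_L2 f)
  finally have "Re (l2_inner M ((A ^^ k) f) f) = (LINT t|\<mu> ((A ^^ m) f). a t)"
    by (simp add: walk_form_a walk_pow_L2 f)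
  also have "\<dots> = (LINT t|\<mu> f. (a t) ^ k)"
    unfolding \<mu>_walk_pow[OF f] by (subst integral_density) (auto simp: k mult_2[symmetric] power_Suc2 simp del: power_Suc)
  finally show ?thesis .
qed

lemma form_eq_integral:
  assumes f: "f \<in> L2 M" shows "form f q = (LINT t|\<mu> f. poly q (a t))"
proof -
  have i: "integrable (\<mu> f) (\<lambda>t. a t ^ k)" for k
    using poly_a_integrable[OF f, of "monom 1 k"] by (simp add: poly_monom)
  have "form f q = Re (l2_inner M (\<lambda>p. \<Sum>k\<le>degree q. of_real (coeff q k) * (A ^^ k) f p) f)"
    by (simp add: form_def poly_op_def[abs_def])
  also have "\<dots> = (\<Sum>k\<le>degree q. coeff q k * Re (l2_inner M ((A ^^ k) f) f))"
    by (subst l2_inner_sum_left) (auto simp: l2_inner_scale_left walk_pow_L2 f L2_scale)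
  also have "\<dots> = (LINT t|\<mu> f. poly q (a t))"
    unfolding poly_altdef by (subst Bochner_Integration.integral_sum) (auto simp: i walk_pow_moment f)
  finally show ?thesis .
qed

section \<open>Spectral projections as strong limits of polynomials\<close>

context
  fixes q :: "nat \<Rightarrow> real poly" and B :: "real set" and C :: real
  assumes B [measurable]: "B \<in> sets borel"
    and qC: "\<And>n s. \<bar>s\<bar> \<le> real N \<Longrightarrow> \<bar>poly (q n) s\<bar> \<le> C"
    and qlim: "\<And>t. \<bar>a t\<bar> \<le> real N \<Longrightarrow> (\<lambda>n. poly (q n) (a t)) \<longlonglongrightarrow> indicator B t"
begin

text \<open>Dominated convergence. The squares are included because an indicator is its own square:
  their convergence to the same limit is what upgrades weak to strong convergence.\<close>

lemma form_tendsto: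
  assumes f: "f \<in> L2 M"
  shows "(\<lambda>n. form f (q n)) \<longlonglongrightarrow> measure (\<mu> f) B" "(\<lambda>n. form f (q n * q n)) \<longlonglongrightarrow> measure (\<mu> f) B"
proof -
  interpret finite_measure "\<mu> f" by (rule finite_measure_\<mu>[OF f])
  have [measurable]: "poly r \<in> borel_measurable borel" for r :: "real poly"
    by (intro borel_measurable_continuous_onI continuous_intros)
  have *: "(\<lambda>n. LINT t|\<mu> f. poly (r n) (a t)) \<longlonglongrightarrow> (LINT t|\<mu> f. indicator B t)"
    if "\<And>n s. \<bar>s\<bar> \<le> real N \<Longrightarrow> \<bar>poly (r n) s\<bar> \<le> K"
      "\<And>t. \<bar>a t\<bar> \<le> real N \<Longrightarrow> (\<lambda>n. poly (r n) (a t)) \<longlonglongrightarrow> indicator B t" for r :: "nat \<Rightarrow> real poly" and K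
    by (rule integral_dominated_convergence[where w = "\<lambda>_. K"])
       (use AE_\<mu>_a_bound[OF f] that in \<open>auto elim!: eventually_mono\<close>)
  show "(\<lambda>n. form f (q n)) \<longlonglongrightarrow> measure (\<mu> f) B"
    using *[of q C] qC qlim by (simp add: form_eq_integral f)
  have "(\<lambda>n. poly (q n * q n) (a t)) \<longlonglongrightarrow> indicator B t" if "\<bar>a t\<bar> \<le> real N" for t
    using tendsto_mult[OF qlim[OF that] qlim[OF that]] by (cases "t \<in> B") auto
  moreover have "\<bar>poly (q n * q n) s\<bar> \<le> C * C" if "\<bar>s\<bar> \<le> real N" for n s
    using qC[OF that, of n] order_trans[OF abs_ge_zero qC[OF that, of n]]
    unfolding poly_mult abs_mult by (intro mult_mono) auto
  ultimately show "(\<lambda>n. form f (q n * q n)) \<longlonglongrightarrow> measure (\<mu> f) B"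
    using *[of "\<lambda>n. q n * q n" "C * C"] by (simp add: form_eq_integral f)
qed

lemma poly_op_weak_tendsto:
  assumes f: "f \<in> L2 M" and g: "g \<in> L2 M"
  shows "(\<lambda>n. l2_inner M (pA (q n) f) g) \<longlonglongrightarrow> l2_inner M (E B f) g"
proof -
  have d: "(\<lambda>n. l2_inner M (pA (q n) h) h) \<longlonglongrightarrow> l2_inner M (E B h) h" if h: "h \<in> L2 M" for h
    using tendsto_of_real[OF form_tendsto(1)[OF h], where 'a = complex] poly_op_form_real[OF h]
    by (simp add: form_def measure_\<mu> E_form h)
  have "(\<lambda>n. 4 * l2_inner M (pA (q n) f) g) \<longlonglongrightarrow> 4 * l2_inner M (E B f) g"
    unfolding l2_polarization[OF poly_op_bounded f g] l2_polarization[OF E_bounded[OF B] f g]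
    by (intro tendsto_sum tendsto_mult tendsto_const d L2_add L2_scale f g)
  then show ?thesis by (simp add: tendsto_mult_left_iff)
qed

text \<open>In the expansion of the squared distance the form of \<open>q n * q n\<close>, the mass
  of \<open>B\<close> and the real part of the mixed term, taken with the factors 1, 1 and -2, all
  tend to the mass of \<open>B\<close>.\<close>

lemma poly_op_strong_tendsto:
  assumes f: "f \<in> L2 M"
  shows "(\<lambda>n. l2_norm M (\<lambda>p. pA (q n) f p - E B f p)) \<longlonglongrightarrow> 0"
proof -
  have e: "(l2_norm M (\<lambda>p. pA (q n) f p - E B f p))\<^sup>2 =
      form f (q n * q n) + measure (\<mu> f) B - 2 * Re (l2_inner M (pA (q n) f) (E B f))" for n
    by (subst l2_norm_sq_diff) (auto simp: poly_op_L2 E_L2 f form_sq measure_\<mu>)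
  have "(\<lambda>n. (l2_norm M (\<lambda>p. pA (q n) f p - E B f p))\<^sup>2) \<longlonglongrightarrow>
      measure (\<mu> f) B + measure (\<mu> f) B - 2 * Re (l2_inner M (E B f) (E B f))"
    unfolding e by (intro tendsto_intros form_tendsto f tendsto_Re poly_op_weak_tendsto E_L2 B)
  also have "l2_inner M (E B f) (E B f) = of_real (measure (\<mu> f) B)"
    by (simp add: l2_inner_self measure_\<mu> f)
  finally have "(\<lambda>n. (l2_norm M (\<lambda>p. pA (q n) f p - E B f p))\<^sup>2) \<longlonglongrightarrow> 0" by simp
  then have "(\<lambda>n. sqrt ((l2_norm M (\<lambda>p. pA (q n) f p - E B f p))\<^sup>2)) \<longlonglongrightarrow> sqrt 0" by (rule tendsto_real_sqrt)
  then show ?thesis by simp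
qed

end

end

section \<open>Coloured graphs as involution systems\<close>

lemma coloured_dgraphD:
  assumes "coloured_dgraph d G"
  shows "e \<in> edges G \<Longrightarrow> \<exists>v\<in>verts G. \<exists>w\<in>verts G. v \<noteq> w \<and> e = {v, w}"
    and "v \<in> verts G \<Longrightarrow> finite (nbrs G v)" and "v \<in> verts G \<Longrightarrow> card (nbrs G v) \<le> d"
    and "e \<in> edges G \<Longrightarrow> colour G e \<in> {1..d + 1}"
    and "e \<in> edges G \<Longrightarrow> e' \<in> edges G \<Longrightarrow> e \<inter> e' \<noteq> {} \<Longrightarrow> colour G e = colour G e' \<Longrightarrow> e = e'"
proof -
  note * = assms[unfolded coloured_dgraph_def vdegree_def]
  show "e \<in> edges G \<Longrightarrow> \<exists>v\<in>verts G. \<exists>w\<in>verts G. v \<noteq> w \<and> e = {v, w}" using * by simp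
  show "v \<in> verts G \<Longrightarrow> finite (nbrs G v)" "v \<in> verts G \<Longrightarrow> card (nbrs G v) \<le> d" using * by simp_all
  show "e \<in> edges G \<Longrightarrow> colour G e \<in> {1..d + 1}" using * by simp
  show "e \<in> edges G \<Longrightarrow> e' \<in> edges G \<Longrightarrow> e \<inter> e' \<noteq> {} \<Longrightarrow> colour G e = colour G e' \<Longrightarrow> e = e'"
    using * by meson
qed

lemma coloured_dgraphI:
  assumes "\<And>e. e \<in> edges G \<Longrightarrow> \<exists>v\<in>verts G. \<exists>w\<in>verts G. v \<noteq> w \<and> e = {v, w}"
    and "\<And>v. v \<in> verts G \<Longrightarrow> finite (nbrs G v) \<and> card (nbrs G v) \<le> d"
    and "\<And>e. e \<in> edges G \<Longrightarrow> colour G e \<in> {1..d + 1}"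
    and "\<And>e e'. e \<in> edges G \<Longrightarrow> e' \<in> edges G \<Longrightarrow> e \<inter> e' \<noteq> {} \<Longrightarrow> colour G e = colour G e' \<Longrightarrow> e = e'"
  shows "coloured_dgraph d G"
  unfolding coloured_dgraph_def vdegree_def using assms by metis

lemma rooted_isoE:
  assumes "rooted_iso A B"
  obtains f where "bij_betw f (verts (fst A)) (verts (fst B))" "f (snd A) = snd B"
    "\<And>v w. v \<in> verts (fst A) \<Longrightarrow> w \<in> verts (fst A) \<Longrightarrow> {v, w} \<in> edges (fst A) \<longleftrightarrow> {f v, f w} \<in> edges (fst B)"
    "\<And>v w. v \<in> verts (fst A) \<Longrightarrow> w \<in> verts (fst A) \<Longrightarrow> {v, w} \<in> edges (fst A) \<Longrightarrow>
      colour (fst B) {f v, f w} = colour (fst A) {v, w}"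
  using assms unfolding rooted_iso_def by blast

lemma rooted_iso_sym:
  assumes "rooted_iso A B" "snd A \<in> verts (fst A)" shows "rooted_iso B A"
proof -
  obtain f where f: "bij_betw f (verts (fst A)) (verts (fst B))" "f (snd A) = snd B"
    and e: "\<And>v w. v \<in> verts (fst A) \<Longrightarrow> w \<in> verts (fst A) \<Longrightarrow>
        ({v, w} \<in> edges (fst A) \<longleftrightarrow> {f v, f w} \<in> edges (fst B)) \<and>
        ({v, w} \<in> edges (fst A) \<longrightarrow> colour (fst B) {f v, f w} = colour (fst A) {v, w})"
    using assms(1) unfolding rooted_iso_def by blast
  let ?g = "inv_into (verts (fst A)) f"
  have g: "?g v \<in> verts (fst A)" "f (?g v) = v" if "v \<in> verts (fst B)" for v
    using f(1) that by (auto simp: bij_betw_def inv_into_into f_inv_into_f)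
  show ?thesis unfolding rooted_iso_def
  proof (intro exI[of _ ?g] conjI ballI)
    show "bij_betw ?g (verts (fst B)) (verts (fst A))" by (rule bij_betw_inv_into[OF f(1)])
    show "?g (snd B) = snd A" using f assms(2) by (metis bij_betw_inv_into_left)
  qed (use e g in \<open>metis+\<close>)
qed

lemma rooted_iso_trans:
  assumes "rooted_iso A B" "rooted_iso B C" shows "rooted_iso A C"
proof -
  obtain f where f: "bij_betw f (verts (fst A)) (verts (fst B))" "f (snd A) = snd B"
    and e: "\<And>v w. v \<in> verts (fst A) \<Longrightarrow> w \<in> verts (fst A) \<Longrightarrow>
        ({v, w} \<in> edges (fst A) \<longleftrightarrow> {f v, f w} \<in> edges (fst B)) \<and>
        ({v, w} \<in> edges (fst A) \<longrightarrow> colour (fst B) {f v, f w} = colour (fst A) {v, w})"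
    using assms(1) unfolding rooted_iso_def by blast
  obtain g where g: "bij_betw g (verts (fst B)) (verts (fst C))" "g (snd B) = snd C"
    and e': "\<And>v w. v \<in> verts (fst B) \<Longrightarrow> w \<in> verts (fst B) \<Longrightarrow>
        ({v, w} \<in> edges (fst B) \<longleftrightarrow> {g v, g w} \<in> edges (fst C)) \<and>
        ({v, w} \<in> edges (fst B) \<longrightarrow> colour (fst C) {g v, g w} = colour (fst B) {v, w})"
    using assms(2) unfolding rooted_iso_def by blast
  have fB: "f v \<in> verts (fst B)" if "v \<in> verts (fst A)" for v using f(1) that by (auto simp: bij_betw_def)
  show ?thesis unfolding rooted_iso_def
    by (intro exI[of _ "g \<circ> f"] conjI ballI bij_betw_trans[OF f(1) g(1)])
       (use f g e e' fB in auto)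
qed

text \<open>Weak convergence speaks of representatives with natural numbers as vertices; this brings
  the balls of the graphs and of the leaves, whose vertices have other types, into its scope. Edges
  are copied along an injection, and colours are read back through its inverse.\<close>

lemma rooted_ball_nat_copy:
  fixes K :: "'v rooted"
  assumes K: "rooted_ball r d K"
  obtains A :: "nat rooted" where "rooted_ball r d A" "rooted_iso K A"
proof -
  define V where "V = verts (fst K)"
  have fin: "finite V" and dg: "coloured_dgraph d (fst K)" and root: "snd K \<in> V"
    and dist: "\<And>v. v \<in> V \<Longrightarrow> gdist_le (fst K) r (snd K) v"
    using K by (auto simp: rooted_ball_def V_def)
  obtain h :: "'v \<Rightarrow> nat" where h: "inj_on h V"
    using finite_imp_inj_to_nat_seg[OF fin] by blast
  define g where "g = inv_into V h"
  have gh: "g (h v) = v" if "v \<in> V" for v using h that by (simp add: g_def)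
  have ed: "\<exists>v\<in>V. \<exists>w\<in>V. v \<noteq> w \<and> e = {v, w}" if "e \<in> edges (fst K)" for e
    using coloured_dgraphD(1)[OF dg that] by (simp add: V_def)
  have edV: "e \<subseteq> V" if "e \<in> edges (fst K)" for e using ed[OF that] by auto
  have ghe: "g ` h ` e = e" if "e \<subseteq> V" for e using that gh by (force simp: image_image)
  define H where "H = \<lparr>verts = h ` V, edges = (\<lambda>e. h ` e) ` edges (fst K), colour = (\<lambda>e. colour (fst K) (g ` e))\<rparr>"
  have Hed: "{h v, h w} \<in> edges H \<longleftrightarrow> {v, w} \<in> edges (fst K)" if "v \<in> V" "w \<in> V" for v w
  proof
    assume "{h v, h w} \<in> edges H"
    then obtain e where e: "e \<in> edges (fst K)" "{h v, h w} = h ` e" by (auto simp: H_def)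
    then have "{g (h v), g (h w)} = e" using ghe edV by (metis image_empty image_insert)
    then show "{v, w} \<in> edges (fst K)" using e(1) gh that by simp
  next
    assume "{v, w} \<in> edges (fst K)"
    then show "{h v, h w} \<in> edges H" by (auto simp: H_def intro!: image_eqI[of _ _ "{v, w}"])
  qed
  have edH: "\<exists>v\<in>V. \<exists>w\<in>V. v \<noteq> w \<and> e = {h v, h w} \<and> {v, w} \<in> edges (fst K)" if e: "e \<in> edges H" for e
  proof -
    obtain e' where e': "e' \<in> edges (fst K)" "e = h ` e'" using e by (auto simp: H_def)
    obtain v w where "v \<in> V" "w \<in> V" "v \<noteq> w" "e' = {v, w}" using ed[OF e'(1)] by blast
    then show ?thesis using e' by (intro bexI[of _ v] bexI[of _ w]) auto
  qed
  have nb: "nbrs H (h v) = h ` nbrs (fst K) v" if v: "v \<in> V" for v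
  proof (intro set_eqI iffI)
    fix x assume x: "x \<in> nbrs H (h v)"
    then obtain a b where ab: "a \<in> V" "b \<in> V" "{h v, x} = {h a, h b}" using edH by (fastforce simp: nbrs_def)
    then obtain w where "w \<in> V" "x = h w" by (auto simp: doubleton_eq_iff)
    then show "x \<in> h ` nbrs (fst K) v" using x Hed[OF v] by (auto simp: nbrs_def)
  next
    fix x assume "x \<in> h ` nbrs (fst K) v"
    then obtain w where w: "{v, w} \<in> edges (fst K)" "x = h w" by (auto simp: nbrs_def)
    then show "x \<in> nbrs H (h v)" using edV[OF w(1)] Hed[OF v, of w] by (auto simp: nbrs_def)
  qed
  have colH: "colour H {h v, h w} = colour (fst K) {v, w}" if "v \<in> V" "w \<in> V" for v w
    using that gh by (simp add: H_def)
  have dH: "coloured_dgraph d H"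
    unfolding coloured_dgraph_def
  proof (intro conjI ballI impI)
    fix e assume e: "e \<in> edges H"
    obtain v w where vw: "v \<in> V" "w \<in> V" "v \<noteq> w" "e = {h v, h w}" "{v, w} \<in> edges (fst K)" using edH[OF e] by blast
    have "h v \<noteq> h w" using h vw by (auto simp: inj_on_def)
    then show "\<exists>v\<in>verts H. \<exists>w\<in>verts H. v \<noteq> w \<and> e = {v, w}"
      using vw by (auto simp: H_def)
    show "colour H e \<in> {1..d + 1}" using vw colH coloured_dgraphD(4)[OF dg vw(5)] by simp
    fix e' assume e': "e' \<in> edges H" and ne: "e \<noteq> e' \<and> e \<inter> e' \<noteq> {}"
    obtain v' w' where vw': "v' \<in> V" "w' \<in> V" "e' = {h v', h w'}" "{v', w'} \<in> edges (fst K)" using edH[OF e'] by blast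
    have "{v, w} \<noteq> {v', w'}"
    proof
      assume "{v, w} = {v', w'}"
      then have "h ` {v, w} = h ` {v', w'}" by (rule arg_cong)
      then show False using ne vw(4) vw'(3) by simp
    qed
    moreover have "{v, w} \<inter> {v', w'} \<noteq> {}"
    proof -
      have "h ` {v, w} \<inter> h ` {v', w'} \<noteq> {}" using ne vw(4) vw'(3) by simp
      moreover have "h ` {v, w} \<inter> h ` {v', w'} = h ` ({v, w} \<inter> {v', w'})"
        by (rule inj_on_image_Int[OF h, symmetric]) (use vw vw' in simp_all)
      ultimately show ?thesis by blast
    qed
    ultimately have "colour (fst K) {v, w} \<noteq> colour (fst K) {v', w'}"
      using coloured_dgraphD(5)[OF dg vw(5) vw'(4)] by blast
    then show "colour H e \<noteq> colour H e'" using vw vw' colH by metis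
  next
    fix x assume "x \<in> verts H"
    then obtain v where v: "v \<in> V" "x = h v" by (auto simp: H_def)
    have fv: "finite (nbrs (fst K) v)" "card (nbrs (fst K) v) \<le> d"
      using coloured_dgraphD(2,3)[OF dg] v by (auto simp: V_def)
    show "finite (nbrs H x)" using nb v fv by simp
    show "vdegree H x \<le> d" unfolding vdegree_def using nb v fv card_image_le le_trans by metis
  qed
  have walk: "(h (snd K), h v) \<in> adj_rel H ^^ n" if "(snd K, v) \<in> adj_rel (fst K) ^^ n" for v n
    using that
  proof (induction n arbitrary: v)
    case (Suc n)
    then obtain u where u: "(snd K, u) \<in> adj_rel (fst K) ^^ n" "{u, v} \<in> edges (fst K)"
      by (auto simp: adj_rel_def)
    then show ?case using Suc.IH[OF u(1)] Hed[of u v] edV[OF u(2)] by (auto simp: adj_rel_def)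
  qed auto
  show ?thesis
  proof (rule that[of "(H, h (snd K))"])
    show "rooted_ball r d (H, h (snd K))"
      using dH fin root dist walk unfolding rooted_ball_def gdist_le_def by (fastforce simp: H_def)
    show "rooted_iso K (H, h (snd K))"
      unfolding rooted_iso_def
      by (intro exI[of _ h]) (use h Hed colH in \<open>auto simp: V_def[symmetric] H_def bij_betw_def\<close>)
  qed
qed

section \<open>Words in the colours and the balls they reach\<close>

definition ncols :: "nat \<Rightarrow> nat" where "ncols d = d + 1"

definition letters :: "nat \<Rightarrow> nat set" where "letters d = {1..d + 1}"

definition words :: "nat \<Rightarrow> nat list set" where "words d = lists (letters d)"

lemma words_simps [simp]:
  "[] \<in> words d" "j # w \<in> words d \<longleftrightarrow> j \<in> letters d \<and> w \<in> words d"
  "u @ w \<in> words d \<longleftrightarrow> u \<in> words d \<and> w \<in> words d"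
  by (auto simp: words_def)

lemma finite_letters [simp]: "finite (letters d)"
  by (simp add: letters_def)

lemma letters_ncols: "{1..ncols d} = letters d"
  by (simp add: letters_def ncols_def)

lemma card_letters [simp]: "card (letters d) = ncols d"
  by (simp add: letters_def ncols_def)

lemma finite_words_le: "finite {w \<in> words d. length w \<le> r}"
proof -
  have "{w \<in> words d. length w \<le> r} = {w. set w \<subseteq> letters d \<and> length w \<le> r}"
    by (auto simp: words_def lists_eq_set)
  then show ?thesis by (simp add: finite_lists_length_le)
qed

text \<open>Common interface of finite graphs, with \<open>colour_step\<close>, and leafgraphs, with
  \<open>invol\<close>: a colour missing at \<open>v\<close> becomes a letter that fixes
  \<open>v\<close>, so walks become words. \<open>fold T w v\<close> applies the first letter of
  \<open>w\<close> first, hence appending a letter extends the walk at its end.\<close>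

locale involution_graph =
  fixes d :: nat and H :: "'v cgraph" and T :: "nat \<Rightarrow> 'v \<Rightarrow> 'v"
  assumes dgraph: "coloured_dgraph d H"
    and T_verts: "v \<in> verts H \<Longrightarrow> j \<in> letters d \<Longrightarrow> T j v \<in> verts H"
    and T_invol: "v \<in> verts H \<Longrightarrow> j \<in> letters d \<Longrightarrow> T j (T j v) = v"
    and edge_iff: "v \<in> verts H \<Longrightarrow> {v, w} \<in> edges H \<longleftrightarrow> w \<noteq> v \<and> (\<exists>j\<in>letters d. w = T j v)"
    and colour_T: "v \<in> verts H \<Longrightarrow> j \<in> letters d \<Longrightarrow> T j v \<noteq> v \<Longrightarrow> colour H {v, T j v} = j"
begin

lemma fold_verts: "w \<in> words d \<Longrightarrow> v \<in> verts H \<Longrightarrow> fold T w v \<in> verts H"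
  by (induction w arbitrary: v) (auto intro: T_verts)

lemma T_distinct: "v \<in> verts H \<Longrightarrow> i \<in> letters d \<Longrightarrow> j \<in> letters d \<Longrightarrow> T i v = T j v \<Longrightarrow> T i v \<noteq> v \<Longrightarrow> i = j"
  using colour_T by metis

text \<open>Letters that fix \<open>v\<close> contribute \<open>g v - g v = 0\<close>, so the sum
  over the neighbours extends to all letters and the varying degree is replaced by the constant
  \<open>ncols d\<close>.\<close>

lemma laplacian_eq_walk:
  assumes v: "v \<in> verts H"
  shows "graph_laplacian H g v = of_nat (ncols d) * g v - walk (ncols d) T g v"
proof -
  define J where "J = {j \<in> letters d. T j v \<noteq> v}"
  have nb: "nbrs H v = (\<lambda>j. T j v) ` J" using edge_iff[OF v] by (auto simp: nbrs_def J_def)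
  have inj: "inj_on (\<lambda>j. T j v) J" using T_distinct[OF v] by (auto simp: inj_on_def J_def)
  have fJ: "finite J" by (simp add: J_def)
  have "graph_laplacian H g v = of_nat (card J) * g v - (\<Sum>j\<in>J. g (T j v))"
    by (simp add: graph_laplacian_def vdegree_def nb card_image[OF inj] sum.reindex[OF inj])
  also have "\<dots> = (\<Sum>j\<in>J. g v - g (T j v))" by (simp add: sum_subtractf)
  also have "\<dots> = (\<Sum>j\<in>letters d. g v - g (T j v))"
    by (rule sum.mono_neutral_left) (auto simp: J_def)
  also have "\<dots> = of_nat (ncols d) * g v - walk (ncols d) T g v" by (simp add: sum_subtractf walk_def flip: letters_ncols)
  finally show ?thesis .
qed

lemma relpow_word:
  assumes v: "v \<in> verts H" and u: "(v, u) \<in> adj_rel H ^^ n"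
  shows "\<exists>w\<in>words d. length w = n \<and> u = fold T w v"
  using u
proof (induction n arbitrary: u)
  case (Suc n)
  then obtain x where x: "(v, x) \<in> adj_rel H ^^ n" "{x, u} \<in> edges H" by (auto simp: adj_rel_def)
  then obtain w where w: "w \<in> words d" "length w = n" "x = fold T w v" using Suc.IH by blast
  then obtain j where "j \<in> letters d" "u = T j x" using edge_iff[OF fold_verts[OF w(1) v]] x by auto
  then show ?case using w by (intro bexI[of _ "w @ [j]"]) auto
qed auto

text \<open>Only an inequality, in contrast to \<open>relpow_word\<close>: a letter that fixes the
  current vertex makes no step in the graph.\<close>

lemma word_relpow:
  assumes v: "v \<in> verts H" and w: "w \<in> words d"
  shows "\<exists>n\<le>length w. (v, fold T w v) \<in> adj_rel H ^^ n"
  using w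
proof (induction w rule: rev_induct)
  case (snoc j w)
  then have w: "w \<in> words d" and j: "j \<in> letters d" by auto
  from snoc w obtain n where n: "n \<le> length w" "(v, fold T w v) \<in> adj_rel H ^^ n" by auto
  show ?case
  proof (cases "T j (fold T w v) = fold T w v")
    case True then show ?thesis using n by (intro exI[of _ n]) auto
  next
    case False
    then have "(fold T w v, T j (fold T w v)) \<in> adj_rel H"
      using edge_iff[OF fold_verts[OF w v]] j by (auto simp: adj_rel_def)
    then show ?thesis using n by (intro exI[of _ "Suc n"]) auto
  qed
qed (auto intro: exI[of _ 0])

lemma gdist_le_iff:
  assumes v: "v \<in> verts H"
  shows "gdist_le H r v u \<longleftrightarrow> (\<exists>w\<in>words d. length w \<le> r \<and> u = fold T w v)"
proof
  assume "gdist_le H r v u"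
  then obtain n where n: "n \<le> r" "(v, u) \<in> adj_rel H ^^ n" by (auto simp: gdist_le_def)
  from relpow_word[OF v n(2)] n(1) show "\<exists>w\<in>words d. length w \<le> r \<and> u = fold T w v" by auto
next
  assume "\<exists>w\<in>words d. length w \<le> r \<and> u = fold T w v"
  then obtain w where w: "w \<in> words d" "length w \<le> r" "u = fold T w v" by auto
  from word_relpow[OF v w(1)] obtain n where "n \<le> length w" "(v, u) \<in> adj_rel H ^^ n" using w(3) by auto
  then show "gdist_le H r v u" using w(2) unfolding gdist_le_def by (intro exI[of _ n]) auto
qed

definition ball :: "nat \<Rightarrow> 'v \<Rightarrow> 'v set" where
  "ball r v = {fold T w v | w. w \<in> words d \<and> length w \<le> r}"

lemma ballI: "w \<in> words d \<Longrightarrow> length w \<le> r \<Longrightarrow> fold T w v \<in> ball r v"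
  by (auto simp: ball_def)

lemma ball_verts: "v \<in> verts H \<Longrightarrow> u \<in> ball r v \<Longrightarrow> u \<in> verts H"
  by (auto simp: ball_def fold_verts)

lemma root_in_ball: "v \<in> ball r v"
  using ballI[of "[]"] by simp

lemma finite_ball: "finite (ball r v)"
proof -
  have "ball r v = (\<lambda>w. fold T w v) ` {w \<in> words d. length w \<le> r}"
    by (auto simp: ball_def)
  then show ?thesis by (simp add: finite_words_le)
qed

lemma nbhd_eq:
  assumes v: "v \<in> verts H"
  shows "nbhd H r v = (\<lparr>verts = ball r v, edges = {e \<in> edges H. e \<subseteq> ball r v}, colour = colour H\<rparr>, v)"
proof -
  have "{w \<in> verts H. gdist_le H r v w} = ball r v"
    using v by (auto simp: gdist_le_iff ball_def fold_verts)
  then show ?thesis by (simp add: nbhd_def Let_def)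
qed

lemma rooted_ball_nbhd:
  assumes v: "v \<in> verts H" shows "rooted_ball r d (nbhd H r v)"
proof -
  let ?K = "\<lparr>verts = ball r v, edges = {e \<in> edges H. e \<subseteq> ball r v}, colour = colour H\<rparr>"
  have "coloured_dgraph d ?K"
  proof (rule coloured_dgraphI)
    fix e assume "e \<in> edges ?K"
    then have e: "e \<in> edges H" "e \<subseteq> ball r v" by auto
    then obtain a b where "a \<noteq> b" "e = {a, b}" using coloured_dgraphD(1)[OF dgraph] by blast
    then show "\<exists>v\<in>verts ?K. \<exists>w\<in>verts ?K. v \<noteq> w \<and> e = {v, w}"
      using e(2) by (intro bexI[of _ a] bexI[of _ b]) auto
    show "colour ?K e \<in> {1..d + 1}" using coloured_dgraphD(4)[OF dgraph e(1)] by simp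
  next
    fix e e' assume "e \<in> edges ?K" "e' \<in> edges ?K" "e \<inter> e' \<noteq> {}" "colour ?K e = colour ?K e'"
    then show "e = e'" using coloured_dgraphD(5)[OF dgraph, of e e'] by simp
  next
    fix u assume "u \<in> verts ?K"
    then have u: "finite (nbrs H u)" "card (nbrs H u) \<le> d"
      using coloured_dgraphD(2,3)[OF dgraph] ball_verts[OF v] by auto
    have sub: "nbrs ?K u \<subseteq> nbrs H u" by (auto simp: nbrs_def)
    show "finite (nbrs ?K u) \<and> card (nbrs ?K u) \<le> d"
      using finite_subset[OF sub u(1)] card_mono[OF u(1) sub] u(2) by simp
  qed
  moreover have "gdist_le ?K r v u" if u: "u \<in> ball r v" for u
  proof -
    obtain n where n: "n \<le> r" "(v, u) \<in> adj_rel H ^^ n"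
      using u gdist_le_iff[OF v, of r u] by (auto simp: ball_def gdist_le_def)
    \<comment> \<open>Every prefix of a walk of at most \<open>r\<close> steps ends inside the ball,
      so the whole walk survives in the induced subgraph.\<close>
    have "(v, u) \<in> adj_rel ?K ^^ n" if "n \<le> r" "(v, u) \<in> adj_rel H ^^ n" for n u
      using that
    proof (induction n arbitrary: u)
      case (Suc n)
      then obtain x where x: "(v, x) \<in> adj_rel H ^^ n" "{x, u} \<in> edges H" by (auto simp: adj_rel_def)
      have "x \<in> ball r v" "u \<in> ball r v"
        using relpow_word[OF v x(1)] relpow_word[OF v Suc.prems(2)] Suc.prems(1) by (auto intro!: ballI)
      then show ?case using Suc.IH[of x] x Suc.prems(1) by (auto simp: adj_rel_def)
    qed auto
    then show ?thesis using n by (auto simp: gdist_le_def)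
  qed
  ultimately show ?thesis
    using v finite_ball root_in_ball by (auto simp: rooted_ball_def nbhd_eq)
qed

end

text \<open>The isomorphism type of a ball and the table of coincidences between short words determine
  each other, up to a change of radius by one.\<close>

definition same_table ::
    "nat \<Rightarrow> nat \<Rightarrow> (nat \<Rightarrow> 'v \<Rightarrow> 'v) \<Rightarrow> 'v \<Rightarrow> (nat \<Rightarrow> 'w \<Rightarrow> 'w) \<Rightarrow> 'w \<Rightarrow> bool" where
  "same_table d r T v T' v' \<longleftrightarrow> (\<forall>w\<in>words d. \<forall>w'\<in>words d.
     length w \<le> r \<and> length w' \<le> r \<longrightarrow> (fold T w v = fold T w' v \<longleftrightarrow> fold T' w v' = fold T' w' v'))"

text \<open>The isomorphism sends the end of a word to the end of the same word; the table makes
  this independent of the word and injective. Whether colour \<open>j\<close> joins two ends is an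
  equation between a word of length at most \<open>r\<close> and another one prolonged by
  \<open>j\<close>, which accounts for the radius \<open>Suc r\<close>.\<close>

lemma same_table_imp_rooted_iso:
  assumes "involution_graph d H T" "involution_graph d H' T'"
    and v: "v \<in> verts H" and v': "v' \<in> verts H'"
    and tab: "same_table d (Suc r) T v T' v'"
  shows "rooted_iso (nbhd H r v) (nbhd H' r v')"
proof -
  interpret H: involution_graph d H T by fact
  interpret H': involution_graph d H' T' by fact
  have tb: "fold T w v = fold T w' v \<longleftrightarrow> fold T' w v' = fold T' w' v'"
    if "w \<in> words d" "w' \<in> words d" "length w \<le> Suc r" "length w' \<le> Suc r" for w w'
    using tab that unfolding same_table_def by blast
  define f where "f u = fold T' (SOME w. w \<in> words d \<and> length w \<le> r \<and> u = fold T w v) v'" for u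
  have f: "f (fold T w v) = fold T' w v'" if w: "w \<in> words d" "length w \<le> r" for w
  proof -
    let ?P = "\<lambda>w'. w' \<in> words d \<and> length w' \<le> r \<and> fold T w v = fold T w' v"
    have "?P (SOME w'. ?P w')" by (rule someI[of ?P w]) (use w in auto)
    then show ?thesis unfolding f_def using tb[of w "SOME w'. ?P w'"] w by auto
  qed
  have step: "fold T w' v = T j (fold T w v) \<longleftrightarrow> fold T' w' v' = T' j (fold T' w v')"
    if "w \<in> words d" "w' \<in> words d" "length w \<le> r" "length w' \<le> r" "j \<in> letters d" for w w' j
    using tb[of w' "w @ [j]"] that by auto
  show ?thesis
    unfolding rooted_iso_def H.nbhd_eq[OF v] H'.nbhd_eq[OF v'] fst_conv snd_conv cgraph.simps
  proof (intro exI[of _ f] conjI ballI)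
    show "bij_betw f (H.ball r v) (H'.ball r v')"
      unfolding bij_betw_def
    proof
      show "inj_on f (H.ball r v)"
      proof (rule inj_onI)
        fix x y assume "x \<in> H.ball r v" "y \<in> H.ball r v" "f x = f y"
        then obtain w w' where "w \<in> words d" "length w \<le> r" "x = fold T w v"
          "w' \<in> words d" "length w' \<le> r" "y = fold T w' v" by (auto simp: H.ball_def)
        then show "x = y" using f[of w] f[of w'] tb[of w w'] \<open>f x = f y\<close> by auto
      qed
      show "f ` H.ball r v = H'.ball r v'" using f unfolding H.ball_def H'.ball_def by force
    qed
    show "f v = v'" using f[of "[]"] by simp
    fix x y assume "x \<in> H.ball r v" "y \<in> H.ball r v"
    then obtain w w' where w: "w \<in> words d" "length w \<le> r" "x = fold T w v"
      and w': "w' \<in> words d" "length w' \<le> r" "y = fold T w' v" by (auto simp: H.ball_def)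
    have fx: "f x = fold T' w v'" "f y = fold T' w' v'" using f w w' by auto
    have xy: "x \<in> verts H" "f x \<in> verts H'" using w fx v v' H.fold_verts H'.fold_verts by auto
    have in_balls: "{x, y} \<subseteq> H.ball r v" "{f x, f y} \<subseteq> H'.ball r v'"
      using w w' fx by (auto intro: H.ballI H'.ballI)
    have ne: "x \<noteq> y \<longleftrightarrow> f x \<noteq> f y" using tb[of w w'] w w' fx by auto
    have st: "y = T j x \<longleftrightarrow> f y = T' j (f x)" if "j \<in> letters d" for j using step[of w w' j] w w' fx that by auto
    have e: "{x, y} \<in> edges H \<longleftrightarrow> {f x, f y} \<in> edges H'"
      unfolding H.edge_iff[OF xy(1)] H'.edge_iff[OF xy(2)] using st ne by auto
    then show "({x, y} \<in> {e \<in> edges H. e \<subseteq> H.ball r v}) = ({f x, f y} \<in> {e \<in> edges H'. e \<subseteq> H'.ball r v'})"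
      using in_balls by auto
    show "{x, y} \<in> {e \<in> edges H. e \<subseteq> H.ball r v} \<longrightarrow> colour H' {f x, f y} = colour H {x, y}"
    proof
      assume "{x, y} \<in> {e \<in> edges H. e \<subseteq> H.ball r v}"
      then obtain j where j: "j \<in> letters d" "y = T j x" "y \<noteq> x" using H.edge_iff[OF xy(1)] by auto
      then show "colour H' {f x, f y} = colour H {x, y}"
        using H.colour_T[OF xy(1) j(1)] H'.colour_T[OF xy(2) j(1)] st[OF j(1)] ne by auto
    qed
  qed
qed

text \<open>An isomorphism of balls commutes with each word that stays inside: a moving letter is
  recognized by the colour of its edge, a fixing letter by the absence of such an edge. All prefixes
  of a word of length at most \<open>r\<close> end in the ball, so here the radius need not
  grow.\<close>

lemma rooted_iso_imp_word_fixed_iff: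
  assumes "involution_graph d H T" "involution_graph d H' T'"
    and v: "v \<in> verts H" and v': "v' \<in> verts H'"
    and iso: "rooted_iso (nbhd H r v) (nbhd H' r v')"
    and w: "w \<in> words d" "length w \<le> r"
  shows "fold T w v = v \<longleftrightarrow> fold T' w v' = v'"
proof -
  interpret H: involution_graph d H T by fact
  interpret H': involution_graph d H' T' by fact
  obtain f where f: "bij_betw f (H.ball r v) (H'.ball r v')" "f v = v'"
    and e: "\<And>x y. x \<in> H.ball r v \<Longrightarrow> y \<in> H.ball r v \<Longrightarrow>
      {x, y} \<in> {e \<in> edges H. e \<subseteq> H.ball r v} \<longleftrightarrow> {f x, f y} \<in> {e \<in> edges H'. e \<subseteq> H'.ball r v'}"
    "\<And>x y. x \<in> H.ball r v \<Longrightarrow> y \<in> H.ball r v \<Longrightarrow>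
      {x, y} \<in> {e \<in> edges H. e \<subseteq> H.ball r v} \<Longrightarrow> colour H' {f x, f y} = colour H {x, y}"
    by (rule rooted_isoE[OF iso], unfold H.nbhd_eq[OF v] H'.nbhd_eq[OF v'] fst_conv snd_conv cgraph.simps)
       (assumption | rule that)+
  have fB: "f x \<in> H'.ball r v'" if "x \<in> H.ball r v" for x using f(1) that by (metis bij_betwE)
  have e1: "{x, y} \<in> edges H \<longleftrightarrow> {f x, f y} \<in> edges H'"
    and e2: "{x, y} \<in> edges H \<Longrightarrow> colour H' {f x, f y} = colour H {x, y}"
    if "x \<in> H.ball r v" "y \<in> H.ball r v" for x y
    using e[OF that] that fB[OF that(1)] fB[OF that(2)] by simp_all
  have fw: "f (fold T w v) = fold T' w v'" if "w \<in> words d" "length w \<le> r" for w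
    using that
  proof (induction w rule: rev_induct)
    case Nil then show ?case by (simp add: f)
  next
    case (snoc j w)
    then have w: "w \<in> words d" "length w \<le> r" and j: "j \<in> letters d" by auto
    have IH: "f (fold T w v) = fold T' w v'" using snoc.IH w by auto
    let ?x = "fold T w v" and ?y = "T j (fold T w v)"
    have xB: "?x \<in> H.ball r v" and yB: "?y \<in> H.ball r v"
      using H.ballI[OF w] H.ballI[of "w @ [j]" r v] snoc.prems by auto
    have y'B: "T' j (fold T' w v') \<in> H'.ball r v'"
      using H'.ballI[of "w @ [j]" r v'] snoc.prems by auto
    have xV: "?x \<in> verts H" "f ?x \<in> verts H'" using H.fold_verts[OF w(1) v] H'.fold_verts[OF w(1) v'] IH by auto
    show ?case
    proof (cases "?y = ?x")
      case False
      then have "{?x, ?y} \<in> edges H" using H.edge_iff[OF xV(1)] j by auto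
      then have ed: "{f ?x, f ?y} \<in> edges H'" and col: "colour H' {f ?x, f ?y} = colour H {?x, ?y}"
        using e1 e2 xB yB by auto
      from ed obtain i where i: "i \<in> letters d" "f ?y = T' i (f ?x)" "f ?y \<noteq> f ?x"
        using H'.edge_iff[OF xV(2)] by auto
      then have "i = j" using col H.colour_T[OF xV(1) j False] H'.colour_T[OF xV(2) i(1)] by auto
      then show ?thesis using i IH by simp
    next
      case True
      \<comment> \<open>If \<open>j\<close> moved \<open>f ?x\<close>, the target would still lie in
        the ball, because \<open>w @ [j]\<close> has length at most \<open>r\<close>. Pulling the
        edge back would give an edge of colour \<open>j\<close> at \<open>?x\<close>, a vertex that
        \<open>j\<close> fixes.\<close>
      have "T' j (f ?x) = f ?x"
      proof (rule ccontr)
        assume ne: "T' j (f ?x) \<noteq> f ?x"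
        obtain z where z: "z \<in> H.ball r v" "f z = T' j (f ?x)"
          using y'B f(1) IH by (metis bij_betw_imp_surj_on imageE)
        have "{f ?x, f z} \<in> edges H'" using H'.edge_iff[OF xV(2)] j z ne by auto
        then have ed: "{?x, z} \<in> edges H" and col: "colour H' {f ?x, f z} = colour H {?x, z}"
          using e1[OF xB z(1)] e2[OF xB z(1)] by auto
        from ed obtain i where i: "i \<in> letters d" "z = T i ?x" "z \<noteq> ?x" using H.edge_iff[OF xV(1)] by auto
        then have "i = j" using col H.colour_T[OF xV(1) i(1)] H'.colour_T[OF xV(2) j ne] z by auto
        then show False using i True by simp
      qed
      then show ?thesis using True IH by simp
    qed
  qed
  have "fold T w v = v \<longleftrightarrow> f (fold T w v) = f v"
    using f(1) H.ballI[OF w] H.root_in_ball[of v r] unfolding bij_betw_def by (auto dest: inj_onD)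
  then show ?thesis using fw[OF w] f(2) by simp
qed

definition colour_step :: "'v cgraph \<Rightarrow> nat \<Rightarrow> 'v \<Rightarrow> 'v" where
  "colour_step G j v = (if \<exists>w. {v, w} \<in> edges G \<and> colour G {v, w} = j
     then SOME w. {v, w} \<in> edges G \<and> colour G {v, w} = j else v)"

text \<open>Properness leaves at most one neighbour per colour, so the choice in
  \<open>colour_step\<close> is forced; reading the chosen edge from its other end shows that the
  step is an involution.\<close>

lemma involution_graph_colour_step:
  assumes G: "coloured_dgraph d G" shows "involution_graph d G (colour_step G)"
proof
  have ed: "\<exists>v\<in>verts G. \<exists>w\<in>verts G. v \<noteq> w \<and> e = {v, w}" if "e \<in> edges G" for e
    using coloured_dgraphD(1)[OF G that] .
  have ne: "v \<noteq> w" "v \<in> verts G" "w \<in> verts G" if "{v, w} \<in> edges G" for v w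
    using ed[OF that] by (auto simp: doubleton_eq_iff)
  have proper: "w = w'" if "{v, w} \<in> edges G" "{v, w'} \<in> edges G" "colour G {v, w} = colour G {v, w'}" for v w w'
  proof -
    have "{v, w} = {v, w'}" by (rule coloured_dgraphD(5)[OF G]) (use that in auto)
    then show ?thesis by (auto simp: doubleton_eq_iff)
  qed
  have step: "colour_step G j v = w" if "{v, w} \<in> edges G" "colour G {v, w} = j" for v w j
  proof -
    have "\<exists>w. {v, w} \<in> edges G \<and> colour G {v, w} = j" using that by blast
    from someI_ex[OF this] this show ?thesis using proper that unfolding colour_step_def by auto
  qed
  have move: "{v, colour_step G j v} \<in> edges G \<and> colour G {v, colour_step G j v} = j"
    if "colour_step G j v \<noteq> v" for v j
  proof -
    have "\<exists>w. {v, w} \<in> edges G \<and> colour G {v, w} = j"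
    proof (rule ccontr)
      assume "\<nexists>w. {v, w} \<in> edges G \<and> colour G {v, w} = j"
      then have "colour_step G j v = v" unfolding colour_step_def by (rule if_not_P)
      then show False using that by simp
    qed
    then obtain w where "{v, w} \<in> edges G" "colour G {v, w} = j" by (elim exE conjE)
    then show ?thesis using step[of v w j] by simp
  qed
  show "coloured_dgraph d G" by fact
  fix v j assume v: "v \<in> verts G" 
  { assume j: "j \<in> letters d"
    show "colour_step G j v \<in> verts G"
    proof (cases "colour_step G j v = v")
      case False
      from move[OF this] have "{v, colour_step G j v} \<in> edges G" ..
      then show ?thesis by (rule ne(3))
    qed (simp add: v)
    show "colour_step G j (colour_step G j v) = v"
    proof (cases "colour_step G j v = v")
      case False
      then show ?thesis using move[of j v] step[of "colour_step G j v" v j] by (simp add: insert_commute)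
    qed simp
    show "colour_step G j v \<noteq> v \<Longrightarrow> colour G {v, colour_step G j v} = j" using move by blast }
  fix w
  show "{v, w} \<in> edges G \<longleftrightarrow> w \<noteq> v \<and> (\<exists>j\<in>letters d. w = colour_step G j v)"
  proof
    assume e: "{v, w} \<in> edges G"
    then have "colour G {v, w} \<in> letters d" using coloured_dgraphD(4)[OF G] by (simp add: letters_def)
    then show "w \<noteq> v \<and> (\<exists>j\<in>letters d. w = colour_step G j v)" using step[OF e refl] ne(1)[OF e] by metis
  qed (use move in metis)
qed

section \<open>The measure on the orbit relation\<close>

locale graphing_loc =
  fixes d :: nat and \<G> :: "'a::{metric_space, second_countable_topology} graphing"
  assumes graphing: "is_graphing d \<G>"
begin

abbreviation "T \<equiv> invol \<G>"
abbreviation "N \<equiv> ncols d"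
abbreviation "X \<equiv> gmeas \<G>"
abbreviation "R \<equiv> orbit_rel d \<G>"
abbreviation "\<nu> \<equiv> rel_measure d \<G>"
abbreviation "orb \<equiv> orbit_of d \<G>"

sublocale prob_space X
  using graphing by (simp add: is_graphing_def)

lemma sets_X [measurable_cong]: "sets X = sets borel"
  using graphing by (simp add: is_graphing_def)

lemma space_X [simp]: "space X = UNIV"
  using sets_eq_imp_space_eq[OF sets_X] by simp

lemma T_invol: "j \<in> letters d \<Longrightarrow> T j (T j p) = p"
  using graphing by (auto simp: is_graphing_def letters_def)

lemma T_cont: "j \<in> letters d \<Longrightarrow> continuous_on UNIV (T j)"
  using graphing by (auto simp: is_graphing_def letters_def)

lemma T_fixed: "\<exists>j\<in>letters d. T j p = p"
  using graphing unfolding is_graphing_def letters_def by blast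

lemma T_agree: "i \<in> letters d \<Longrightarrow> j \<in> letters d \<Longrightarrow> i \<noteq> j \<Longrightarrow> T i p = T j p \<Longrightarrow> T i p = p"
  using graphing unfolding is_graphing_def letters_def by blast

lemma R_iff: "(x, y) \<in> R \<longleftrightarrow> (\<exists>w\<in>words d. y = fold T w x)"
proof
  assume "(x, y) \<in> R"
  then show "\<exists>w\<in>words d. y = fold T w x" unfolding orbit_rel_def
  proof (induction rule: rtrancl_induct)
    case base
    show ?case by (rule bexI[of _ "[]"]) auto
  next
    case (step y z)
    then obtain w j where "w \<in> words d" "y = fold T w x" "j \<in> letters d" "z = T j y" by (auto simp: letters_def)
    then show ?case by (intro bexI[of _ "w @ [j]"]) auto
  qed
next
  assume "\<exists>w\<in>words d. y = fold T w x"
  then obtain w where w: "w \<in> words d" "y = fold T w x" by blast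
  have "(x, fold T w x) \<in> R" using w(1)
  proof (induction w rule: rev_induct)
    case (snoc j w)
    then have "(x, fold T w x) \<in> R" "(fold T w x, T j (fold T w x)) \<in> {(x, T j x) | x j. j \<in> {1..d + 1}}"
      by (auto simp: letters_def)
    then show ?case unfolding orbit_rel_def by (simp add: rtrancl.rtrancl_into_rtrancl)
  qed (simp add: orbit_rel_def)
  then show "(x, y) \<in> R" using w by simp
qed

lemma orb_iff: "y \<in> orb x \<longleftrightarrow> (\<exists>w\<in>words d. y = fold T w x)"
  by (simp add: orbit_of_def R_iff)

lemma R_orb: "(x, y) \<in> R \<longleftrightarrow> y \<in> orb x"
  by (simp add: orbit_of_def)

lemma root_orb [simp]: "x \<in> orb x"
  by (simp add: orbit_of_def orbit_rel_def)

lemma T_orb: "j \<in> letters d \<Longrightarrow> y \<in> orb x \<Longrightarrow> T j y \<in> orb x"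
proof -
  assume j: "j \<in> letters d" and "y \<in> orb x"
  then obtain w where "w \<in> words d" "y = fold T w x" by (auto simp: orb_iff)
  then show ?thesis unfolding orb_iff using j by (intro bexI[of _ "w @ [j]"]) simp_all
qed

lemma T_orb_iff: "j \<in> letters d \<Longrightarrow> T j y \<in> orb x \<longleftrightarrow> y \<in> orb x"
  using T_orb T_invol by metis

lemma involution_graph_leafgraph: "involution_graph d (leafgraph d \<G> x) T"
proof
  let ?H = "leafgraph d \<G> x"
  have V: "verts ?H = orb x" by (simp add: leafgraph_def)
  have Ed: "e \<in> edges ?H \<longleftrightarrow> (\<exists>y j. e = {y, T j y} \<and> y \<in> orb x \<and> j \<in> letters d \<and> T j y \<noteq> y)" for e
    by (auto simp: leafgraph_def letters_def)
  have edge: "{v, w} \<in> edges ?H \<longleftrightarrow> w \<noteq> v \<and> (\<exists>j\<in>letters d. w = T j v)" if v: "v \<in> orb x" for v w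
  proof
    assume "{v, w} \<in> edges ?H"
    then obtain y j where "{v, w} = {y, T j y}" "j \<in> letters d" "T j y \<noteq> y" unfolding Ed by blast
    then show "w \<noteq> v \<and> (\<exists>j\<in>letters d. w = T j v)" using T_invol by (metis doubleton_eq_iff)
  qed (use v Ed in blast)
  have col: "colour ?H {v, T j v} = j" if j: "j \<in> letters d" and ne: "T j v \<noteq> v" for v j
  proof -
    have "colour ?H {v, T j v} = (THE i. i \<in> {1..d + 1} \<and> (\<exists>y. T i y \<noteq> y \<and> {v, T j v} = {y, T i y}))"
      by (simp add: leafgraph_def)
    also have "\<dots> = j"
    proof (rule the_equality)
      show "j \<in> {1..d + 1} \<and> (\<exists>y. T j y \<noteq> y \<and> {v, T j v} = {y, T j y})" using j ne by (auto simp: letters_def)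
      fix i assume "i \<in> {1..d + 1} \<and> (\<exists>y. T i y \<noteq> y \<and> {v, T j v} = {y, T i y})"
      then obtain y where i: "i \<in> letters d" and y: "T i y \<noteq> y" "{v, T j v} = {y, T i y}" by (auto simp: letters_def)
      then have "T i v = T j v" using T_invol[OF i] by (auto simp: doubleton_eq_iff)
      then show "i = j" using T_agree[OF i j, of v] ne by auto
    qed
    finally show ?thesis .
  qed
  show "coloured_dgraph d ?H"
  proof (rule coloured_dgraphI)
    fix e assume e: "e \<in> edges ?H"
    then obtain y j where y: "e = {y, T j y}" "y \<in> orb x" "j \<in> letters d" "T j y \<noteq> y" unfolding Ed by blast
    then show "\<exists>v\<in>verts ?H. \<exists>w\<in>verts ?H. v \<noteq> w \<and> e = {v, w}"
      using T_orb V by (intro bexI[of _ y] bexI[of _ "T j y"]) auto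
    show "colour ?H e \<in> {1..d + 1}" using col[OF y(3,4)] y by (simp add: letters_def)
  next
    fix v assume v: "v \<in> verts ?H"
    \<comment> \<open>One of the \<open>d + 1\<close> letters fixes \<open>v\<close>, which leaves
      at most \<open>d\<close> letters that can lead to a neighbour.\<close>
    obtain j where j: "j \<in> letters d" "T j v = v" using T_fixed by blast
    have sub: "nbrs ?H v \<subseteq> (\<lambda>i. T i v) ` (letters d - {j})"
      using v j edge V by (auto simp: nbrs_def)
    have "card (nbrs ?H v) \<le> card ((\<lambda>i. T i v) ` (letters d - {j}))" by (rule card_mono[OF _ sub]) simp
    also have "\<dots> \<le> card (letters d - {j})" by (rule card_image_le) simp
    also have "\<dots> = d" using j by (simp add: ncols_def)
    finally show "finite (nbrs ?H v) \<and> card (nbrs ?H v) \<le> d" using finite_subset[OF sub] by simp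
  next
    fix e e' assume ed: "e \<in> edges ?H" "e' \<in> edges ?H" and int: "e \<inter> e' \<noteq> {}" and c: "colour ?H e = colour ?H e'"
    obtain y j where y: "e = {y, T j y}" "y \<in> orb x" "j \<in> letters d" "T j y \<noteq> y" using ed(1) unfolding Ed by blast
    obtain z i where z: "e' = {z, T i z}" "z \<in> orb x" "i \<in> letters d" "T i z \<noteq> z" using ed(2) unfolding Ed by blast
    have ij: "i = j" using c col[OF y(3,4)] col[OF z(3,4)] y(1) z(1) by simp
    obtain u where u: "u \<in> e" "u \<in> e'" using int by auto
    have "e = {u, T j u}" using u(1) y(1) T_invol[OF y(3), of y] by auto
    moreover have "e' = {u, T j u}" using u(2) z(1) T_invol[OF z(3), of z] ij by auto
    ultimately show "e = e'" by simp
  qed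
  show "v \<in> verts ?H \<Longrightarrow> j \<in> letters d \<Longrightarrow> T j v \<in> verts ?H" for v j by (simp add: V T_orb)
  show "j \<in> letters d \<Longrightarrow> T j (T j v) = v" for v j by (rule T_invol)
  show "v \<in> verts ?H \<Longrightarrow> {v, w} \<in> edges ?H \<longleftrightarrow> w \<noteq> v \<and> (\<exists>j\<in>letters d. w = T j v)" for v w
    using edge V by simp
  show "j \<in> letters d \<Longrightarrow> T j v \<noteq> v \<Longrightarrow> colour ?H {v, T j v} = j" for v j by (rule col)
qed

lemma verts_leafgraph [simp]: "verts (leafgraph d \<G> x) = orb x"
  by (simp add: leafgraph_def)

section \<open>Measurable enumeration of the orbits and integration along fibres\<close>

definition W :: "nat \<Rightarrow> 'a \<Rightarrow> 'a" where
  "W n = fold T (from_nat_into (words d) n)"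

lemma words_nonempty: "words d \<noteq> {}"
  using words_simps(1) by blast

lemma countable_words: "countable (words d)"
  unfolding words_def by (intro countable_lists countable_finite) simp

lemma orb_W: "orb x = range (\<lambda>n. W n x)"
proof -
  have "orb x = (\<lambda>w. fold T w x) ` words d" by (auto simp: orb_iff)
  also have "words d = range (from_nat_into (words d))"
    by (rule range_from_nat_into[OF words_nonempty countable_words, symmetric])
  finally show ?thesis by (simp add: image_image W_def)
qed

lemma fold_T_cont: "w \<in> words d \<Longrightarrow> continuous_on UNIV (fold T w)"
proof (induction w rule: rev_induct)
  case (snoc j w)
  then have "continuous_on UNIV (T j \<circ> fold T w)"
    by (intro continuous_on_compose continuous_on_subset[OF T_cont]) auto
  then show ?case by (simp add: o_def)
qed (simp add: id_def[symmetric])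

lemma W_cont: "continuous_on UNIV (W n)"
  unfolding W_def by (rule fold_T_cont) (simp add: words_nonempty from_nat_into)

lemma W_measurable [measurable]: "W n \<in> borel_measurable borel"
  by (rule borel_measurable_continuous_onI[OF W_cont])

text \<open>The points from which the \<open>n\<close>-th word reaches something new. Restricted to
  the sets \<open>D n\<close>, the maps \<open>W n\<close> enumerate each orbit exactly once: a
  countable system of measurable sections of the relation.\<close>

definition D :: "nat \<Rightarrow> 'a set" where
  "D n = {x. \<forall>m<n. W m x \<noteq> W n x}"

lemma D_borel [measurable]: "D n \<in> sets borel"
proof -
  have "closed {x. W m x = W n x}" for m by (rule closed_Collect_eq) (auto intro: W_cont)
  then have "- (\<Union>m<n. {x. W m x = W n x}) \<in> sets borel" by (intro borel_comp sets.finite_UN) auto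
  moreover have "D n = - (\<Union>m<n. {x. W m x = W n x})" by (auto simp: D_def)
  ultimately show ?thesis by simp
qed

lemma bij_W: "bij_betw (\<lambda>n. W n x) {n. x \<in> D n} (orb x)"
  unfolding bij_betw_def
proof
  show "inj_on (\<lambda>n. W n x) {n. x \<in> D n}"
  proof (rule inj_onI)
    fix m n assume "m \<in> {n. x \<in> D n}" "n \<in> {n. x \<in> D n}" "W m x = W n x"
    then show "m = n" by (cases m n rule: linorder_cases) (auto simp: D_def)
  qed
  show "(\<lambda>n. W n x) ` {n. x \<in> D n} = orb x"
  proof (intro set_eqI iffI)
    fix y assume "y \<in> orb x"
    then have ex: "\<exists>n. y = W n x" by (auto simp: orb_W)
    define n where "n = (LEAST n. y = W n x)"
    have "y = W n x" unfolding n_def by (rule LeastI_ex[OF ex])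
    moreover have "x \<in> D n" unfolding D_def
    proof (intro CollectI allI impI)
      fix m assume "m < n"
      then have "y \<noteq> W m x" unfolding n_def by (rule not_less_Least)
      then show "W m x \<noteq> W n x" using calculation by simp
    qed
    ultimately show "y \<in> (\<lambda>n. W n x) ` {n. x \<in> D n}" by blast
  qed (auto simp: orb_W)
qed

text \<open>Replaces a sum over an orbit, which varies with \<open>x\<close>, by a series over a
  fixed index set with terms measurable in \<open>x\<close>. Measurability of fibre integrals is
  read off from this form.\<close>

lemma nn_integral_orb:
  "(\<integral>\<^sup>+y. u y \<partial>count_space (orb x)) = (\<Sum>n. indicator (D n) x * u (W n x))"
proof -
  have "(\<integral>\<^sup>+y. u y \<partial>count_space (orb x)) = (\<integral>\<^sup>+n. u (W n x) \<partial>count_space {n. x \<in> D n})"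
    by (rule nn_integral_bij_count_space[OF bij_W, symmetric])
  also have "\<dots> = (\<integral>\<^sup>+n. u (W n x) * indicator {n. x \<in> D n} n \<partial>count_space UNIV)"
    by (rule nn_integral_count_space_indicator) simp
  also have "\<dots> = (\<Sum>n. u (W n x) * indicator {n. x \<in> D n} n)" by (rule nn_integral_count_space_nat)
  also have "\<dots> = (\<Sum>n. indicator (D n) x * u (W n x))"
    by (rule suminf_cong) (auto simp: indicator_def)
  finally show ?thesis .
qed

abbreviation "BR \<equiv> restrict_space (borel :: ('a \<times> 'a) measure) R"

lemma sets_\<nu> [measurable_cong]: "sets \<nu> = sets BR"
  using sets.sigma_sets_eq[of BR] sets.space_closed[of BR]
  by (simp add: rel_measure_def space_restrict_space)

lemma space_\<nu> [simp]: "space \<nu> = R"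
  using sets_eq_imp_space_eq[OF sets_\<nu>] by (simp add: space_restrict_space)

lemma pair_W_measurable [measurable]: "(\<lambda>x. (x, W n x)) \<in> measurable borel BR"
  by (rule measurable_restrict_space2) (auto simp: R_orb orb_W borel_prod[symmetric])

lemma sets_BR_sub: "B \<in> sets BR \<Longrightarrow> B \<subseteq> R"
  using sets.sets_into_space[of B BR] by (simp add: space_restrict_space)

lemma emeasure_section:
  assumes B: "B \<in> sets BR"
  shows "emeasure (count_space UNIV) {y. (x, y) \<in> B} = (\<Sum>n. indicator (D n) x * indicator B (x, W n x))"
proof -
  have sub: "{y. (x, y) \<in> B} \<subseteq> orb x" using sets_BR_sub[OF B] by (auto simp: orbit_of_def)
  have "emeasure (count_space UNIV) {y. (x, y) \<in> B} = emeasure (count_space (orb x)) {y. (x, y) \<in> B}"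
    using sub by (simp add: emeasure_count_space)
  also have "\<dots> = (\<integral>\<^sup>+y. indicator {y. (x, y) \<in> B} y \<partial>count_space (orb x))"
    using sub by (subst nn_integral_indicator) auto
  also have "\<dots> = (\<Sum>n. indicator (D n) x * indicator B (x, W n x))"
    unfolding nn_integral_orb by (simp add: indicator_def)
  finally show ?thesis .
qed

lemma section_measurable:
  assumes [measurable]: "B \<in> sets BR"
  shows "(\<lambda>x. emeasure (count_space UNIV) {y. (x, y) \<in> B}) \<in> borel_measurable borel"
  unfolding emeasure_section[OF assms] by measurable

lemma emeasure_\<nu>:
  assumes B: "B \<in> sets \<nu>"
  shows "emeasure \<nu> B = (\<integral>\<^sup>+x. emeasure (count_space UNIV) {y. (x, y) \<in> B} \<partial>X)"
  unfolding rel_measure_def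
proof (rule emeasure_measure_of_sigma)
  show "sigma_algebra R (sets BR)"
    using sets.sigma_algebra_axioms[of BR] by (simp add: space_restrict_space)
  show "positive (sets BR) (\<lambda>B. \<integral>\<^sup>+x. emeasure (count_space UNIV) {y. (x, y) \<in> B} \<partial>X)"
    by (simp add: positive_def)
  show "countably_additive (sets BR) (\<lambda>B. \<integral>\<^sup>+x. emeasure (count_space UNIV) {y. (x, y) \<in> B} \<partial>X)"
  proof (rule countably_additiveI)
    fix C :: "nat \<Rightarrow> ('a \<times> 'a) set"
    assume C: "range C \<subseteq> sets BR" "disjoint_family C"
    have [measurable]: "C i \<in> sets BR" for i using C by auto
    have "(\<Sum>i. \<integral>\<^sup>+x. emeasure (count_space UNIV) {y. (x, y) \<in> C i} \<partial>X) =
        (\<integral>\<^sup>+x. (\<Sum>i. emeasure (count_space UNIV) {y. (x, y) \<in> C i}) \<partial>X)"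
      using section_measurable by (intro nn_integral_suminf[symmetric]) (simp add: measurable_cong_sets[OF sets_X refl])
    also have "\<dots> = (\<integral>\<^sup>+x. emeasure (count_space UNIV) {y. (x, y) \<in> (\<Union>i. C i)} \<partial>X)"
    proof (rule nn_integral_cong)
      fix x
      have "(\<Sum>i. emeasure (count_space UNIV) {y. (x, y) \<in> C i}) =
          emeasure (count_space UNIV) (\<Union>i. {y. (x, y) \<in> C i})"
        by (rule suminf_emeasure) (use C in \<open>auto simp: disjoint_family_on_def\<close>)
      also have "(\<Union>i. {y. (x, y) \<in> C i}) = {y. (x, y) \<in> (\<Union>i. C i)}" by auto
      finally show "(\<Sum>i. emeasure (count_space UNIV) {y. (x, y) \<in> C i}) =
          emeasure (count_space UNIV) {y. (x, y) \<in> (\<Union>i. C i)}" .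
    qed
    finally show "(\<Sum>i. \<integral>\<^sup>+x. emeasure (count_space UNIV) {y. (x, y) \<in> C i} \<partial>X) =
        (\<integral>\<^sup>+x. emeasure (count_space UNIV) {y. (x, y) \<in> (\<Union>i. C i)} \<partial>X)" .
  qed
  show "B \<in> sets BR" using B by (simp add: sets_\<nu>)
qed

lemma fibre_integral_measurable:
  assumes u: "u \<in> borel_measurable \<nu>"
  shows "(\<lambda>x. \<integral>\<^sup>+y. u (x, y) \<partial>count_space (orb x)) \<in> borel_measurable X"
proof -
  have [measurable]: "u \<in> borel_measurable BR" using u by (simp add: measurable_cong_sets[OF sets_\<nu> refl])
  have "(\<lambda>x. \<Sum>n. indicator (D n) x * u (x, W n x)) \<in> borel_measurable borel" by measurable
  then show ?thesis by (simp add: nn_integral_orb measurable_cong_sets[OF sets_X refl])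
qed

lemma nn_integral_\<nu>:
  assumes u: "u \<in> borel_measurable \<nu>"
  shows "(\<integral>\<^sup>+p. u p \<partial>\<nu>) = (\<integral>\<^sup>+x. \<integral>\<^sup>+y. u (x, y) \<partial>count_space (orb x) \<partial>X)"
  using u
proof (induction rule: borel_measurable_induct)
  case (cong f g)
  have "(\<integral>\<^sup>+p. f p \<partial>\<nu>) = (\<integral>\<^sup>+p. g p \<partial>\<nu>)" by (rule nn_integral_cong) (use cong in auto)
  moreover have "(\<integral>\<^sup>+x. \<integral>\<^sup>+y. f (x, y) \<partial>count_space (orb x) \<partial>X) = (\<integral>\<^sup>+x. \<integral>\<^sup>+y. g (x, y) \<partial>count_space (orb x) \<partial>X)"
    by (intro nn_integral_cong cong) (auto simp: R_orb)
  ultimately show ?case using cong by simp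
next
  case (set B)
  have "(\<integral>\<^sup>+y. indicator B (x, y) \<partial>count_space (orb x)) = emeasure (count_space UNIV) {y. (x, y) \<in> B}" for x
    using set by (simp add: nn_integral_orb emeasure_section sets_\<nu>)
  then show ?case using set by (simp add: emeasure_\<nu>)
next
  case (mult u c)
  then show ?case
    by (simp add: nn_integral_cmult fibre_integral_measurable)
next
  case (add u v)
  then show ?case
    by (simp add: nn_integral_add fibre_integral_measurable)
next
  case (seq U)
  have "(\<integral>\<^sup>+p. (SUP i. U i) p \<partial>\<nu>) = (SUP i. \<integral>\<^sup>+p. U i p \<partial>\<nu>)"
    unfolding SUP_apply by (rule nn_integral_monotone_convergence_SUP) (use seq in auto)
  also have "\<dots> = (SUP i. \<integral>\<^sup>+x. \<integral>\<^sup>+y. U i (x, y) \<partial>count_space (orb x) \<partial>X)"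
    using seq by simp
  also have "\<dots> = (\<integral>\<^sup>+x. (SUP i. \<integral>\<^sup>+y. U i (x, y) \<partial>count_space (orb x)) \<partial>X)"
    by (rule nn_integral_monotone_convergence_SUP[symmetric])
       (use seq in \<open>auto simp: incseq_def le_fun_def intro!: fibre_integral_measurable nn_integral_mono\<close>)
  also have "\<dots> = (\<integral>\<^sup>+x. \<integral>\<^sup>+y. (SUP i. U i (x, y)) \<partial>count_space (orb x) \<partial>X)"
    by (intro nn_integral_cong nn_integral_monotone_convergence_SUP[symmetric])
       (use seq in \<open>auto simp: incseq_def le_fun_def\<close>)
  finally show ?case by (simp only: SUP_apply)
qed

text \<open>Only the empty set is null for counting measure, so a \<open>\<nu>\<close>-null set
  misses the whole orbit of almost every \<open>x\<close>.\<close>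

lemma AE_\<nu>:
  assumes "AE p in \<nu>. P p" shows "AE x in X. \<forall>y\<in>orb x. P (x, y)"
proof -
  obtain B where B: "{p \<in> space \<nu>. \<not> P p} \<subseteq> B" "emeasure \<nu> B = 0" "B \<in> sets \<nu>"
    by (rule AE_E[OF assms])
  have "(\<lambda>x. emeasure (count_space UNIV) {y. (x, y) \<in> B}) \<in> borel_measurable X"
    using section_measurable B(3) by (simp add: sets_\<nu> measurable_cong_sets[OF sets_X refl])
  then have "AE x in X. emeasure (count_space UNIV) {y. (x, y) \<in> B} = 0"
    using B by (simp add: emeasure_\<nu> nn_integral_0_iff_AE)
  then show ?thesis
  proof eventually_elim
    case (elim x)
    then have "{y. (x, y) \<in> B} = {}" by (simp add: emeasure_count_space_eq_0)
    show ?case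
    proof
      fix y assume "y \<in> orb x"
      then have "(x, y) \<in> space \<nu>" by (simp add: R_orb)
      then show "P (x, y)" using B(1) \<open>{y. (x, y) \<in> B} = {}\<close> by blast
    qed
  qed
qed

section \<open>The involutions acting on the second coordinate\<close>

definition R2 :: "nat \<Rightarrow> 'a \<times> 'a \<Rightarrow> 'a \<times> 'a" where
  "R2 j p = (fst p, T j (snd p))"

lemma R2_pair [simp]: "R2 j (x, y) = (x, T j y)"
  by (simp add: R2_def)

lemma R2_R: "j \<in> letters d \<Longrightarrow> R2 j p \<in> R \<longleftrightarrow> p \<in> R"
  by (cases p) (simp add: R_orb T_orb_iff)

lemma R2_measurable: 
  assumes j: "j \<in> letters d" shows "R2 j \<in> measurable \<nu> \<nu>"
proof -
  have "continuous_on UNIV (R2 j)" unfolding R2_def[abs_def]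
    by (intro continuous_intros continuous_on_compose2[OF T_cont[OF j]]) auto
  then have "R2 j \<in> borel_measurable borel" by (rule borel_measurable_continuous_onI)
  then have "R2 j \<in> measurable BR BR"
    by (rule measurable_restrict_space3) (use R2_R[OF j] in auto)
  then show ?thesis by (simp add: measurable_cong_sets[OF sets_\<nu> sets_\<nu>])
qed

lemma bij_T: "j \<in> letters d \<Longrightarrow> bij (T j)"
  by (rule involuntory_imp_bij) (rule T_invol)

text \<open>\<open>R2 j\<close> stays in each fibre and permutes it, and a bijection preserves
  counting measure.\<close>

lemma R2_preserves: 
  assumes j: "j \<in> letters d" shows "distr \<nu> \<nu> (R2 j) = \<nu>"
proof (rule measure_eqI)
  fix B assume "B \<in> sets (distr \<nu> \<nu> (R2 j))"
  then have B: "B \<in> sets \<nu>" by simp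
  have BR: "B \<subseteq> R" using B sets_BR_sub by (simp add: sets_\<nu>)
  have *: "R2 j -` B \<inter> space \<nu> \<in> sets \<nu>" by (rule measurable_sets[OF R2_measurable[OF j] B])
  have "emeasure (distr \<nu> \<nu> (R2 j)) B = emeasure \<nu> (R2 j -` B \<inter> space \<nu>)"
    by (rule emeasure_distr[OF R2_measurable[OF j] B])
  also have "\<dots> = (\<integral>\<^sup>+x. emeasure (count_space UNIV) {y. (x, y) \<in> R2 j -` B \<inter> space \<nu>} \<partial>X)"
    by (rule emeasure_\<nu>[OF *])
  also have "\<dots> = (\<integral>\<^sup>+x. emeasure (count_space UNIV) {y. (x, y) \<in> B} \<partial>X)"
  proof (rule nn_integral_cong)
    fix x
    have "{y. (x, y) \<in> R2 j -` B \<inter> space \<nu>} = T j -` {y. (x, y) \<in> B}"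
    proof (intro set_eqI)
      fix y
      have "(x, T j y) \<in> B \<Longrightarrow> (x, y) \<in> R" using BR R2_R[OF j, of "(x, y)"] by auto
      then show "y \<in> {y. (x, y) \<in> R2 j -` B \<inter> space \<nu>} \<longleftrightarrow> y \<in> T j -` {y. (x, y) \<in> B}" by auto
    qed
    moreover have "emeasure (count_space UNIV) (T j -` {y. (x, y) \<in> B}) = emeasure (distr (count_space UNIV) (count_space UNIV) (T j)) {y. (x, y) \<in> B}"
      by (simp add: emeasure_distr)
    ultimately show "emeasure (count_space UNIV) {y. (x, y) \<in> R2 j -` B \<inter> space \<nu>} = emeasure (count_space UNIV) {y. (x, y) \<in> B}"
      by (simp add: distr_bij_count_space bij_T[OF j])
  qed
  finally show "emeasure (distr \<nu> \<nu> (R2 j)) B = emeasure \<nu> B" by (simp add: emeasure_\<nu>[OF B])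
qed simp

sublocale rel: walk_system \<nu> N R2
proof
  fix j assume "j \<in> {1..N}"
  then have j: "j \<in> letters d" by (simp only: letters_ncols)
  show "R2 j \<in> measurable \<nu> \<nu>" "distr \<nu> \<nu> (R2 j) = \<nu>" by (rule R2_measurable[OF j], rule R2_preserves[OF j])
  show "R2 j (R2 j p) = p" for p by (simp add: R2_def T_invol[OF j])
qed (simp add: ncols_def)

lemma fibre_walk_system: "walk_system (count_space (orb x)) N T"
proof
  fix j assume "j \<in> {1..N}"
  then have j: "j \<in> letters d" by (simp only: letters_ncols)
  show "T j \<in> measurable (count_space (orb x)) (count_space (orb x))" using T_orb[OF j] by simp
  show "T j (T j p) = p" for p by (rule T_invol[OF j])
  have "bij_betw (T j) (orb x) (orb x)"
    by (rule bij_betw_byWitness[of _ "T j"]) (auto simp: T_invol[OF j] T_orb[OF j])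
  then show "distr (count_space (orb x)) (count_space (orb x)) (T j) = count_space (orb x)"
    by (rule distr_bij_count_space)
qed (simp add: ncols_def)

lemma walk_R2: "walk n R2 f (x, y) = walk n T (\<lambda>z. f (x, z)) y"
  by (simp add: walk_def)

lemma walk_pow_R2: "(walk n R2 ^^ k) f (x, y) = (walk n T ^^ k) (\<lambda>z. f (x, z)) y"
  by (induction k arbitrary: y) (simp_all add: walk_def)

lemma poly_op_R2: "poly_op n R2 q f (x, y) = poly_op n T q (\<lambda>z. f (x, z)) y"
  by (simp add: poly_op_def walk_pow_R2)

lemma laplacian_R2: 
  assumes "p \<in> R" shows "graphing_laplacian d \<G> f p = of_nat N * f p - walk N R2 f p"
proof -
  obtain x y where p: "p = (x, y)" by (cases p)
  interpret involution_graph d "leafgraph d \<G> x" T by (rule involution_graph_leafgraph)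
  have "graph_laplacian (leafgraph d \<G> x) (\<lambda>z. f (x, z)) y = of_nat N * f (x, y) - walk N T (\<lambda>z. f (x, z)) y"
    by (rule laplacian_eq_walk) (use assms in \<open>simp add: p R_orb\<close>)
  then show ?thesis by (simp add: p graphing_laplacian_def walk_R2)
qed

lemma L2_fibre:
  assumes f: "f \<in> L2 \<nu>" shows "AE x in X. (\<lambda>y. f (x, y)) \<in> L2 (count_space (orb x))"
proof -
  have [measurable]: "f \<in> borel_measurable \<nu>" by (rule L2D(1)[OF f])
  have "(\<integral>\<^sup>+p. ennreal ((cmod (f p))\<^sup>2) \<partial>\<nu>) < \<infinity>"
    using L2D(2)[OF f] by (simp add: integrable_iff_bounded)
  then have "(\<integral>\<^sup>+x. \<integral>\<^sup>+y. ennreal ((cmod (f (x, y)))\<^sup>2) \<partial>count_space (orb x) \<partial>X) \<noteq> \<infinity>"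
    by (subst (asm) nn_integral_\<nu>) auto
  then have "AE x in X. (\<integral>\<^sup>+y. ennreal ((cmod (f (x, y)))\<^sup>2) \<partial>count_space (orb x)) \<noteq> \<infinity>"
    by (intro nn_integral_PInf_AE fibre_integral_measurable[of "\<lambda>p. ennreal ((cmod (f p))\<^sup>2)"]) auto
  then show ?thesis
    by eventually_elim (auto simp: L2_def integrable_iff_bounded less_top)
qed

text \<open>The kernel of the identity operator, used as a unit vector: the coefficient of a
  polynomial in \<open>A\<close> at this vector is the trace of that polynomial. Its scalar spectral
  measure is the candidate for the KNS measure.\<close>

definition diag_ind :: "'a \<times> 'a \<Rightarrow> complex" where
  "diag_ind p = (if fst p = snd p then 1 else 0)"

lemma Diag_sets [measurable]: "{p \<in> R. fst p = snd p} \<in> sets \<nu>"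
proof -
  have "closed {p :: 'a \<times> 'a. fst p = snd p}" by (intro closed_Collect_eq continuous_intros)
  then have "{p :: 'a \<times> 'a. fst p = snd p} \<inter> R \<in> sets BR"
    by (auto simp: sets_restrict_space)
  moreover have "{p \<in> R. fst p = snd p} = {p. fst p = snd p} \<inter> R" by auto
  ultimately show ?thesis by (simp add: sets_\<nu>)
qed

lemma diag_ind_measurable [measurable]: "diag_ind \<in> borel_measurable \<nu>"
proof -
  have "(\<lambda>p. indicator {p \<in> R. fst p = snd p} p) \<in> borel_measurable \<nu>" by measurable
  then show ?thesis
    by (subst measurable_cong[of _ _ "indicator {p \<in> R. fst p = snd p}"]) (auto simp: diag_ind_def indicator_def)
qed

lemma diag_measurable [measurable]: "(\<lambda>x. (x, x)) \<in> measurable X \<nu>"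
proof -
  have "(\<lambda>x. (x, x)) \<in> measurable borel BR"
    by (rule measurable_restrict_space2) (auto simp: R_orb borel_prod[symmetric])
  then show ?thesis by (simp add: measurable_cong_sets[OF sets_X sets_\<nu>])
qed

lemma distr_diag: "distr X \<nu> (\<lambda>x. (x, x)) = density \<nu> (indicator {p \<in> R. fst p = snd p})"
proof (rule measure_eqI)
  fix B assume "B \<in> sets (distr X \<nu> (\<lambda>x. (x, x)))"
  then have B [measurable]: "B \<in> sets \<nu>" by simp
  have sub: "B \<subseteq> R" using B sets_BR_sub by (simp add: sets_\<nu>)
  let ?Dg = "{p \<in> R. fst p = snd p}"
  have "emeasure (density \<nu> (indicator ?Dg)) B = emeasure \<nu> (?Dg \<inter> B)"
    by (subst emeasure_density) (auto simp: indicator_inter_arith[symmetric])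
  also have "\<dots> = (\<integral>\<^sup>+x. emeasure (count_space UNIV) {y. (x, y) \<in> ?Dg \<inter> B} \<partial>X)"
    by (rule emeasure_\<nu>) auto
  also have "\<dots> = (\<integral>\<^sup>+x. indicator ((\<lambda>x. (x, x)) -` B \<inter> space X) x \<partial>X)"
  proof (rule nn_integral_cong)
    fix x
    have "{y. (x, y) \<in> ?Dg \<inter> B} = (if (x, x) \<in> B then {x} else {})" using sub by auto
    then show "emeasure (count_space UNIV) {y. (x, y) \<in> ?Dg \<inter> B} = indicator ((\<lambda>x. (x, x)) -` B \<inter> space X) x"
      by (simp add: indicator_def)
  qed
  also have "\<dots> = emeasure X ((\<lambda>x. (x, x)) -` B \<inter> space X)"
    by (rule nn_integral_indicator) (rule measurable_sets[OF diag_measurable B])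
  also have "\<dots> = emeasure (distr X \<nu> (\<lambda>x. (x, x))) B" by (rule emeasure_distr[symmetric]) auto
  finally show "emeasure (distr X \<nu> (\<lambda>x. (x, x))) B = emeasure (density \<nu> (indicator ?Dg)) B" by simp
qed simp

lemma l2_inner_diag_ind:
  assumes [measurable]: "f \<in> borel_measurable \<nu>"
  shows "l2_inner \<nu> f diag_ind = (LINT x|X. f (x, x))"
proof -
  let ?Dg = "{p \<in> R. fst p = snd p}"
  have "(LINT x|X. f (x, x)) = (LINT p|distr X \<nu> (\<lambda>x. (x, x)). f p)"
    by (rule integral_distr[symmetric]) auto
  also have "\<dots> = (LINT p|density \<nu> (\<lambda>p. ennreal (indicator ?Dg p)). f p)"
    unfolding distr_diag by (simp add: ennreal_indicator)
  also have "\<dots> = (LINT p|\<nu>. indicator ?Dg p *\<^sub>R f p)"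
    by (rule integral_density) auto
  also have "\<dots> = l2_inner \<nu> f diag_ind" unfolding l2_inner_def
    by (rule Bochner_Integration.integral_cong) (auto simp: diag_ind_def)
  finally show ?thesis ..
qed

lemma diag_ind_L2: "diag_ind \<in> L2 \<nu>"
proof -
  let ?Dg = "{p \<in> R. fst p = snd p}"
  have "emeasure \<nu> ?Dg = emeasure (density \<nu> (indicator ?Dg)) ?Dg"
    by (subst emeasure_density) (auto simp: indicator_inter_arith[symmetric])
  also have "\<dots> < \<infinity>" unfolding distr_diag[symmetric] by (subst emeasure_distr) (auto simp: less_top[symmetric])
  finally have "integrable \<nu> (indicator ?Dg :: _ \<Rightarrow> real)" by (intro integrable_real_indicator) auto
  moreover have "integrable \<nu> (\<lambda>p. (cmod (diag_ind p))\<^sup>2) \<longleftrightarrow> integrable \<nu> (indicator ?Dg :: _ \<Rightarrow> real)"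
    by (rule Bochner_Integration.integrable_cong) (auto simp: diag_ind_def)
  ultimately show ?thesis by (simp add: L2_def)
qed

lemma l2_norm_diag_ind: "l2_norm \<nu> diag_ind = 1"
proof -
  have "complex_of_real ((l2_norm \<nu> diag_ind)\<^sup>2) = 1"
    unfolding l2_inner_self[symmetric] by (simp add: l2_inner_diag_ind) (simp add: diag_ind_def prob_space[unfolded space_X])
  then have "(l2_norm \<nu> diag_ind)\<^sup>2 = 1" using of_real_eq_1_iff by blast
  then show ?thesis using l2_norm_nonneg[of \<nu> diag_ind] by (simp add: power2_eq_1_iff)
qed

end

section \<open>The Feldman--Moore algebra and its trace\<close>

lemma has_sum_finite_sum:
  fixes f :: "'i \<Rightarrow> 'b \<Rightarrow> complex"
  assumes "\<And>i. i \<in> I \<Longrightarrow> (f i has_sum s i) A"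
  shows "((\<lambda>z. \<Sum>i\<in>I. f i z) has_sum (\<Sum>i\<in>I. s i)) A"
  using assms by (induction I rule: infinite_finite_induct) (auto intro: has_sum_add)

lemma bounded_op_lincomb:
  assumes S: "bounded_op M S" and T: "bounded_op M T"
  shows "bounded_op M (\<lambda>f p. a * S f p + b * T f p)"
proof -
  obtain C where C: "\<And>f. f \<in> L2 M \<Longrightarrow> l2_norm M (S f) \<le> C * l2_norm M f"
    using S unfolding bounded_op_def bounded_op_by_def by blast
  obtain C' where C': "\<And>f. f \<in> L2 M \<Longrightarrow> l2_norm M (T f) \<le> C' * l2_norm M f"
    using T unfolding bounded_op_def bounded_op_by_def by blast
  note L = bounded_opD(1)[OF S] bounded_opD(1)[OF T] L2_add L2_scale
  show ?thesis unfolding bounded_op_def bounded_op_by_def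
  proof (intro exI[of _ "cmod a * C + cmod b * C'"] conjI ballI allI)
    fix f assume f: "f \<in> L2 M"
    show "(\<lambda>p. a * S f p + b * T f p) \<in> L2 M" by (intro L f)
    have "l2_norm M (\<lambda>p. a * S f p + b * T f p) \<le> l2_norm M (\<lambda>p. a * S f p) + l2_norm M (\<lambda>p. b * T f p)"
      by (intro l2_norm_triangle L f)
    also have "\<dots> \<le> cmod a * (C * l2_norm M f) + cmod b * (C' * l2_norm M f)"
      unfolding l2_norm_scale by (intro add_mono mult_left_mono C C' f) auto
    finally show "l2_norm M (\<lambda>p. a * S f p + b * T f p) \<le> (cmod a * C + cmod b * C') * l2_norm M f"
      by (simp add: algebra_simps)
    fix g c e assume g: "g \<in> L2 M"
    from bounded_opD(2)[OF S f g, of c e] bounded_opD(2)[OF T f g, of c e]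
    show "AE p in M. a * S (\<lambda>q. c * f q + e * g q) p + b * T (\<lambda>q. c * f q + e * g q) p =
        c * (a * S f p + b * T f p) + e * (a * S g p + b * T g p)"
      by eventually_elim (simp add: algebra_simps)
  qed
qed

text \<open>Kernel operators and polynomials of the walk operator are compared on the relation only;
  boundedness has to pass between operators that may differ off the space.\<close>

lemma bounded_op_cong_space:
  assumes S: "bounded_op M S" and eq: "\<And>f p. p \<in> space M \<Longrightarrow> T f p = S f p"
  shows "bounded_op M T"
proof -
  have n: "l2_norm M (T f) = l2_norm M (S f)" for f
    unfolding l2_norm_def by (simp add: eq cong: Bochner_Integration.integral_cong)
  have "T f \<in> L2 M \<longleftrightarrow> S f \<in> L2 M" for f by (rule L2_cong_space) (rule eq)
  moreover have "(AE p in M. T (\<lambda>q. a * f q + b * g q) p = a * T f p + b * T g p) \<longleftrightarrow>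
      (AE p in M. S (\<lambda>q. a * f q + b * g q) p = a * S f p + b * S g p)" for f g a b
    by (rule AE_cong) (simp add: eq)
  ultimately show ?thesis using S unfolding bounded_op_def bounded_op_by_def n by simp
qed

lemma nn_integral_sq: "f \<in> L2 M \<Longrightarrow> (\<integral>\<^sup>+p. ennreal ((cmod (f p))\<^sup>2) \<partial>M) = ennreal ((l2_norm M f)\<^sup>2)"
  unfolding l2_norm_sq by (rule nn_integral_eq_integral) (auto dest: L2D)

text \<open>By Fatou's lemma the norm is lower semicontinuous under pointwise limits. This bounds
  the fibre operators, which are constructed as pointwise limits.\<close>

lemma L2_liminf:
  assumes f: "\<And>n. f n \<in> L2 M" and b: "\<And>n. l2_norm M (f n) \<le> K"
    and lim: "\<And>p. p \<in> space M \<Longrightarrow> (\<lambda>n. f n p) \<longlonglongrightarrow> h p"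
  shows "h \<in> L2 M" "l2_norm M h \<le> K"
proof -
  have [measurable]: "f n \<in> borel_measurable M" for n by (rule L2D(1)[OF f])
  have K: "0 \<le> K" using b[of 0] l2_norm_nonneg[of M "f 0"] by linarith
  have h [measurable]: "h \<in> borel_measurable M" by (rule borel_measurable_LIMSEQ_metric[OF _ lim]) simp
  have "(\<integral>\<^sup>+p. ennreal ((cmod (h p))\<^sup>2) \<partial>M) = (\<integral>\<^sup>+p. liminf (\<lambda>n. ennreal ((cmod (f n p))\<^sup>2)) \<partial>M)"
  proof (rule nn_integral_cong)
    fix p assume "p \<in> space M"
    then have "(\<lambda>n. ennreal ((cmod (f n p))\<^sup>2)) \<longlonglongrightarrow> ennreal ((cmod (h p))\<^sup>2)"
      by (intro tendsto_ennrealI tendsto_power tendsto_norm lim)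
    from lim_imp_Liminf[OF trivial_limit_sequentially this]
    show "ennreal ((cmod (h p))\<^sup>2) = liminf (\<lambda>n. ennreal ((cmod (f n p))\<^sup>2))" by (rule sym)
  qed
  also have "\<dots> \<le> liminf (\<lambda>n. \<integral>\<^sup>+p. ennreal ((cmod (f n p))\<^sup>2) \<partial>M)"
    by (rule nn_integral_liminf) simp
  also have "\<dots> \<le> ennreal (K\<^sup>2)"
    unfolding nn_integral_sq[OF f]
    by (rule Liminf_le) (auto intro!: always_eventually ennreal_leI power_mono b)
  finally have le: "(\<integral>\<^sup>+p. ennreal ((cmod (h p))\<^sup>2) \<partial>M) \<le> ennreal (K\<^sup>2)" .
  then have "(\<integral>\<^sup>+p. ennreal ((cmod (h p))\<^sup>2) \<partial>M) < \<infinity>" by (simp add: le_less_trans)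
  then show hL: "h \<in> L2 M" by (simp add: L2_def integrable_iff_bounded)
  from le have "(l2_norm M h)\<^sup>2 \<le> K\<^sup>2" by (simp add: nn_integral_sq[OF hL])
  then show "l2_norm M h \<le> K" using K by (rule power2_le_imp_le)
qed

lemma count_space_point:
  assumes "y \<in> A"
  shows "(\<lambda>z. if z = y then 1 else 0) \<in> L2 (count_space A)"
    and "l2_inner (count_space A) h (\<lambda>z. if z = y then 1 else 0) = h y"
proof -
  have "integrable (count_space A) (indicator {y} :: _ \<Rightarrow> real)"
    by (rule integrable_real_indicator) (use assms in \<open>auto simp: emeasure_count_space\<close>)
  moreover have "(\<lambda>z. (cmod (if z = y then 1 else 0 :: complex))\<^sup>2) = indicator {y}"
    by (auto simp: fun_eq_iff)
  ultimately have "integrable (count_space A) (\<lambda>z. (cmod (if z = y then 1 else 0 :: complex))\<^sup>2)" by simp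
  then show "(\<lambda>z. if z = y then 1 else 0) \<in> L2 (count_space A)" by (simp add: L2_def)
  have f: "finite {a \<in> A. h a * cnj (if a = y then 1 else 0) \<noteq> 0}"
    by (rule finite_subset[of _ "{y}"]) auto
  have "l2_inner (count_space A) h (\<lambda>z. if z = y then 1 else 0) =
      (\<Sum>a | a \<in> A \<and> h a * cnj (if a = y then 1 else 0) \<noteq> 0. h a * cnj (if a = y then 1 else 0))"
    unfolding l2_inner_def by (rule lebesgue_integral_count_space_finite_support[OF f])
  also have "\<dots> = (\<Sum>a\<in>{y}. h a * cnj (if a = y then 1 else 0))"
    by (rule sum.mono_neutral_cong_left) (use assms in \<open>auto split: if_splits\<close>)
  finally show "l2_inner (count_space A) h (\<lambda>z. if z = y then 1 else 0) = h y" by simp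
qed

text \<open>Under counting measure, evaluation at \<open>y\<close> is the coefficient against a
  point mass, so the weak convergence of decreasing polynomials is convergence at each point, with
  no exceptional set.\<close>

lemma poly_op_pointwise_convergent:
  assumes ws: "walk_system (count_space A) N \<rho>" and g: "g \<in> L2 (count_space A)" and y: "y \<in> A"
    and nonneg: "\<And>n s. \<bar>s\<bar> \<le> real N \<Longrightarrow> 0 \<le> poly (p n) s"
    and decr: "\<And>n s. \<bar>s\<bar> \<le> real N \<Longrightarrow> poly (p (Suc n)) s \<le> poly (p n) s"
  shows "convergent (\<lambda>n. poly_op N \<rho> (p n) g y)"
proof -
  interpret walk_system "count_space A" N \<rho> by (rule ws)
  have "convergent (\<lambda>n. l2_inner (count_space A) (pA (p n) g) (\<lambda>z. if z = y then 1 else 0))"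
    by (rule poly_op_decreasing_convergent[of g _ p, OF g count_space_point(1)[OF y]]) (rule nonneg decr, assumption)+
  then show ?thesis by (simp add: count_space_point(2)[OF y])
qed

context graphing_loc
begin

abbreviation "pR \<equiv> poly_op N R2"

text \<open>The kernel of \<open>q(A)\<close>, produced by letting \<open>q(A)\<close> act in the
  second variable on the kernel of the identity.\<close>

definition poly_kernel :: "real poly \<Rightarrow> 'a \<times> 'a \<Rightarrow> complex" where
  "poly_kernel q = pR q diag_ind"

abbreviation "K q \<equiv> kernel_op d \<G> (poly_kernel q)"

lemma walk_pow_Suc: "(walk N R2 ^^ Suc k) f p = (\<Sum>j\<in>letters d. (walk N R2 ^^ k) f (R2 j p))"
  using walk_def[of N R2 "(walk N R2 ^^ k) f" p] by (simp only: funpow.simps comp_apply letters_ncols)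

text \<open>A letter applied in the variable \<open>y\<close> acts alike on the kernel and on the
  result, so the induction starts from the kernel of the identity and never disturbs the sum over
  \<open>z\<close>.\<close>

lemma kernel_walk_pow:
  assumes "y \<in> orb x"
  shows "((\<lambda>z. f (x, z) * (walk N R2 ^^ k) diag_ind (z, y)) has_sum (walk N R2 ^^ k) f (x, y)) (orb x)"
  using assms
proof (induction k arbitrary: y)
  case 0
  then show ?case by (intro has_sum_finite_neutralI[of "{y}"]) (auto simp: diag_ind_def)
next
  case (Suc k)
  have "((\<lambda>z. \<Sum>j\<in>letters d. f (x, z) * (walk N R2 ^^ k) diag_ind (z, T j y)) has_sum
      (\<Sum>j\<in>letters d. (walk N R2 ^^ k) f (x, T j y))) (orb x)"
    by (intro has_sum_finite_sum Suc.IH T_orb Suc.prems)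
  then show ?case by (simp only: walk_pow_Suc R2_pair sum_distrib_left)
qed

lemma kernel_op_poly_kernel:
  assumes "p \<in> R" shows "K q f p = pR q f p"
proof -
  obtain x y where p: "p = (x, y)" by (cases p)
  then have y: "y \<in> orb x" using assms by (simp add: R_orb)
  have "((\<lambda>z. \<Sum>i\<le>degree q. of_real (coeff q i) * (f (x, z) * (walk N R2 ^^ i) diag_ind (z, y))) has_sum pR q f (x, y)) (orb x)"
    unfolding poly_op_def by (intro has_sum_finite_sum has_sum_cmult_right kernel_walk_pow y)
  then have "((\<lambda>z. f (x, z) * poly_kernel q (z, y)) has_sum pR q f (x, y)) (orb x)"
    by (simp add: poly_kernel_def poly_op_def sum_distrib_left mult.left_commute)
  then show ?thesis by (simp add: kernel_op_def p infsumI)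
qed

text \<open>A nonzero entry of the kernel of \<open>A^k\<close> at \<open>(x, y)\<close> requires a
  word of length \<open>k\<close> leading from \<open>x\<close> to \<open>y\<close>, so the degree
  of \<open>q\<close> serves as bandwidth; the number \<open>N^k\<close> of such words bounds the
  entries.\<close>

lemma fb_kernel_poly_kernel: "fb_kernel d \<G> (poly_kernel q)"
  unfolding fb_kernel_def
proof (intro conjI)
  show "poly_kernel q \<in> borel_measurable \<nu>" unfolding poly_kernel_def by (rule L2D(1)[OF rel.poly_op_L2[OF diag_ind_L2]])
  have b: "cmod ((walk N R2 ^^ k) diag_ind p) \<le> real N ^ k" for k p
  proof (induction k arbitrary: p)
    case 0 then show ?case by (simp add: diag_ind_def)
  next
    case (Suc k)
    have "cmod (\<Sum>j\<in>letters d. (walk N R2 ^^ k) diag_ind (R2 j p)) \<le> (\<Sum>j\<in>letters d. real N ^ k)"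
      by (rule sum_norm_le) (rule Suc)
    then show ?case unfolding walk_pow_Suc by simp
  qed
  have "cmod (poly_kernel q p) \<le> (\<Sum>i\<le>degree q. \<bar>coeff q i\<bar> * real N ^ i)" for p
    unfolding poly_kernel_def poly_op_def by (rule sum_norm_le) (use b in \<open>auto simp: norm_mult mult_left_mono\<close>)
  then show "\<exists>C. \<forall>p\<in>R. cmod (poly_kernel q p) \<le> C" by blast
  have w: "\<exists>w\<in>words d. length w = k \<and> y = fold T w x" if "(walk N R2 ^^ k) diag_ind (x, y) \<noteq> 0" for k x y
    using that
  proof (induction k arbitrary: y)
    case 0 then show ?case by (auto simp: diag_ind_def split: if_splits)
  next
    case (Suc k)
    have "(\<Sum>j\<in>letters d. (walk N R2 ^^ k) diag_ind (x, T j y)) \<noteq> 0"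
      using Suc.prems by (simp only: walk_pow_Suc R2_pair not_False_eq_True)
    then obtain j where j: "j \<in> letters d" "(walk N R2 ^^ k) diag_ind (x, T j y) \<noteq> 0" by (meson sum.not_neutral_contains_not_neutral)
    then obtain w where "w \<in> words d" "length w = k" "T j y = fold T w x" using Suc.IH by blast
    then show ?case using j T_invol[OF j(1), of y] by (intro bexI[of _ "w @ [j]"]) auto
  qed
  have "poly_kernel q (x, y) = 0" if "\<not> gdist_le (leafgraph d \<G> x) (degree q) x y" for x y
  proof (rule ccontr)
    interpret involution_graph d "leafgraph d \<G> x" T by (rule involution_graph_leafgraph)
    assume "poly_kernel q (x, y) \<noteq> 0"
    then obtain i where i: "i \<le> degree q" "(walk N R2 ^^ i) diag_ind (x, y) \<noteq> 0"
      unfolding poly_kernel_def poly_op_def by (metis (no_types, lifting) atMost_iff mult_eq_0_iff sum.neutral)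
    then have "gdist_le (leafgraph d \<G> x) (degree q) x y" using w[of i x y] by (subst gdist_le_iff) auto
    then show False using that by contradiction
  qed
  then show "\<exists>b. \<forall>(x, y)\<in>R. \<not> gdist_le (leafgraph d \<G> x) b x y \<longrightarrow> poly_kernel q (x, y) = 0" by blast
qed

lemma K_L2: "f \<in> L2 \<nu> \<Longrightarrow> K q f \<in> L2 \<nu>"
  using L2_cong_space[of \<nu> "K q f" "pR q f"] by (simp add: kernel_op_poly_kernel rel.poly_op_L2)

lemma K_bounded: "bounded_op \<nu> (K q)"
  by (rule bounded_op_cong_space[OF rel.poly_op_bounded]) (simp add: kernel_op_poly_kernel)

lemma K_inner: "l2_inner \<nu> (K q f) g = l2_inner \<nu> (pR q f) g"
  unfolding l2_inner_def by (rule Bochner_Integration.integral_cong) (auto simp: kernel_op_poly_kernel)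

text \<open>Strong convergence supplies approximating kernels but does not decompose the limit into
  fibre operators. The field is therefore defined by the limits on every single orbit, and a
  subsequence converging almost everywhere on the relation identifies it with
  \<open>S\<close>.\<close>

lemma feldman_mooreI:
  assumes S: "bounded_op \<nu> S"
    and strong: "\<And>f. f \<in> L2 \<nu> \<Longrightarrow> (\<lambda>n. l2_norm \<nu> (\<lambda>p. pR (q n) f p - S f p)) \<longlonglongrightarrow> 0"
    and bd: "\<And>n s. \<bar>s\<bar> \<le> real N \<Longrightarrow> \<bar>poly (q n) s\<bar> \<le> C"
    and conv: "\<And>x g y. g \<in> L2 (count_space (orb x)) \<Longrightarrow> y \<in> orb x \<Longrightarrow> convergent (\<lambda>n. poly_op N T (q n) g y)"
  shows "S \<in> feldman_moore d \<G>"
  unfolding feldman_moore_def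
proof (intro CollectI conjI allI impI)
  define s where "s x g y = lim (\<lambda>n. poly_op N T (q n) g y)" for x :: 'a and g y
  have slim: "(\<lambda>n. poly_op N T (q n) g y) \<longlonglongrightarrow> s x g y" if "g \<in> L2 (count_space (orb x))" "y \<in> orb x" for x g y
    using conv[OF that] by (simp add: s_def convergent_LIMSEQ_iff)
  show "decomposable_op d \<G> S"
    unfolding decomposable_op_def
  proof (intro conjI S exI[of _ s] exI[of _ C] ballI)
    show "AE x in X. bounded_op_by (count_space (orb x)) C (s x)"
    proof (rule AE_I2)
      fix x
      interpret F: walk_system "count_space (orb x)" N T by (rule fibre_walk_system)
      show "bounded_op_by (count_space (orb x)) C (s x)"
        unfolding bounded_op_by_def
      proof (intro conjI ballI allI)
        fix g assume g: "g \<in> L2 (count_space (orb x))"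
        have b: "l2_norm (count_space (orb x)) (poly_op N T (q n) g) \<le> C * l2_norm (count_space (orb x)) g" for n
          by (rule F.poly_op_norm_le[OF g bd])
        have l: "(\<lambda>n. poly_op N T (q n) g y) \<longlonglongrightarrow> s x g y" if "y \<in> space (count_space (orb x))" for y
          using slim[OF g] that by simp
        show "s x g \<in> L2 (count_space (orb x))" by (rule L2_liminf(1)[OF F.poly_op_L2[OF g] b l])
        show "l2_norm (count_space (orb x)) (s x g) \<le> C * l2_norm (count_space (orb x)) g"
          by (rule L2_liminf(2)[OF F.poly_op_L2[OF g] b l])
        fix h a b assume h: "h \<in> L2 (count_space (orb x))"
        show "AE y in count_space (orb x). s x (\<lambda>z. a * g z + b * h z) y = a * s x g y + b * s x h y"
        proof (rule AE_I2)
          fix y assume "y \<in> space (count_space (orb x))"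
          then have y: "y \<in> orb x" by simp
          have "(\<lambda>n. poly_op N T (q n) (\<lambda>z. a * g z + b * h z) y) \<longlonglongrightarrow> a * s x g y + b * s x h y"
            unfolding poly_op_lincomb by (intro tendsto_intros slim g h y)
          then show "s x (\<lambda>z. a * g z + b * h z) y = a * s x g y + b * s x h y"
            unfolding s_def[of x "\<lambda>z. a * g z + b * h z"] by (rule limI)
        qed
      qed
    qed
    fix f assume f: "f \<in> L2 \<nu>"
    define D where "D n p = pR (q n) f p - S f p" for n p
    have D: "D n \<in> L2 \<nu>" for n unfolding D_def by (intro L2_diff rel.poly_op_L2 f bounded_opD(1)[OF S])
    have "(\<lambda>n. LINT p|\<nu>. norm ((cmod (D n p))\<^sup>2)) \<longlonglongrightarrow> 0"
    proof -
      have "(\<lambda>n. (l2_norm \<nu> (D n))\<^sup>2) \<longlonglongrightarrow> 0\<^sup>2"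
        using strong[OF f] unfolding D_def by (rule tendsto_power)
      then show ?thesis by (simp add: l2_norm_sq)
    qed
    then obtain r where r: "strict_mono r" "AE p in \<nu>. (\<lambda>n. (cmod (D (r n) p))\<^sup>2) \<longlonglongrightarrow> 0"
      using tendsto_L1_AE_subseq[of \<nu> "\<lambda>n p. (cmod (D n p))\<^sup>2"] L2D(2)[OF D] by auto
    show "AE x in X. \<forall>y\<in>orb x. S f (x, y) = s x (\<lambda>z. f (x, z)) y"
      using AE_\<nu>[OF r(2)] L2_fibre[OF f]
    proof eventually_elim
      case (elim x)
      show ?case
      proof
        fix y assume y: "y \<in> orb x"
        have "(\<lambda>n. cmod (D (r n) (x, y))) \<longlonglongrightarrow> 0"
          using tendsto_real_sqrt[OF elim(1)[rule_format, OF y]] by simp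
        then have "(\<lambda>n. D (r n) (x, y) + S f (x, y)) \<longlonglongrightarrow> 0 + S f (x, y)"
          by (intro tendsto_add tendsto_const) (simp add: tendsto_norm_zero_iff)
        then have "(\<lambda>n. poly_op N T (q (r n)) (\<lambda>z. f (x, z)) y) \<longlonglongrightarrow> S f (x, y)"
          by (simp add: D_def poly_op_R2)
        moreover have "(\<lambda>n. poly_op N T (q (r n)) (\<lambda>z. f (x, z)) y) \<longlonglongrightarrow> s x (\<lambda>z. f (x, z)) y"
          using LIMSEQ_subseq_LIMSEQ[OF slim[OF elim(2) y] r(1)] by (simp add: o_def)
        ultimately show "S f (x, y) = s x (\<lambda>z. f (x, z)) y" by (rule LIMSEQ_unique)
      qed
    qed
  qed
next
  fix F \<epsilon> assume F: "finite F \<and> F \<subseteq> L2 \<nu> \<times> L2 \<nu> \<and> 0 < (\<epsilon>::real)"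
  have ev: "\<forall>\<^sub>F n in sequentially. cmod (l2_inner \<nu> (S f) g - l2_inner \<nu> (K (q n) f) g) < \<epsilon>"
    if "(f, g) \<in> F" for f g
  proof -
    have f: "f \<in> L2 \<nu>" and g: "g \<in> L2 \<nu>" using that F by auto
    have "(\<lambda>n. l2_norm \<nu> (\<lambda>p. pR (q n) f p - S f p) * l2_norm \<nu> g) \<longlonglongrightarrow> 0 * l2_norm \<nu> g"
      by (intro tendsto_intros strong f)
    then have "\<forall>\<^sub>F n in sequentially. l2_norm \<nu> (\<lambda>p. pR (q n) f p - S f p) * l2_norm \<nu> g < \<epsilon>"
      using F by (intro order_tendstoD) auto
    then show ?thesis
    proof eventually_elim
      case (elim n)
      have "cmod (l2_inner \<nu> (S f) g - l2_inner \<nu> (K (q n) f) g) = cmod (l2_inner \<nu> (\<lambda>p. pR (q n) f p - S f p) g)"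
        by (subst l2_inner_diff_left) (auto simp: rel.poly_op_L2 bounded_opD(1)[OF S] f g K_inner norm_minus_commute)
      also have "\<dots> \<le> l2_norm \<nu> (\<lambda>p. pR (q n) f p - S f p) * l2_norm \<nu> g"
        by (rule l2_Cauchy_Schwarz) (auto intro: L2_diff rel.poly_op_L2 bounded_opD(1)[OF S] f g)
      finally show ?case using elim by simp
    qed
  qed
  have "\<forall>\<^sub>F n in sequentially. \<forall>(f, g)\<in>F. cmod (l2_inner \<nu> (S f) g - l2_inner \<nu> (K (q n) f) g) < \<epsilon>"
    by (rule eventually_ball_finite) (use F ev in auto)
  from eventually_happens'[OF sequentially_bot this]
  obtain n where "\<forall>(f, g)\<in>F. cmod (l2_inner \<nu> (S f) g - l2_inner \<nu> (K (q n) f) g) < \<epsilon>" ..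
  then show "\<exists>\<kappa>. fb_kernel d \<G> \<kappa> \<and> (\<forall>(f, g)\<in>F. cmod (l2_inner \<nu> (S f) g - l2_inner \<nu> (kernel_op d \<G> \<kappa> f) g) < \<epsilon>)"
    using fb_kernel_poly_kernel by blast
qed

lemma K_feldman_moore: "K q \<in> feldman_moore d \<G>"
proof -
  obtain C where C: "\<And>s. \<bar>s\<bar> \<le> real N \<Longrightarrow> \<bar>poly q s\<bar> \<le> C" using rel.poly_bounded_on_interval by blast
  have "l2_norm \<nu> (\<lambda>p. pR q f p - K q f p) = l2_norm \<nu> (\<lambda>p. 0)" for f
    unfolding l2_norm_def by (rule arg_cong[of _ _ sqrt], rule Bochner_Integration.integral_cong) (auto simp: kernel_op_poly_kernel)
  then have 0: "l2_norm \<nu> (\<lambda>p. pR q f p - K q f p) = 0" for f by (simp add: l2_norm_def)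
  show ?thesis
    by (rule feldman_mooreI[OF K_bounded, of "\<lambda>_. q" _ C]) (use C in \<open>auto simp: 0 convergent_const\<close>)
qed

end

section \<open>The trace of a spectral projection and the KNS measure\<close>

locale spectral_graphing = graphing_loc d \<G>
  for d and \<G> :: "'a::{metric_space, second_countable_topology} graphing" +
  fixes E :: "real set \<Rightarrow> ('a \<times> 'a) oper" and Tr :: "('a \<times> 'a) oper \<Rightarrow> complex"
  assumes spectral: "is_spectral_measure_of \<nu> (graphing_laplacian d \<G>) E"
    and trace: "is_graphing_trace d \<G> Tr"
begin

sublocale spec: spectral_walk \<nu> N R2 E
proof
  show "projection_valued_measure \<nu> E" using spectral by (simp add: is_spectral_measure_of_def)
  then interpret pvm \<nu> E by unfold_locales
  fix f assume f: "f \<in> L2 \<nu>"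
  show int: "integrable (scalar_spectral_measure \<nu> E f) (\<lambda>t. t)"
    using spectral f by (simp add: is_spectral_measure_of_def)
  interpret finite_measure "\<mu> f" by (rule finite_measure_\<mu>[OF f])
  have "l2_inner \<nu> (graphing_laplacian d \<G> f) f = l2_inner \<nu> (\<lambda>p. of_nat N * f p - walk N R2 f p) f"
    unfolding l2_inner_def by (rule Bochner_Integration.integral_cong) (simp_all add: laplacian_R2 del: of_nat_add)
  also have "\<dots> = of_nat N * of_real ((l2_norm \<nu> f)\<^sup>2) - l2_inner \<nu> (walk N R2 f) f"
    by (simp only: l2_inner_diff_left L2_scale f rel.walk_L2 l2_inner_scale_left l2_inner_self)
  finally have "l2_inner \<nu> (walk N R2 f) f = of_real (real N * (l2_norm \<nu> f)\<^sup>2 - (LINT t|\<mu> f. t))"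
    using spectral f by (simp add: is_spectral_measure_of_def)
  also have "real N * (l2_norm \<nu> f)\<^sup>2 - (LINT t|\<mu> f. t) = (LINT t|\<mu> f. real N - t)"
    using int by (subst Bochner_Integration.integral_diff) (auto simp: measure_\<mu>_UNIV f)
  finally show "l2_inner \<nu> (walk N R2 f) f = of_real (LINT t|scalar_spectral_measure \<nu> E f. real N - t)" .
qed

abbreviation "m \<equiv> scalar_spectral_measure \<nu> E diag_ind"

lemma trace_K: "Tr (K q) = of_real (rel.form diag_ind q)"
proof -
  have "Tr (K q) = (LINT x|X. poly_kernel q (x, x))"
    using trace fb_kernel_poly_kernel by (simp add: is_graphing_trace_def)
  also have "\<dots> = l2_inner \<nu> (pR q diag_ind) diag_ind"
    unfolding poly_kernel_def by (rule l2_inner_diag_ind[symmetric]) (rule L2D(1)[OF rel.poly_op_L2[OF diag_ind_L2]])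
  finally show ?thesis using rel.poly_op_form_real[OF diag_ind_L2] by (simp add: rel.form_def)
qed

lemma trace_lincomb:
  "S \<in> feldman_moore d \<G> \<Longrightarrow> S' \<in> feldman_moore d \<G> \<Longrightarrow> Tr (\<lambda>f p. a * S f p + b * S' f p) = a * Tr S + b * Tr S'"
  using trace by (simp add: is_graphing_trace_def normal_trace_def)

text \<open>The kernel operators \<open>U n = 5 - p_n(A)\<close> are positive, because
  \<open>p_n\<close> is at most 5 on the interval, and increase to \<open>5 - E B\<close>, their
  least upper bound among the self-adjoint elements of the algebra. Normality computes the trace of
  that bound, and linearity removes the constant.\<close>

lemma Re_trace_E: "Re (Tr (E {0..x})) = measure m {0..x}"
proof -
  define B where "B = {0..x}"
  have B [measurable]: "B \<in> sets borel" by (simp add: B_def)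
  obtain p where p0: "\<And>n s. \<bar>s\<bar> \<le> real N \<Longrightarrow> 0 \<le> poly (p n) s"
    and p5: "\<And>n s. \<bar>s\<bar> \<le> real N \<Longrightarrow> poly (p n) s \<le> 5"
    and pdec: "\<And>n s. \<bar>s\<bar> \<le> real N \<Longrightarrow> poly (p (Suc n)) s \<le> poly (p n) s"
    and plim: "\<And>s. \<bar>s\<bar> \<le> real N \<Longrightarrow> (\<lambda>n. poly (p n) s) \<longlonglongrightarrow> (if real N - x \<le> s then 1 else 0)"
    using decreasing_polys_to_indicator[of "real N" "real N - x"] by blast
  have pabs: "\<bar>poly (p n) s\<bar> \<le> 5" if "\<bar>s\<bar> \<le> real N" for n s using p0[OF that, of n] p5[OF that, of n] by simp
  \<comment> \<open>The threshold \<open>N - x\<close> expresses \<open>t \<le> x\<close>; the other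
    constraint \<open>0 \<le> t\<close> is contained in the bound on \<open>N - t\<close>, so on the
    relevant interval the half line and \<open>{0..x}\<close> have the same indicator.\<close>
  have pB: "(\<lambda>n. poly (p n) (spec.a t)) \<longlonglongrightarrow> indicator B t" if "\<bar>spec.a t\<bar> \<le> real N" for t
    using plim[OF that] that by (auto simp: spec.a_def B_def indicator_def)
  note strong = spec.poly_op_strong_tendsto[OF B pabs pB]
  \<comment> \<open>Two members of this family matter: \<open>L 5 (-1)\<close>, to which normality
    is applied, and \<open>L 0 1\<close>, which is \<open>E B\<close>. \<open>K 1\<close> is the
    identity written as a kernel operator, so that its trace is known.\<close>
  define L where "L \<alpha> \<beta> f r = complex_of_real \<alpha> * K 1 f r + complex_of_real \<beta> * E B f r" for \<alpha> \<beta> :: real and f r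
  have LN: "L \<alpha> \<beta> \<in> feldman_moore d \<G>" for \<alpha> \<beta>
  proof (rule feldman_mooreI)
    show "bounded_op \<nu> (L \<alpha> \<beta>)"
      unfolding L_def[abs_def] by (intro bounded_op_lincomb K_bounded spec.E_bounded B)
    let ?q = "\<lambda>n. [:\<alpha>:] + smult \<beta> (p n)"
    fix f assume f: "f \<in> L2 \<nu>"
    have "l2_norm \<nu> (\<lambda>r. pR (?q n) f r - L \<alpha> \<beta> f r) = l2_norm \<nu> (\<lambda>r. of_real \<beta> * (pR (p n) f r - E B f r))" for n
      unfolding l2_norm_def
      by (rule arg_cong[of _ _ sqrt], rule Bochner_Integration.integral_cong)
         (auto simp: L_def kernel_op_poly_kernel poly_op_add poly_op_smult one_pCons right_diff_distrib)
    moreover have "(\<lambda>n. \<bar>\<beta>\<bar> * l2_norm \<nu> (\<lambda>r. pR (p n) f r - E B f r)) \<longlonglongrightarrow> \<bar>\<beta>\<bar> * 0"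
      by (intro tendsto_intros strong f)
    ultimately show "(\<lambda>n. l2_norm \<nu> (\<lambda>r. pR (?q n) f r - L \<alpha> \<beta> f r)) \<longlonglongrightarrow> 0"
      by (simp add: l2_norm_scale)
  next
    fix n and s :: real assume "\<bar>s\<bar> \<le> real N"
    then have "\<bar>\<beta>\<bar> * \<bar>poly (p n) s\<bar> \<le> \<bar>\<beta>\<bar> * 5" by (intro mult_left_mono pabs) auto
    then show "\<bar>poly ([:\<alpha>:] + smult \<beta> (p n)) s\<bar> \<le> \<bar>\<alpha>\<bar> + \<bar>\<beta>\<bar> * 5"
      using abs_triangle_ineq[of \<alpha> "\<beta> * poly (p n) s"] by (simp add: abs_mult)
  next
    fix y x' and g :: "'a \<Rightarrow> complex" assume "g \<in> L2 (count_space (orb x'))" "y \<in> orb x'"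
    then have "convergent (\<lambda>n. poly_op N T (p n) g y)"
      by (intro poly_op_pointwise_convergent[where p = p, OF fibre_walk_system]) (auto intro: p0 pdec)
    then show "convergent (\<lambda>n. poly_op N T ([:\<alpha>:] + smult \<beta> (p n)) g y)"
      unfolding poly_op_add poly_op_smult by (intro convergent_add convergent_const convergent_mult)
  qed
  define U where "U n = K ([:5:] - p n)" for n
  have formU: "rel.form f ([:5:] - p n) = 5 * (l2_norm \<nu> f)\<^sup>2 - rel.form f (p n)" if "f \<in> L2 \<nu>" for f n
    by (simp only: rel.form_diff[OF that] rel.form_const)
  have Uin: "l2_inner \<nu> (U n f) f = of_real (5 * (l2_norm \<nu> f)\<^sup>2 - rel.form f (p n))" if "f \<in> L2 \<nu>" for f n
    unfolding U_def K_inner using rel.poly_op_form_real[OF that, of "[:5:] - p n"] formU[OF that, of n]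
    by (simp only: rel.form_def)
  have Sin: "l2_inner \<nu> (L 5 (-1) f) f = of_real (5 * (l2_norm \<nu> f)\<^sup>2 - measure (scalar_spectral_measure \<nu> E f) B)"
    if f: "f \<in> L2 \<nu>" for f
  proof -
    have "l2_inner \<nu> (L 5 (-1) f) f = 5 * l2_inner \<nu> (K 1 f) f + (-1) * l2_inner \<nu> (E B f) f"
      unfolding L_def
      by (subst l2_inner_add_left[OF L2_scale[OF K_L2[OF f]] L2_scale[OF spec.E_L2[OF B f]] f]) (simp only: l2_inner_scale_left of_real_numeral of_real_minus of_real_1)
    also have "l2_inner \<nu> (K 1 f) f = of_real ((l2_norm \<nu> f)\<^sup>2)"
      unfolding K_inner by (simp add: one_pCons l2_inner_self poly_op_const[abs_def])
    also have "l2_inner \<nu> (E B f) f = of_real (measure (scalar_spectral_measure \<nu> E f) B)"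
      by (simp add: spec.E_form[OF B f] spec.measure_\<mu>[OF f B])
    finally show ?thesis by simp
  qed
  have lim: "(\<lambda>n. rel.form f (p n)) \<longlonglongrightarrow> measure (scalar_spectral_measure \<nu> E f) B" if "f \<in> L2 \<nu>" for f
    by (rule spec.form_tendsto(1)[OF B pabs pB that])
  have dec: "decseq (\<lambda>n. rel.form f (p n))" if "f \<in> L2 \<nu>" for f
    by (rule decseq_SucI) (rule rel.form_mono[OF that pdec])
  have UL [simp]: "U n f \<in> L2 \<nu>" "L 5 (-1) f \<in> L2 \<nu>" if "f \<in> L2 \<nu>" for n f
    by (simp only: U_def K_L2[OF that],
        unfold L_def[abs_def], rule bounded_op_lincomb[OF K_bounded spec.E_bounded[OF B], THEN bounded_opD(1), OF that])
  have op_leU: "op_le \<nu> (U n) (U k)" if "n \<le> k" for n k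
    unfolding op_le_def op_pos_def
  proof
    fix f assume f: "f \<in> L2 \<nu>"
    have e: "l2_inner \<nu> (\<lambda>r. U k f r - U n f r) f = of_real (rel.form f (p n) - rel.form f (p k))"
      using f by (simp add: l2_inner_diff_left Uin)
    show "l2_inner \<nu> (\<lambda>r. U k f r - U n f r) f \<in> \<real>\<^sub>\<ge>\<^sub>0"
      unfolding e nonneg_Reals_of_real_iff using decseqD[OF dec[OF f] that] by simp
  qed
  have nt: "normal_functional \<nu> (feldman_moore d \<G>) Tr"
    using trace by (simp add: is_graphing_trace_def normal_trace_def)
  have "Re (Tr (L 5 (-1))) = (SUP V\<in>range U. Re (Tr V))"
  proof (rule nt[unfolded normal_functional_def, rule_format], intro conjI ballI impI)
    show "range U \<noteq> {}" by simp
    show "range U \<subseteq> feldman_moore d \<G>" using K_feldman_moore by (auto simp: U_def)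
    show "L 5 (-1) \<in> feldman_moore d \<G>" by (rule LN)
    show "op_pos \<nu> V" if V: "V \<in> range U" for V
      unfolding op_pos_def
    proof
      fix f assume f: "f \<in> L2 \<nu>"
      from V obtain n where n: "V = U n" by auto
      have "0 \<le> rel.form f ([:5:] - p n)" by (rule rel.form_nonneg[OF f]) (use p5 in auto)
      then show "l2_inner \<nu> (V f) f \<in> \<real>\<^sub>\<ge>\<^sub>0"
        unfolding n Uin[OF f] formU[OF f] nonneg_Reals_of_real_iff .
    qed
    show "\<exists>W\<in>range U. op_le \<nu> V W \<and> op_le \<nu> V' W" if V: "V \<in> range U" "V' \<in> range U" for V V'
    proof -
      from V obtain n k where "V = U n" "V' = U k" by auto
      then show ?thesis using op_leU[of n "max n k"] op_leU[of k "max n k"] by auto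
    qed
    show "op_le \<nu> V (L 5 (-1))" if V: "V \<in> range U" for V
      unfolding op_le_def op_pos_def
    proof
      fix f assume f: "f \<in> L2 \<nu>"
      from V obtain n where n: "V = U n" by auto
      have e: "l2_inner \<nu> (\<lambda>r. L 5 (-1) f r - V f r) f = of_real (rel.form f (p n) - measure (scalar_spectral_measure \<nu> E f) B)"
        unfolding n using f by (simp add: l2_inner_diff_left Uin Sin)
      show "l2_inner \<nu> (\<lambda>r. L 5 (-1) f r - V f r) f \<in> \<real>\<^sub>\<ge>\<^sub>0"
        unfolding e nonneg_Reals_of_real_iff using decseq_ge[OF dec[OF f] lim[OF f], of n] by simp
    qed
    show "op_le \<nu> (L 5 (-1)) Z"
      if Z: "Z \<in> feldman_moore d \<G>" "self_adjoint \<nu> Z \<and> (\<forall>V\<in>range U. op_le \<nu> V Z)" for Z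
      unfolding op_le_def op_pos_def
    proof
      fix f assume f: "f \<in> L2 \<nu>"
      have Zb: "bounded_op \<nu> Z" using Z(1) by (simp add: feldman_moore_def decomposable_op_def)
      have ZL: "Z f \<in> L2 \<nu>" by (rule bounded_opD(1)[OF Zb f])
      define z where "z = l2_inner \<nu> (Z f) f"
      have n: "z - of_real (5 * (l2_norm \<nu> f)\<^sup>2 - rel.form f (p n)) \<in> \<real>\<^sub>\<ge>\<^sub>0" for n
      proof -
        have "l2_inner \<nu> (\<lambda>r. Z f r - U n f r) f \<in> \<real>\<^sub>\<ge>\<^sub>0" using Z(2) f by (simp add: op_le_def op_pos_def)
        then show ?thesis by (simp only: l2_inner_diff_left[OF ZL UL(1)[OF f] f] Uin[OF f] z_def)
      qed
      \<comment> \<open>Domination of every \<open>U n\<close> by \<open>Z\<close> passes to the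
        limit of the forms, since the nonnegative reals are closed in the complex plane.\<close>
      have "(\<lambda>n. z - of_real (5 * (l2_norm \<nu> f)\<^sup>2 - rel.form f (p n))) \<longlonglongrightarrow>
          z - of_real (5 * (l2_norm \<nu> f)\<^sup>2 - measure (scalar_spectral_measure \<nu> E f) B)"
        by (intro tendsto_intros lim f)
      then have "z - of_real (5 * (l2_norm \<nu> f)\<^sup>2 - measure (scalar_spectral_measure \<nu> E f) B) \<in> \<real>\<^sub>\<ge>\<^sub>0"
        by (rule closed_sequentially[OF closed_nonneg_Reals_complex n])
      then show "l2_inner \<nu> (\<lambda>r. Z f r - L 5 (-1) f r) f \<in> \<real>\<^sub>\<ge>\<^sub>0"
        by (simp only: l2_inner_diff_left[OF ZL UL(2)[OF f] f] Sin[OF f] z_def)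
    qed
  qed
  also have "(SUP V\<in>range U. Re (Tr V)) = (SUP n. 5 - rel.form diag_ind (p n))"
    by (simp add: image_image U_def trace_K formU diag_ind_L2 l2_norm_diag_ind)
  also have "\<dots> = 5 - measure m B"
  proof (rule LIMSEQ_unique[of "\<lambda>n. 5 - rel.form diag_ind (p n)"])
    have "0 \<le> rel.form diag_ind (p n)" for n by (rule rel.form_nonneg[OF diag_ind_L2 p0])
    then show "(\<lambda>n. 5 - rel.form diag_ind (p n)) \<longlonglongrightarrow> (SUP n. 5 - rel.form diag_ind (p n))"
      using dec[OF diag_ind_L2] by (intro LIMSEQ_incseq_SUP bdd_aboveI2[of _ _ 5]) (auto simp: incseq_def decseq_def)
    show "(\<lambda>n. 5 - rel.form diag_ind (p n)) \<longlonglongrightarrow> 5 - measure m B"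
      by (intro tendsto_intros lim diag_ind_L2)
  qed
  finally have 1: "Re (Tr (L 5 (-1))) = 5 - measure m B" .
  have EN: "E B \<in> feldman_moore d \<G>" using LN[of 0 1] by (simp add: L_def[abs_def])
  have "Tr (L 5 (-1)) = 5 * Tr (K 1) + (-1) * Tr (E B)"
    unfolding L_def[abs_def] using trace_lincomb[OF K_feldman_moore[of 1] EN, of 5 "-1"] by simp
  moreover have "Tr (K 1) = 1" by (simp add: trace_K one_pCons rel.form_const l2_norm_diag_ind)
  ultimately show ?thesis using 1 by (simp add: B_def)
qed

lemma m_finite_borel: "finite_borel_measure m"
  using spec.finite_measure_\<mu>[OF diag_ind_L2] spec.sets_\<mu> by (simp add: finite_borel_measure_def finite_borel_measure_axioms_def)

lemma m_support: "AE t in m. 0 \<le> t \<and> t \<le> 2 * real N"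
  using spec.AE_\<mu>_a_bound[OF diag_ind_L2] by eventually_elim (auto simp: spec.a_def)

text \<open>Both measures have the same distribution function: \<open>m\<close> gives no mass to the
  negative numbers, so \<open>{0..x}\<close> may be replaced by \<open>{..x}\<close>. A distribution
  function determines a finite Borel measure.\<close>

lemma KNS_measure_eq: "KNS_measure Tr E = m"
proof -
  interpret m: finite_borel_measure m by (rule m_finite_borel)
  have F: "(\<lambda>x. Re (Tr (E {0..x}))) = cdf m"
  proof
    fix x
    have "measure m {0..x} = measure m {..x}"
      by (rule m.finite_measure_eq_AE) (use m_support spec.sets_\<mu> in auto)
    then show "Re (Tr (E {0..x})) = cdf m x" by (simp add: Re_trace_E cdf_def)
  qed
  have "KNS_measure Tr E = interval_measure (cdf m)" by (simp add: KNS_measure_def F)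
  also have "\<dots> = m"
  proof (rule cdf_unique')
    show "finite_borel_measure (interval_measure (cdf m))"
      by (rule finite_borel_measure_interval_measure[OF m.cdf_nondecreasing m.cdf_is_right_cont m.cdf_lim_at_bot m.cdf_lim_at_top]) auto
    show "cdf (interval_measure (cdf m)) = cdf m"
      by (rule cdf_interval_measure[OF m.cdf_nondecreasing m.cdf_is_right_cont m.cdf_lim_at_bot])
  qed (rule m_finite_borel)
  finally show ?thesis .
qed

lemma m_moment: "(LINT t|m. poly q (real N - t)) = Re (LINT x|X. poly_kernel q (x, x))"
proof -
  have "(LINT t|m. poly q (real N - t)) = rel.form diag_ind q"
    by (simp add: spec.form_eq_integral diag_ind_L2 spec.a_def)
  also have "\<dots> = Re (LINT x|X. poly_kernel q (x, x))"
    unfolding rel.form_def poly_kernel_def by (subst l2_inner_diag_ind) (auto intro: L2D(1) rel.poly_op_L2 diag_ind_L2)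
  finally show ?thesis .
qed

end

section \<open>Eigenvalues of finite graphs\<close>

interpretation cfun: vector_space "\<lambda>(c :: complex) (f :: 'v \<Rightarrow> complex) v. c * f v"
  by unfold_locales (auto simp: fun_eq_iff algebra_simps)

lemma sum_apply_fun: "(\<Sum>i\<in>I. f i) x = (\<Sum>i\<in>I. f i x)" for f :: "'i \<Rightarrow> 'b \<Rightarrow> complex"
  by (induction I rule: infinite_finite_induct) auto

lemma cfun_span_finite_support:
  fixes f :: "'v \<Rightarrow> complex"
  assumes "finite V" "\<And>v. v \<notin> V \<Longrightarrow> f v = 0"
  shows "f \<in> cfun.span ((\<lambda>v u. if u = v then 1 else 0) ` V)"
proof -
  have "f = (\<Sum>v\<in>V. (\<lambda>u. f v * (if u = v then 1 else 0)))"
    using assms by (auto simp: fun_eq_iff sum_apply_fun if_distrib[of "\<lambda>x. _ * x"] cong: if_cong)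
  also have "\<dots> \<in> cfun.span ((\<lambda>v u. if u = v then 1 else 0) ` V)"
    by (intro cfun.span_sum cfun.span_scale[where c = "f _"] cfun.span_base) auto
  finally show ?thesis .
qed

section \<open>The spectral theorem in finite dimension\<close>

locale finite_selfadjoint =
  fixes V :: "'v set" and B :: "('v \<Rightarrow> complex) \<Rightarrow> 'v \<Rightarrow> complex"
  assumes finV: "finite V"
    and B_lincomb: "B (\<lambda>v. a * f v + b * g v) = (\<lambda>v. a * B f v + b * B g v)"
    and B_off: "v \<notin> V \<Longrightarrow> B f v = 0"
    and B_sym: "(\<Sum>v\<in>V. B f v * cnj (g v)) = (\<Sum>v\<in>V. f v * cnj (B g v))"
begin

definition ip :: "('v \<Rightarrow> complex) \<Rightarrow> ('v \<Rightarrow> complex) \<Rightarrow> complex" where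
  "ip f g = (\<Sum>v\<in>V. f v * cnj (g v))"

definition Wsp :: "('v \<Rightarrow> complex) set" where
  "Wsp = {f. \<forall>v. v \<notin> V \<longrightarrow> f v = 0}"

lemma ip_lincomb: "ip (\<lambda>v. a * f v + b * g v) h = a * ip f h + b * ip g h"
  by (simp add: ip_def sum.distrib sum_distrib_left algebra_simps)

lemma ip_scale: "ip (\<lambda>v. a * f v) h = a * ip f h"
  by (simp add: ip_def sum_distrib_left algebra_simps)

lemma ip_scale_right: "ip h (\<lambda>v. a * f v) = cnj a * ip h f"
  by (simp add: ip_def sum_distrib_left algebra_simps)

lemma ip_sum: "ip (\<lambda>v. \<Sum>i\<in>I. c i * f i v) h = (\<Sum>i\<in>I. c i * ip (f i) h)"
proof -
  have "ip (\<lambda>v. \<Sum>i\<in>I. c i * f i v) h = (\<Sum>v\<in>V. \<Sum>i\<in>I. c i * (f i v * cnj (h v)))"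
    by (simp add: ip_def sum_distrib_right mult.assoc)
  also have "\<dots> = (\<Sum>i\<in>I. \<Sum>v\<in>V. c i * (f i v * cnj (h v)))" by (rule sum.swap)
  finally show ?thesis by (simp add: ip_def sum_distrib_left)
qed

lemma ip_commute: "ip f g = cnj (ip g f)"
  by (simp add: ip_def mult.commute)

lemma ip_self: "ip f f = of_real (\<Sum>v\<in>V. (cmod (f v))\<^sup>2)"
  by (simp add: ip_def complex_norm_square[symmetric])

lemma ip_self_eq_0: "f \<in> Wsp \<Longrightarrow> ip f f = 0 \<longleftrightarrow> f = (\<lambda>v. 0)"
  unfolding ip_self of_real_eq_0_iff using sum_nonneg_eq_0_iff[OF finV, of "\<lambda>v. (cmod (f v))\<^sup>2"]
  by (auto simp: Wsp_def fun_eq_iff)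

lemma ip_B: "ip (B f) g = ip f (B g)"
  by (simp add: ip_def B_sym)

lemma B_scale: "B (\<lambda>v. a * f v) = (\<lambda>v. a * B f v)"
  using B_lincomb[of a f 0 f] by simp

lemma B_sum: "B (\<lambda>v. \<Sum>i\<in>I. c i * f i v) = (\<lambda>v. \<Sum>i\<in>I. c i * B (f i) v)" if "finite I"
  using that
proof (induction I)
  case empty
  show ?case using B_lincomb[of 0 _ 0] by simp
next
  case (insert i I)
  then show ?case using B_lincomb[of "c i" "f i" 1 "\<lambda>v. \<Sum>i\<in>I. c i * f i v"] by (simp add: fun_eq_iff)
qed

text \<open>Pairing a linear relation with one of the vectors isolates its coefficient, whence
  independence. Functions vanishing off \<open>V\<close> lie in the span of the point masses, which
  bounds the size; this bound lets a largest eigensystem exist.\<close>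

lemma card_orthonormal:
  assumes S: "finite S" "S \<subseteq> Wsp" "\<And>b c. b \<in> S \<Longrightarrow> c \<in> S \<Longrightarrow> ip b c = (if b = c then 1 else 0)"
  shows "cfun.independent S" "card S \<le> card V"
proof -
  show ind: "cfun.independent S"
  proof
    assume "cfun.dependent S"
    then obtain u where u: "\<exists>b\<in>S. u b \<noteq> 0" "(\<Sum>b\<in>S. (\<lambda>v. u b * b v)) = 0"
      using cfun.dependent_finite[OF S(1)] by auto
    then obtain c where c: "c \<in> S" "u c \<noteq> 0" by auto
    have "(\<lambda>v. \<Sum>b\<in>S. u b * b v) = (\<lambda>v. 0)" using u(2) by (auto simp: fun_eq_iff sum_apply_fun)
    then have "ip (\<lambda>v. \<Sum>b\<in>S. u b * b v) c = 0" by (simp add: ip_def)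
    then have "(\<Sum>b\<in>S. u b * (if b = c then 1 else 0)) = 0"
      unfolding ip_sum using S(3) c(1) by (simp cong: sum.cong)
    then show False using c S(1) by (simp add: if_distrib[of "\<lambda>x. _ * x"] cong: if_cong)
  qed
  have "S \<subseteq> cfun.span ((\<lambda>v u. if u = v then 1 else 0) ` V)"
    using S(2) cfun_span_finite_support[OF finV] by (auto simp: Wsp_def)
  from cfun.independent_span_bound[OF _ ind this] finV
  have "card S \<le> card ((\<lambda>v u. if u = v then (1::complex) else 0) ` V)" by auto
  also have "\<dots> \<le> card V" by (rule card_image_le[OF finV])
  finally show "card S \<le> card V" .
qed

text \<open>Complex coefficients, in contrast to \<open>poly_op\<close>, because a root has to be
  split off.\<close>

definition cpo :: "complex poly \<Rightarrow> ('v \<Rightarrow> complex) \<Rightarrow> 'v \<Rightarrow> complex" where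
  "cpo q f v = (\<Sum>i\<le>degree q. coeff q i * (B ^^ i) f v)"

lemma cpo_extend: "degree q \<le> n \<Longrightarrow> cpo q f v = (\<Sum>i\<le>n. coeff q i * (B ^^ i) f v)"
  unfolding cpo_def by (rule sum.mono_neutral_left) (auto simp: coeff_eq_0)

lemma cpo_linear_factor: "cpo ([:- z, 1:] * r) g = (\<lambda>v. B (cpo r g) v - z * cpo r g v)"
proof
  fix v
  define n where "n = degree r"
  have "degree ([:- z, 1:] * r) \<le> Suc n"
    using degree_mult_le[of "[:- z, 1:]" r] by (simp add: n_def)
  then have "cpo ([:- z, 1:] * r) g v = (\<Sum>i\<le>Suc n. coeff ([:- z, 1:] * r) i * (B ^^ i) g v)"
    by (rule cpo_extend)
  also have "\<dots> = (\<Sum>i\<le>Suc n. coeff (pCons 0 r) i * (B ^^ i) g v) - z * (\<Sum>i\<le>Suc n. coeff r i * (B ^^ i) g v)"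
    by (simp add: sum_subtractf sum_distrib_left algebra_simps del: sum.atMost_Suc)
  also have "(\<Sum>i\<le>Suc n. coeff (pCons 0 r) i * (B ^^ i) g v) = (\<Sum>i\<le>n. coeff r i * B ((B ^^ i) g) v)"
    by (subst sum.atMost_Suc_shift) simp
  also have "\<dots> = B (cpo r g) v"
    using B_sum[of "{..n}" "coeff r" "\<lambda>i. (B ^^ i) g"] by (simp add: cpo_def[abs_def] n_def)
  also have "(\<Sum>i\<le>Suc n. coeff r i * (B ^^ i) g v) = cpo r g v"
    by (rule cpo_extend[symmetric]) (simp add: n_def)
  finally show "cpo ([:- z, 1:] * r) g v = B (cpo r g) v - z * cpo r g v" .
qed

lemma annihilating_poly:
  assumes g: "g \<in> Wsp" shows "\<exists>q. q \<noteq> 0 \<and> cpo q g = (\<lambda>v. 0)"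
proof -
  define u where "u i = (B ^^ i) g" for i
  define n where "n = card V"
  have uW: "u i \<in> Wsp" for i using g B_off by (cases i) (auto simp: u_def Wsp_def)
  have ann: "\<exists>q. q \<noteq> 0 \<and> cpo q g = (\<lambda>v. 0)"
    if c: "j \<le> n" "c j \<noteq> 0" "\<And>v. (\<Sum>i\<le>n. c i * u i v) = 0" for c j
  proof -
    define q where "q = (\<Sum>i\<le>n. monom (c i) i)"
    have co: "coeff q i = (if i \<le> n then c i else 0)" for i
      by (simp add: q_def coeff_sum)
    have "degree q \<le> n" unfolding q_def by (rule degree_sum_le) (auto intro: order_trans[OF degree_monom_le])
    then have "cpo q g v = 0" for v using c(3)[of v] by (simp add: cpo_extend co u_def)
    moreover have "q \<noteq> 0" using co[of j] c by auto
    ultimately show ?thesis by auto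
  qed
  show ?thesis
  \<comment> \<open>The vectors \<open>u 0, ..., u n\<close> are one more than the dimension.
    Dependence is a property of sets, so a repetition among them is treated apart:
    \<open>u i = u j\<close> gives the annihilating polynomial \<open>X^i - X^j\<close>.\<close>
  proof (cases "inj_on u {..n}")
    case True
    let ?S = "u ` {..n}"
    have "cfun.dependent ?S"
    proof (rule ccontr)
      assume ind: "cfun.independent ?S"
      have "?S \<subseteq> cfun.span ((\<lambda>v u. if u = v then 1 else 0) ` V)"
        using uW cfun_span_finite_support[OF finV] by (auto simp: Wsp_def)
      from cfun.independent_span_bound[OF _ ind this] finV
      have "card ?S \<le> card ((\<lambda>v u. if u = v then (1::complex) else 0) ` V)" by auto
      also have "\<dots> \<le> n" unfolding n_def by (rule card_image_le[OF finV])
      finally show False using card_image[OF True] by simp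
    qed
    then obtain x where x: "\<exists>f\<in>?S. x f \<noteq> 0" "(\<Sum>f\<in>?S. (\<lambda>v. x f * f v)) = 0"
      using cfun.dependent_finite[of ?S] by auto
    then obtain j where j: "j \<le> n" "x (u j) \<noteq> 0" by auto
    have "(\<Sum>i\<le>n. x (u i) * u i v) = 0" for v
    proof -
      have "(\<Sum>i\<le>n. x (u i) * u i v) = (\<Sum>f\<in>?S. x f * f v)" by (simp add: sum.reindex[OF True])
      also have "\<dots> = (\<Sum>f\<in>?S. (\<lambda>v. x f * f v)) v" by (simp add: sum_apply_fun)
      finally show ?thesis unfolding x(2) by simp
    qed
    then show ?thesis using ann[OF j(1), of "\<lambda>i. x (u i)"] j by blast
  next
    case False
    then obtain i j where ij: "i \<le> n" "j \<le> n" "i \<noteq> j" "u i = u j" by (auto simp: inj_on_def)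
    have "(\<Sum>k\<le>n. ((if k = i then 1 else 0) - (if k = j then 1 else 0)) * u k v) = u i v - u j v" for v
      using ij by (simp add: left_diff_distrib sum_subtractf if_distrib[of "\<lambda>x. x * _"] cong: if_cong)
    then show ?thesis using ann[OF ij(1), of "\<lambda>k. (if k = i then 1 else 0) - (if k = j then 1 else 0)"] ij by simp
  qed
qed

text \<open>Take an annihilating polynomial of \<open>g\<close> of least degree and split off a root
  \<open>z\<close>: the cofactor applied to \<open>g\<close> is nonzero by minimality and is an
  eigenvector for \<open>z\<close>, which is real by symmetry of \<open>B\<close>. It lies in every
  invariant subspace \<open>U\<close> containing \<open>g\<close>, a freedom used for orthogonal
  complements.\<close>

lemma exists_eigenvector:
  assumes g: "g \<in> Wsp" "g \<noteq> (\<lambda>v. 0)"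
    and U: "g \<in> U" "\<And>f. f \<in> U \<Longrightarrow> B f \<in> U" "\<And>a b f h. f \<in> U \<Longrightarrow> h \<in> U \<Longrightarrow> (\<lambda>v. a * f v + b * h v) \<in> U"
  shows "\<exists>h\<in>U \<inter> Wsp. h \<noteq> (\<lambda>v. 0) \<and> (\<exists>s::real. B h = (\<lambda>v. of_real s * h v))"
proof -
  define P where "P n = (\<exists>q. q \<noteq> 0 \<and> cpo q g = (\<lambda>v. 0) \<and> degree q = n)" for n
  have "\<exists>n. P n" using annihilating_poly[OF g(1)] by (auto simp: P_def)
  then obtain q where q: "q \<noteq> 0" "cpo q g = (\<lambda>v. 0)" "degree q = (LEAST n. P n)"
    using LeastI_ex[of P] unfolding P_def by blast
  have "degree q \<noteq> 0"
  proof
    assume "degree q = 0"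
    then obtain c where "q = [:c:]" by (auto elim: degree_eq_zeroE)
    then show False using q g by (auto simp: cpo_def fun_eq_iff)
  qed
  then obtain z where "poly q z = 0"
    using fundamental_theorem_of_algebra[of q] by (metis constant_degree)
  then obtain r where qr: "q = [:- z, 1:] * r" by (metis dvdE poly_eq_0_iff_dvd)
  then have r: "r \<noteq> 0" "degree r < degree q" using q by (auto simp: degree_mult_eq simp del: mult_pCons_left)
  define h where "h = cpo r g"
  have h0: "h \<noteq> (\<lambda>v. 0)"
  proof
    assume "h = (\<lambda>v. 0)"
    then have "P (degree r)" using r by (auto simp: P_def h_def)
    then show False using r(2) not_less_Least q(3) by metis
  qed
  have Bh: "B h = (\<lambda>v. z * h v)" using q(2) unfolding qr cpo_linear_factor h_def by (auto simp: fun_eq_iff)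
  have pw: "(B ^^ i) g \<in> U" for i by (induction i) (auto simp: U)
  have z0: "(\<lambda>v. 0) \<in> U" using U(3)[OF U(1,1), of 0 0] by simp
  have "(\<lambda>v. \<Sum>i\<in>I. coeff r i * (B ^^ i) g v) \<in> U" if "finite I" for I
    using that
  proof (induction I)
    case (insert i I)
    then show ?case using U(3)[OF pw[of i] insert.IH, of "coeff r i" 1] by simp
  qed (simp add: z0)
  from this[of "{..degree r}"] have hU: "h \<in> U" unfolding h_def cpo_def[abs_def] by simp
  have hW: "h \<in> Wsp"
  proof -
    have "(B ^^ i) g \<in> Wsp" for i using g B_off by (cases i) (auto simp: Wsp_def)
    then show ?thesis by (simp add: h_def cpo_def Wsp_def)
  qed
  have "z * ip h h = ip (B h) h" by (simp add: Bh ip_scale)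
  also have "\<dots> = cnj z * ip h h" by (simp add: ip_B) (simp add: Bh ip_scale_right)
  finally have "z = cnj z" using h0 ip_self_eq_0[OF hW] by simp
  then have "z = of_real (Re z)" by (metis Reals_cnj_iff of_real_Re)
  then show ?thesis using Bh h0 hU hW by (intro bexI[of _ h]) (metis, simp)
qed

definition eigensystem :: "('v \<Rightarrow> complex) set \<Rightarrow> (('v \<Rightarrow> complex) \<Rightarrow> real) \<Rightarrow> bool" where
  "eigensystem S eg \<longleftrightarrow> finite S \<and> S \<subseteq> Wsp \<and>
     (\<forall>b\<in>S. \<forall>c\<in>S. ip b c = (if b = c then 1 else 0)) \<and> (\<forall>b\<in>S. B b = (\<lambda>v. of_real (eg b) * b v))"

text \<open>Choose an orthonormal system of eigenvectors of largest size. Its orthogonal complement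
  is invariant, so a nonzero vector there would produce a further normalized eigenvector and a
  larger system.\<close>

lemma exists_eigenbasis:
  obtains S eg where "eigensystem S eg"
    "\<And>f. f \<in> Wsp \<Longrightarrow> f = (\<lambda>v. \<Sum>b\<in>S. ip f b * b v)"
proof -
  define P where "P n = (\<exists>S eg. eigensystem S eg \<and> card S = n)" for n
  have "P 0" by (auto simp: P_def eigensystem_def intro!: exI[of _ "{}"])
  moreover have bd: "n \<le> card V" if Pn: "P n" for n
  proof -
    obtain S eg where "eigensystem S eg" "card S = n" using Pn by (auto simp: P_def)
    then show ?thesis using card_orthonormal(2)[of S] by (auto simp: eigensystem_def)
  qed
  ultimately obtain n where n: "P n" "\<And>k. P k \<Longrightarrow> k \<le> n"
    using GreatestI_nat[of P 0 "card V"] Greatest_le_nat[of P _ "card V"] by metis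
  then obtain S eg where es: "eigensystem S eg" "card S = n" by (auto simp: P_def)
  then have fin: "finite S" and SW: "S \<subseteq> Wsp"
    and on: "\<And>b c. b \<in> S \<Longrightarrow> c \<in> S \<Longrightarrow> ip b c = (if b = c then 1 else 0)"
    and eg: "\<And>b. b \<in> S \<Longrightarrow> B b = (\<lambda>v. of_real (eg b) * b v)"
    by (auto simp: eigensystem_def)
  have perp: "f = (\<lambda>v. 0)" if f: "f \<in> Wsp" and fS: "\<And>b. b \<in> S \<Longrightarrow> ip f b = 0" for f
  proof (rule ccontr)
    assume f0: "f \<noteq> (\<lambda>v. 0)"
    define U where "U = {g. \<forall>b\<in>S. ip g b = 0}"
    have "\<exists>h\<in>U \<inter> Wsp. h \<noteq> (\<lambda>v. 0) \<and> (\<exists>s::real. B h = (\<lambda>v. of_real s * h v))"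
    proof (rule exists_eigenvector[OF f f0])
      show "f \<in> U" using fS by (auto simp: U_def)
      show "B g \<in> U" if "g \<in> U" for g
        using that by (auto simp: U_def ip_B eg ip_scale_right)
      show "(\<lambda>v. a * g v + b * h v) \<in> U" if "g \<in> U" "h \<in> U" for a b g h
        using that by (auto simp: U_def ip_lincomb)
    qed
    then obtain h s where h: "h \<in> U" "h \<in> Wsp" "h \<noteq> (\<lambda>v. 0)" "B h = (\<lambda>v. of_real s * h v)" by auto
    define r where "r = (\<Sum>v\<in>V. (cmod (h v))\<^sup>2)"
    have r: "ip h h = of_real r" "r > 0"
      using ip_self_eq_0[OF h(2)] h(3) by (auto simp: ip_self r_def less_le sum_nonneg simp flip: of_real_power of_real_sum)
    define e where "e = (\<lambda>v. of_real (1 / sqrt r) * h v)"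
    have ee: "ip e e = 1"
    proof -
      have "ip e e = of_real ((1 / sqrt r) * (1 / sqrt r) * r)"
        unfolding e_def ip_scale ip_scale_right r(1)
        by (simp only: of_real_mult mult.assoc complex_cnj_complex_of_real)
      also have "(1 / sqrt r) * (1 / sqrt r) * r = 1" using r(2) by simp
      finally show ?thesis by simp
    qed
    have eS: "ip e b = 0" "ip b e = 0" if "b \<in> S" for b
    proof -
      show "ip e b = 0" unfolding e_def ip_scale using h(1) that by (simp add: U_def)
      then show "ip b e = 0" using ip_commute[of b e] by simp
    qed
    have "e \<notin> S" using ee eS by force
    have Be: "B e = (\<lambda>v. of_real s * e v)" unfolding e_def B_scale h(4) by (simp add: mult.left_commute)
    have "eigensystem (insert e S) (eg(e := s))"
      unfolding eigensystem_def
      using fin SW on eg ee eS Be \<open>e \<notin> S\<close> h(2) by (auto simp: e_def Wsp_def)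
    then have "P (Suc n)" using es(2) fin \<open>e \<notin> S\<close> unfolding P_def by (metis card_insert_disjoint)
    then show False using n(2) by fastforce
  qed
  have "f = (\<lambda>v. \<Sum>b\<in>S. ip f b * b v)" if f: "f \<in> Wsp" for f
  proof -
    let ?g = "\<lambda>v. 1 * f v + (-1) * (\<Sum>b\<in>S. ip f b * b v)"
    have "?g = (\<lambda>v. 0)"
    proof (rule perp)
      show "?g \<in> Wsp" using f SW by (auto simp: Wsp_def subset_iff intro!: sum.neutral)
      fix c assume c: "c \<in> S"
      have "(\<Sum>b\<in>S. ip f b * ip b c) = (\<Sum>b\<in>S. ip f b * (if b = c then 1 else 0))"
        by (rule sum.cong) (simp_all add: on c)
      also have "\<dots> = ip f c" using c fin by (simp add: if_distrib[of "\<lambda>x. _ * x"] cong: if_cong)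
      finally show "ip ?g c = 0" unfolding ip_lincomb ip_sum by simp
    qed
    then show ?thesis by (simp add: fun_eq_iff)
  qed
  then show ?thesis using that es(1) by blast
qed

end

section \<open>Power sums and multiplicities of the eigenvalues of a finite graph\<close>

lemma walk_pow_words:
  "(walk (ncols d) T ^^ k) f v = (\<Sum>w | w \<in> words d \<and> length w = k. f (fold T w v))"
proof (induction k arbitrary: v)
  case 0
  have "{w \<in> words d. length w = 0} = {[]}" by auto
  then show ?case by simp
next
  case (Suc k)
  have inj: "inj_on (\<lambda>(j, w). j # w) (letters d \<times> {w \<in> words d. length w = k})"
    by (auto simp: inj_on_def)
  have im: "{w \<in> words d. length w = Suc k} = (\<lambda>(j, w). j # w) ` (letters d \<times> {w \<in> words d. length w = k})"
    by (auto simp: length_Suc_conv)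
  have "(walk (ncols d) T ^^ Suc k) f v = (\<Sum>j\<in>letters d. (walk (ncols d) T ^^ k) f (T j v))"
    using walk_def[of "ncols d" T "(walk (ncols d) T ^^ k) f" v] by (simp only: funpow.simps comp_apply letters_ncols)
  also have "\<dots> = (\<Sum>(j, w)\<in>letters d \<times> {w \<in> words d. length w = k}. f (fold T w (T j v)))"
    unfolding Suc.IH by (simp add: sum.cartesian_product)
  also have "\<dots> = (\<Sum>w | w \<in> words d \<and> length w = Suc k. f (fold T w v))"
    unfolding im by (subst sum.reindex[OF inj]) (auto intro!: sum.cong)
  finally show ?case .
qed

lemma L2_finite: "finite V \<Longrightarrow> f \<in> L2 (count_space V)"
  by (simp add: L2_def integrable_count_space)

lemma l2_inner_finite: "finite V \<Longrightarrow> l2_inner (count_space V) f g = (\<Sum>v\<in>V. f v * cnj (g v))"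
  by (simp add: l2_inner_def lebesgue_integral_count_space_finite)

context involution_graph
begin

lemma finite_walk_system:
  assumes "finite (verts H)" shows "walk_system (count_space (verts H)) (ncols d) T"
proof
  fix j assume "j \<in> {1..ncols d}"
  then have j: "j \<in> letters d" by (simp only: letters_ncols)
  show "T j \<in> measurable (count_space (verts H)) (count_space (verts H))" using T_verts[OF _ j] by simp
  show "T j (T j p) = p" if "p \<in> space (count_space (verts H))" for p using that T_invol[OF _ j] by simp
  have "bij_betw (T j) (verts H) (verts H)"
    by (rule bij_betw_byWitness[of _ "T j"]) (auto simp: T_invol[OF _ j] T_verts[OF _ j])
  then show "distr (count_space (verts H)) (count_space (verts H)) (T j) = count_space (verts H)"
    by (rule distr_bij_count_space)
qed (simp add: ncols_def)

text \<open>The trace of \<open>A^k\<close> is computed in two bases: an orthonormal eigenbasis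
  gives the power sum of the eigenvalues, the point masses give the number of pairs of a word and a
  vertex fixed by it.\<close>

lemma laplacian_spectrum:
  assumes fin: "finite (verts H)"
  obtains S :: "('v \<Rightarrow> complex) set" and eg :: "('v \<Rightarrow> complex) \<Rightarrow> real"
  where "finite S"
    "\<And>b. b \<in> S \<Longrightarrow> \<exists>v\<in>verts H. b v \<noteq> 0"
    "\<And>b v. b \<in> S \<Longrightarrow> v \<in> verts H \<Longrightarrow> graph_laplacian H b v = of_real (eg b) * b v"
    "\<And>t. laplacian_mult H t = card {b \<in> S. eg b = t}"
    "\<And>k. (\<Sum>b\<in>S. (real (ncols d) - eg b) ^ k) =
      (\<Sum>w | w \<in> words d \<and> length w = k. real (card {v \<in> verts H. fold T w v = v}))"
proof -
  define V where "V = verts H"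
  define N where "N = ncols d"
  define B where "B f v = (if v \<in> V then walk N T f v else 0)" for f :: "'v \<Rightarrow> complex" and v
  have fV: "finite V" using fin by (simp add: V_def)
  interpret ws: walk_system "count_space V" N T unfolding V_def N_def by (rule finite_walk_system[OF fin])
  interpret fs: finite_selfadjoint V B
  proof
    show "B (\<lambda>v. a * f v + b * g v) = (\<lambda>v. a * B f v + b * B g v)" for a b f g
      unfolding B_def walk_lincomb by auto
    show "(\<Sum>v\<in>V. B f v * cnj (g v)) = (\<Sum>v\<in>V. f v * cnj (B g v))" for f g
      using ws.walk_self_adjoint[OF L2_finite[OF fV] L2_finite[OF fV], of f g]
      by (simp add: l2_inner_finite[OF fV] B_def)
  qed (auto simp: B_def fV)
  obtain S eg where es: "fs.eigensystem S eg"
    and basis: "\<And>f. f \<in> fs.Wsp \<Longrightarrow> f = (\<lambda>v. \<Sum>b\<in>S. fs.ip f b * b v)"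
    using fs.exists_eigenbasis by blast
  have finS: "finite S" and SW: "S \<subseteq> fs.Wsp"
    and on: "\<And>b c. b \<in> S \<Longrightarrow> c \<in> S \<Longrightarrow> fs.ip b c = (if b = c then 1 else 0)"
    and evB: "\<And>b. b \<in> S \<Longrightarrow> B b = (\<lambda>v. of_real (eg b) * b v)"
    using es by (auto simp: fs.eigensystem_def)
  have lap: "graph_laplacian H f v = of_nat N * f v - B f v" if "v \<in> V" for f v
    using laplacian_eq_walk[of v f] that by (simp add: B_def V_def N_def)
  have Bpow: "(B ^^ k) f v = (walk N T ^^ k) f v" if "v \<in> V" for k f v
    using that
  proof (induction k arbitrary: v)
    case (Suc k)
    have "B ((B ^^ k) f) v = (\<Sum>j\<in>letters d. (B ^^ k) f (T j v))"
      using Suc.prems by (simp add: B_def N_def walk_def flip: letters_ncols)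
    also have "\<dots> = (\<Sum>j\<in>letters d. (walk N T ^^ k) f (T j v))"
      by (rule sum.cong) (use Suc T_verts in \<open>auto simp: V_def\<close>)
    finally show ?case by (simp add: N_def walk_def[of _ _ "(_ ^^ _) _"] flip: letters_ncols)
  qed simp
  have evpow: "(B ^^ k) b = (\<lambda>v. of_real (eg b ^ k) * b v)" if "b \<in> S" for b k
  proof (induction k)
    case (Suc k)
    have "(B ^^ Suc k) b = B (\<lambda>v. of_real (eg b ^ k) * b v)" by (simp only: funpow.simps comp_apply Suc.IH)
    then show ?case unfolding fs.B_scale evB[OF that] by (simp add: fun_eq_iff)
  qed simp
  define \<delta> where "\<delta> v u = (if u = v then 1 else 0 :: complex)" for v u :: 'v
  have ip\<delta>: "fs.ip (\<delta> v) b = cnj (b v)" if "v \<in> V" for v b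
    using that fV by (simp add: fs.ip_def \<delta>_def if_distrib[of "\<lambda>x. x * _"] cong: if_cong)
  have Bpow_sum: "(B ^^ k) (\<lambda>v. \<Sum>b\<in>S. c b * b v) = (\<lambda>v. \<Sum>b\<in>S. c b * (B ^^ k) b v)" for k c
    by (induction k) (simp_all add: fs.B_sum[OF finS])
  \<comment> \<open>The diagonal entry at \<open>v\<close>, expanded in the eigenbasis; summation
    over \<open>v\<close> removes the weights, because each \<open>b\<close> has norm one.\<close>
  have diag: "(B ^^ k) (\<delta> v) v = of_real (\<Sum>b\<in>S. eg b ^ k * (cmod (b v))\<^sup>2)" if v: "v \<in> V" for k v
  proof -
    have "\<delta> v \<in> fs.Wsp" using v by (auto simp: fs.Wsp_def \<delta>_def)
    from basis[OF this] have "\<delta> v = (\<lambda>u. \<Sum>b\<in>S. cnj (b v) * b u)" by (simp add: ip\<delta>[OF v])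
    then have "(B ^^ k) (\<delta> v) v = (\<Sum>b\<in>S. cnj (b v) * (B ^^ k) b v)" by (simp only: Bpow_sum)
    also have "\<dots> = (\<Sum>b\<in>S. of_real (eg b ^ k * (cmod (b v))\<^sup>2))"
    proof (rule sum.cong[OF refl])
      fix b assume "b \<in> S"
      then have "cnj (b v) * (B ^^ k) b v = of_real (eg b ^ k) * (b v * cnj (b v))"
        by (simp only: evpow mult.left_commute mult.commute)
      then show "cnj (b v) * (B ^^ k) b v = of_real (eg b ^ k * (cmod (b v))\<^sup>2)"
        by (simp only: complex_norm_square of_real_mult)
    qed
    finally show ?thesis by simp
  qed
  show ?thesis
  \<comment> \<open>So far \<open>eg\<close> gives the eigenvalues of the walk operator; the
    Laplacian has \<open>N\<close> minus these.\<close>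
  proof (rule that[of S "\<lambda>b. real N - eg b"])
    show "finite S" by fact
    fix b assume b: "b \<in> S"
    show "\<exists>v\<in>verts H. b v \<noteq> 0"
    proof (rule ccontr)
      assume "\<not> ?thesis"
      then have "fs.ip b b = 0" unfolding fs.ip_def by (intro sum.neutral) (simp add: V_def)
      then show False using on[OF b b] by simp
    qed
    show "graph_laplacian H b v = of_real (real N - eg b) * b v" if "v \<in> verts H" for v
      using lap[of v b] that evB[OF b] by (simp add: V_def left_diff_distrib)
  next
    fix t
    let ?St = "{b \<in> S. real N - eg b = t}"
    let ?E = "{f. (\<forall>v. v \<notin> verts H \<longrightarrow> f v = 0) \<and> (\<forall>v\<in>verts H. graph_laplacian H f v = of_real t * f v)}"
    have "card ?St = cfun.dim ?E"
    proof (rule cfun.basis_card_eq_dim)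
      show "?St \<subseteq> ?E"
      proof
        fix b assume b: "b \<in> ?St"
        then have "b \<in> fs.Wsp" using SW by blast
        then have "\<forall>v. v \<notin> V \<longrightarrow> b v = 0" unfolding fs.Wsp_def by blast
        moreover have "graph_laplacian H b v = of_real t * b v" if "v \<in> V" for v
          using lap[OF that, of b] b evB[of b] by (auto simp: left_diff_distrib)
        ultimately show "b \<in> ?E" by (simp add: V_def)
      qed
      show "cfun.independent ?St"
        using cfun.independent_mono[OF fs.card_orthonormal(1)[OF finS SW on], of ?St] by auto
      show "?E \<subseteq> cfun.span ?St"
      proof
        fix f assume f: "f \<in> ?E"
        then have fW: "f \<in> fs.Wsp" unfolding fs.Wsp_def V_def[symmetric] by blast
        have Bf: "B f v = of_real (real N - t) * f v" for v
          using f lap[of v f] by (cases "v \<in> V") (auto simp: V_def left_diff_distrib algebra_simps fs.B_off)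
        \<comment> \<open>Eigenvectors for different eigenvalues are orthogonal, so the expansion of
          a Laplacian eigenfunction involves only the basis vectors of its own eigenvalue; these
          span the eigenspace.\<close>
        have z: "fs.ip f b = 0" if "b \<in> S" "real N - eg b \<noteq> t" for b
        proof -
          have "of_real (real N - t) * fs.ip f b = fs.ip (B f) b"
            unfolding Bf[abs_def] fs.ip_scale ..
          also have "\<dots> = of_real (eg b) * fs.ip f b"
            unfolding fs.ip_B evB[OF that(1)] fs.ip_scale_right by simp
          finally have "of_real (real N - t - eg b) * fs.ip f b = 0" by (simp add: left_diff_distrib)
          moreover have "real N - t - eg b \<noteq> 0" using that(2) by linarith
          ultimately show ?thesis by (metis mult_eq_0_iff of_real_eq_0_iff)
        qed
        have "f = (\<lambda>v. \<Sum>b\<in>S. fs.ip f b * b v)" by (rule basis[OF fW])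
        also have "\<dots> = (\<Sum>b\<in>?St. (\<lambda>v. fs.ip f b * b v))"
        proof
          fix v
          have "(\<Sum>b\<in>S. fs.ip f b * b v) = (\<Sum>b\<in>?St. fs.ip f b * b v)"
            by (rule sum.mono_neutral_right[OF finS]) (use z in auto)
          then show "(\<Sum>b\<in>S. fs.ip f b * b v) = (\<Sum>b\<in>?St. (\<lambda>v. fs.ip f b * b v)) v"
            by (simp add: sum_apply_fun)
        qed
        also have "\<dots> \<in> cfun.span ?St"
          by (intro cfun.span_sum cfun.span_scale[where c = "fs.ip f _"] cfun.span_base)
        finally show "f \<in> cfun.span ?St" .
      qed
    qed
    then show "laplacian_mult H t = card ?St" by (simp add: laplacian_mult_def)
  next
    fix k
    have "(\<Sum>v\<in>V. (B ^^ k) (\<delta> v) v) = of_real (\<Sum>v\<in>V. \<Sum>b\<in>S. eg b ^ k * (cmod (b v))\<^sup>2)"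
      by (simp add: diag)
    also have "(\<Sum>v\<in>V. \<Sum>b\<in>S. eg b ^ k * (cmod (b v))\<^sup>2) = (\<Sum>b\<in>S. eg b ^ k * (\<Sum>v\<in>V. (cmod (b v))\<^sup>2))"
      by (subst sum.swap) (simp add: sum_distrib_left)
    also have "\<dots> = (\<Sum>b\<in>S. eg b ^ k)"
    proof (rule sum.cong[OF refl])
      fix b assume "b \<in> S"
      then have "fs.ip b b = 1" using on[of b b] by simp
      then have "complex_of_real (\<Sum>v\<in>V. (cmod (b v))\<^sup>2) = 1" by (simp only: fs.ip_self)
      then show "eg b ^ k * (\<Sum>v\<in>V. (cmod (b v))\<^sup>2) = eg b ^ k" by (simp only: of_real_eq_1_iff mult_1_right)
    qed
    finally have 1: "(\<Sum>v\<in>V. (B ^^ k) (\<delta> v) v) = of_real (\<Sum>b\<in>S. eg b ^ k)" .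
    have "(\<Sum>v\<in>V. (B ^^ k) (\<delta> v) v) = (\<Sum>v\<in>V. \<Sum>w | w \<in> words d \<and> length w = k. \<delta> v (fold T w v))"
      by (simp add: Bpow N_def walk_pow_words)
    also have "\<dots> = (\<Sum>w | w \<in> words d \<and> length w = k. \<Sum>v\<in>V. \<delta> v (fold T w v))" by (rule sum.swap)
    also have "\<dots> = (\<Sum>w | w \<in> words d \<and> length w = k. of_nat (card {v \<in> V. fold T w v = v}))"
      by (rule sum.cong[OF refl]) (simp add: \<delta>_def sum.If_cases[OF fV] Int_def)
    finally have "complex_of_real (\<Sum>b\<in>S. eg b ^ k) = of_real (\<Sum>w | w \<in> words d \<and> length w = k. real (card {v \<in> V. fold T w v = v}))"
      unfolding 1 by simp
    then show "(\<Sum>b\<in>S. (real (ncols d) - (real N - eg b)) ^ k) =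
      (\<Sum>w | w \<in> words d \<and> length w = k. real (card {v \<in> verts H. fold T w v = v}))"
      unfolding of_real_eq_iff by (simp add: N_def V_def)
  qed
qed

end

text \<open>An inverse \<open>Q\<close> of \<open>S - z\<close> would send \<open>S b - z b\<close>,
  which vanishes on \<open>V\<close>, back to \<open>b\<close>. Being bounded, \<open>Q\<close>
  sends it to a function of norm zero, so \<open>b\<close> would vanish on \<open>V\<close>.\<close>

lemma eigenvalue_in_op_spectrum:
  assumes fin: "finite V" and ne: "\<exists>v\<in>V. b v \<noteq> 0"
    and eig: "\<And>v. v \<in> V \<Longrightarrow> S b v = z * b v"
  shows "z \<in> op_spectrum (count_space V) S"
  unfolding op_spectrum_def
proof (rule CollectI, rule notI)
  assume "\<exists>Q. bounded_op (count_space V) Q \<and>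
      op_eq (count_space V) (\<lambda>f. Q (\<lambda>p. S f p - z * f p)) (\<lambda>f. f) \<and>
      op_eq (count_space V) (\<lambda>f p. S (Q f) p - z * Q f p) (\<lambda>f. f)"
  then obtain Q where Q: "bounded_op (count_space V) Q"
    and inv: "op_eq (count_space V) (\<lambda>f. Q (\<lambda>p. S f p - z * f p)) (\<lambda>f. f)" by blast
  obtain C where C: "\<And>f. f \<in> L2 (count_space V) \<Longrightarrow> l2_norm (count_space V) (Q f) \<le> C * l2_norm (count_space V) f"
    using Q unfolding bounded_op_def bounded_op_by_def by blast
  note L = L2_finite[OF fin]
  let ?g = "\<lambda>p. S b p - z * b p"
  have "l2_norm (count_space V) ?g = 0"
    by (simp add: l2_norm_def lebesgue_integral_count_space_finite[OF fin] eig)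
  then have "l2_norm (count_space V) (Q ?g) = 0" using C[OF L, of ?g] l2_norm_nonneg[of "count_space V" "Q ?g"] by simp
  then have "AE p in count_space V. Q ?g p = 0" by (rule l2_norm_0_AE[OF L])
  then have "\<forall>v\<in>V. Q ?g v = 0" by (simp add: AE_count_space)
  moreover have "\<forall>v\<in>V. Q ?g v = b v" using inv L by (simp add: op_eq_def AE_count_space)
  ultimately show False using ne by simp
qed

text \<open>The density lives on the whole real line with counting measure but vanishes off the
  finite set of eigenvalues; regrouping by eigenvalue restores the sum over
  \<open>S\<close>.\<close>

lemma integral_multiplicity_measure:
  fixes g :: "real \<Rightarrow> real" and eg :: "'b \<Rightarrow> real"
  assumes S: "finite S"
  shows "(LINT t|point_measure UNIV (\<lambda>t. ennreal (real (card {b \<in> S. eg b = t}) / real n)). g t) = (\<Sum>b\<in>S. g (eg b)) / real n"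
proof -
  let ?m = "\<lambda>t. real (card {b \<in> S. eg b = t}) / real n"
  have "(LINT t|point_measure UNIV (\<lambda>t. ennreal (?m t)). g t) = (LINT t|count_space UNIV. ?m t *\<^sub>R g t)"
    unfolding point_measure_def by (rule integral_density) auto
  also have "\<dots> = (\<Sum>t\<in>eg ` S. ?m t * g t)"
  proof -
    have sub: "{t \<in> UNIV. ?m t *\<^sub>R g t \<noteq> 0} \<subseteq> eg ` S"
    proof
      fix t assume "t \<in> {t \<in> UNIV. ?m t *\<^sub>R g t \<noteq> 0}"
      then have "card {b \<in> S. eg b = t} \<noteq> 0" by simp
      then have "{b \<in> S. eg b = t} \<noteq> {}" by (metis card.empty)
      then show "t \<in> eg ` S" by auto
    qed
    then have "(LINT t|count_space UNIV. ?m t *\<^sub>R g t) = (\<Sum>t | t \<in> UNIV \<and> ?m t *\<^sub>R g t \<noteq> 0. ?m t *\<^sub>R g t)"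
      by (intro lebesgue_integral_count_space_finite_support finite_subset[OF _ finite_imageI[OF S]])
    also have "\<dots> = (\<Sum>t\<in>eg ` S. ?m t * g t)"
      using S sub by (intro sum.mono_neutral_cong_left) auto
    finally show ?thesis .
  qed
  also have "\<dots> = (\<Sum>t\<in>eg ` S. \<Sum>b\<in>{b \<in> S. eg b = t}. g (eg b)) / real n"
    by (simp add: sum_divide_distrib)
  also have "(\<Sum>t\<in>eg ` S. \<Sum>b\<in>{b \<in> S. eg b = t}. g (eg b)) = (\<Sum>b\<in>S. g (eg b))"
    by (rule sum.image_gen[OF S, symmetric])
  finally show ?thesis .
qed

section \<open>Convergence of the spectral measures\<close>

definition word_table :: "nat \<Rightarrow> nat \<Rightarrow> (nat \<Rightarrow> 'v \<Rightarrow> 'v) \<Rightarrow> 'v \<Rightarrow> (nat list \<times> nat list) set" where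
  "word_table d r T v = {(w, w'). w \<in> words d \<and> w' \<in> words d \<and> length w \<le> r \<and> length w' \<le> r \<and>
     fold T w v = fold T w' v}"

lemma same_table_iff: "same_table d r T v T' v' \<longleftrightarrow> word_table d r T v = word_table d r T' v'"
  unfolding same_table_def word_table_def by blast

definition all_tables :: "nat \<Rightarrow> nat \<Rightarrow> (nat list \<times> nat list) set set" where
  "all_tables d r = Pow ({w \<in> words d. length w \<le> r} \<times> {w \<in> words d. length w \<le> r})"

lemma finite_all_tables: "finite (all_tables d r)"
  by (simp add: all_tables_def finite_words_le)

lemma word_table_in: "word_table d r T v \<in> all_tables d r"
  by (auto simp: word_table_def all_tables_def)

text \<open>Each element is sent to a choice made from its class predicate. Equivalent elements have
  the same predicate and hence the same choice, which makes the chosen elements pairwise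
  inequivalent.\<close>

lemma finite_representatives:
  fixes iso :: "'c \<Rightarrow> 'c \<Rightarrow> bool"
  assumes fin: "finite A0"
    and refl: "\<And>a. a \<in> A0 \<Longrightarrow> iso a a"
    and sym: "\<And>a b. a \<in> A0 \<Longrightarrow> b \<in> A0 \<Longrightarrow> iso a b \<Longrightarrow> iso b a"
    and trans: "\<And>a b c. iso a b \<Longrightarrow> iso b c \<Longrightarrow> iso a c"
  obtains A1 where "finite A1" "A1 \<subseteq> A0" "\<And>a. a \<in> A0 \<Longrightarrow> \<exists>b\<in>A1. iso a b"
    "\<And>a b. a \<in> A1 \<Longrightarrow> b \<in> A1 \<Longrightarrow> iso a b \<Longrightarrow> a = b"
proof -
  define c where "c a = (SOME b. b \<in> A0 \<and> iso a b)" for a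
  have c: "c a \<in> A0 \<and> iso a (c a)" if "a \<in> A0" for a
    unfolding c_def by (rule someI[of _ a]) (use that refl in auto)
  show ?thesis
  proof (rule that[of "c ` A0"])
    fix x y assume "x \<in> c ` A0" "y \<in> c ` A0" and xy: "iso x y"
    then obtain a b where a: "a \<in> A0" "x = c a" and b: "b \<in> A0" "y = c b" by auto
    have "iso a b"
    proof -
      have "iso a (c b)" using c[OF a(1)] xy a b trans by blast
      moreover have "iso (c b) b" using sym c b by blast
      ultimately show ?thesis by (rule trans)
    qed
    then have "(\<lambda>z. z \<in> A0 \<and> iso a z) = (\<lambda>z. z \<in> A0 \<and> iso b z)"
      using sym[OF a(1) b(1)] trans by blast
    then show "x = y" by (simp add: a b c_def)
  qed (use fin c in auto)
qed

context graphing_loc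
begin

abbreviation "leaf \<equiv> leafgraph d \<G>"

text \<open>Prescribing a table means deciding finitely many equations between continuous maps, so
  the set is a finite intersection of closed sets and complements of closed sets.\<close>

lemma table_class_borel: "{x. word_table d r T x = t} \<in> sets borel"
proof -
  let ?Ws = "{w \<in> words d. length w \<le> r}"
  define Eq where "Eq p = {x. fold T (fst p) x = fold T (snd p) x}" for p
  have Eq: "Eq p \<in> sets borel" if "p \<in> ?Ws \<times> ?Ws" for p
    unfolding Eq_def using that by (intro borel_closed closed_Collect_eq fold_T_cont) auto
  have wt: "word_table d r T x = {p \<in> ?Ws \<times> ?Ws. x \<in> Eq p}" for x
    by (auto simp: word_table_def Eq_def)
  have ne: "?Ws \<times> ?Ws \<noteq> {}"
  proof -
    have "([], []) \<in> ?Ws \<times> ?Ws" by simp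
    then show ?thesis by blast
  qed
  show ?thesis
  proof (cases "t \<subseteq> ?Ws \<times> ?Ws")
    case True
    have "{x. word_table d r T x = t} = (\<Inter>p\<in>?Ws \<times> ?Ws. if p \<in> t then Eq p else - Eq p)"
    proof (rule set_eqI)
      fix x
      have "word_table d r T x = t \<longleftrightarrow> (\<forall>p\<in>?Ws \<times> ?Ws. x \<in> Eq p \<longleftrightarrow> p \<in> t)"
        unfolding wt using True by blast
      also have "\<dots> \<longleftrightarrow> (\<forall>p\<in>?Ws \<times> ?Ws. x \<in> (if p \<in> t then Eq p else - Eq p))"
        by (intro ball_cong refl) simp
      finally show "x \<in> {x. word_table d r T x = t} \<longleftrightarrow> x \<in> (\<Inter>p\<in>?Ws \<times> ?Ws. if p \<in> t then Eq p else - Eq p)"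
        by (simp only: mem_Collect_eq INT_iff)
    qed
    also have "\<dots> \<in> sets borel"
      by (rule sets.finite_INT[OF _ ne]) (use Eq in \<open>auto simp: finite_words_le intro!: borel_comp\<close>)
    finally show ?thesis .
  next
    case False
    then have "{x. word_table d r T x = t} = {}" unfolding wt by blast
    then show ?thesis by simp
  qed
qed

text \<open>The type of the \<open>r\<close>-ball depends only on the table of radius
  \<open>Suc r\<close>, of which there are finitely many; the set is a finite union of table
  classes.\<close>

lemma iso_class_borel: "{x. rooted_iso (nbhd (leaf x) r x) A} \<in> sets borel"
proof -
  let ?I = "\<lambda>x. rooted_iso (nbhd (leaf x) r x) A"
  let ?t = "word_table d (Suc r) T"
  have tr: "?I y" if "?I x" "?t x = ?t y" for x y
  proof (rule rooted_iso_trans[OF _ that(1)])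
    show "rooted_iso (nbhd (leaf y) r y) (nbhd (leaf x) r x)"
      by (rule same_table_imp_rooted_iso[OF involution_graph_leafgraph involution_graph_leafgraph])
         (use that(2) in \<open>auto simp: same_table_iff\<close>)
  qed
  have "{x. ?I x} = (\<Union>t\<in>{t \<in> all_tables d (Suc r). \<exists>x. ?I x \<and> ?t x = t}. {x. ?t x = t})"
    using tr by (auto simp: word_table_in)
  also have "\<dots> \<in> sets borel"
    by (intro sets.finite_UN table_class_borel finite_subset[OF _ finite_all_tables[of d "Suc r"]]) auto
  finally show ?thesis .
qed

end

locale converging_graphs = graphing_loc d \<G>
  for d and \<G> :: "'a::{metric_space, second_countable_topology} graphing" +
  fixes G :: "nat \<Rightarrow> 'v cgraph"
  assumes G: "\<And>i. finite (verts (G i)) \<and> coloured_dgraph d (G i) \<and> gconnected (G i)"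
    and conv: "weakly_converges d G \<G>"
begin

abbreviation "st i \<equiv> colour_step (G i)"

lemma G_inv: "involution_graph d (G i) (st i)"
  using G by (intro involution_graph_colour_step) blast

lemma finite_G: "finite (verts (G i))"
  using G by blast

lemma card_G_pos: "0 < card (verts (G i))"
  using G[of i] by (auto simp: gconnected_def card_gt_0_iff)

text \<open>Weak convergence treats one class at a time, whereas an event is to be summed over all
  classes; so a finite system of representatives is needed that serves all graphs and all leaves at
  once. The table of radius \<open>Suc r\<close> determines the ball and there are finitely many
  tables: one representative is picked for each table that occurs, and isomorphic duplicates are
  then removed.\<close>

lemma ball_representatives:
  obtains \<A> :: "nat rooted set" where "finite \<A>" "\<And>A. A \<in> \<A> \<Longrightarrow> rooted_ball r d A"
    "\<And>i v. v \<in> verts (G i) \<Longrightarrow> \<exists>!A. A \<in> \<A> \<and> rooted_iso (nbhd (G i) r v) A"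
    "\<And>x. \<exists>!A. A \<in> \<A> \<and> rooted_iso (nbhd (leaf x) r x) A"
proof -
  define P where "P t A \<longleftrightarrow> rooted_ball r d A \<and>
     ((\<exists>i v. v \<in> verts (G i) \<and> word_table d (Suc r) (st i) v = t \<and> rooted_iso (nbhd (G i) r v) A) \<or>
      (\<exists>x. word_table d (Suc r) T x = t \<and> rooted_iso (nbhd (leaf x) r x) A))" for t and A :: "nat rooted"
  define rep where "rep t = (SOME A. P t A)" for t
  have PG: "\<exists>A. P (word_table d (Suc r) (st i) v) A" if v: "v \<in> verts (G i)" for i v
    using rooted_ball_nat_copy[OF involution_graph.rooted_ball_nbhd[OF G_inv v]] v unfolding P_def by metis
  have PX: "\<exists>A. P (word_table d (Suc r) T x) A" for x
    using rooted_ball_nat_copy[OF involution_graph.rooted_ball_nbhd[OF involution_graph_leafgraph], of x x r] unfolding P_def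
    by (metis root_orb verts_leafgraph)
  have isoG: "rooted_iso (nbhd (G i) r v) A" if v: "v \<in> verts (G i)" and A: "P (word_table d (Suc r) (st i) v) A" for i v A
  proof -
    from A consider i' v' where "v' \<in> verts (G i')" "word_table d (Suc r) (st i') v' = word_table d (Suc r) (st i) v"
        "rooted_iso (nbhd (G i') r v') A"
      | x where "word_table d (Suc r) T x = word_table d (Suc r) (st i) v" "rooted_iso (nbhd (leaf x) r x) A"
      unfolding P_def by blast
    then show ?thesis
    proof cases
      case 1
      show ?thesis
        by (rule rooted_iso_trans[OF same_table_imp_rooted_iso[OF G_inv G_inv v 1(1)] 1(3)]) (simp add: same_table_iff 1)
    next
      case 2
      show ?thesis
        by (rule rooted_iso_trans[OF same_table_imp_rooted_iso[OF G_inv involution_graph_leafgraph v] 2(2)])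
           (simp_all add: same_table_iff 2)
    qed
  qed
  have isoX: "rooted_iso (nbhd (leaf x) r x) A" if A: "P (word_table d (Suc r) T x) A" for x A
  proof -
    from A consider i' v' where "v' \<in> verts (G i')" "word_table d (Suc r) (st i') v' = word_table d (Suc r) T x"
        "rooted_iso (nbhd (G i') r v') A"
      | y where "word_table d (Suc r) T y = word_table d (Suc r) T x" "rooted_iso (nbhd (leaf y) r y) A"
      unfolding P_def by blast
    then show ?thesis
    proof cases
      case 1
      show ?thesis
        by (rule rooted_iso_trans[OF same_table_imp_rooted_iso[OF involution_graph_leafgraph G_inv _ 1(1)] 1(3)])
           (simp_all add: same_table_iff 1)
    next
      case 2
      show ?thesis
        by (rule rooted_iso_trans[OF same_table_imp_rooted_iso[OF involution_graph_leafgraph involution_graph_leafgraph] 2(2)])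
           (simp_all add: same_table_iff 2)
    qed
  qed
  define A0 where "A0 = rep ` {t \<in> all_tables d (Suc r). \<exists>A. P t A}"
  have fin: "finite A0" unfolding A0_def by (intro finite_imageI finite_subset[OF _ finite_all_tables[of d "Suc r"]]) auto
  have rep: "P t (rep t)" if "\<exists>A. P t A" for t using someI_ex[OF that] by (simp add: rep_def)
  have A0ball: "rooted_ball r d A" if "A \<in> A0" for A
  proof -
    from that obtain t where t: "\<exists>A. P t A" "A = rep t" unfolding A0_def by blast
    then show ?thesis using rep[OF t(1)] unfolding P_def by simp
  qed
  have refl: "rooted_iso A A" for A :: "nat rooted" unfolding rooted_iso_def by (rule exI[of _ id]) auto
  obtain \<A> where A: "finite \<A>" "\<A> \<subseteq> A0" "\<And>a. a \<in> A0 \<Longrightarrow> \<exists>b\<in>\<A>. rooted_iso a b"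
    "\<And>a b. a \<in> \<A> \<Longrightarrow> b \<in> \<A> \<Longrightarrow> rooted_iso a b \<Longrightarrow> a = b"
  proof (rule finite_representatives[OF fin, of rooted_iso])
    show "rooted_iso b a" if "a \<in> A0" "b \<in> A0" "rooted_iso a b" for a b
      using rooted_iso_sym[OF that(3)] A0ball[OF that(1)] by (simp add: rooted_ball_def)
    show "rooted_iso a c" if "rooted_iso a b" "rooted_iso b c" for a b c :: "nat rooted"
      using that by (rule rooted_iso_trans)
  qed (use refl in auto)
  show ?thesis
  proof (rule that[of \<A>])
    show "finite \<A>" by fact
    show "rooted_ball r d a" if "a \<in> \<A>" for a using A0ball A(2) that by blast
    fix i v assume v: "v \<in> verts (G i)"
    let ?t = "word_table d (Suc r) (st i) v"
    have "rep ?t \<in> A0" unfolding A0_def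
      by (rule imageI, rule CollectI, rule conjI, rule word_table_in, rule PG[OF v])
    then obtain a where a: "a \<in> \<A>" "rooted_iso (rep ?t) a" using A(3) by blast
    have "rooted_iso (nbhd (G i) r v) a" by (rule rooted_iso_trans[OF isoG[OF v rep[OF PG[OF v]]] a(2)])
    moreover have "a = b" if "b \<in> \<A>" "rooted_iso (nbhd (G i) r v) b" for b
    proof (rule A(4)[OF a(1) that(1)])
      have "rooted_iso a (nbhd (G i) r v)"
        using rooted_iso_sym[OF \<open>rooted_iso (nbhd (G i) r v) a\<close>] involution_graph.rooted_ball_nbhd[OF G_inv v, of r]
        by (simp add: rooted_ball_def)
      then show "rooted_iso a b" using that(2) by (rule rooted_iso_trans)
    qed
    ultimately show "\<exists>!A. A \<in> \<A> \<and> rooted_iso (nbhd (G i) r v) A" using a(1) by blast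
  next
    fix x
    let ?t = "word_table d (Suc r) T x"
    have "rep ?t \<in> A0" unfolding A0_def
      by (rule imageI, rule CollectI, rule conjI, rule word_table_in, rule PX)
    then obtain a where a: "a \<in> \<A>" "rooted_iso (rep ?t) a" using A(3) by blast
    have "rooted_iso (nbhd (leaf x) r x) a" by (rule rooted_iso_trans[OF isoX[OF rep[OF PX]] a(2)])
    moreover have "a = b" if "b \<in> \<A>" "rooted_iso (nbhd (leaf x) r x) b" for b
    proof (rule A(4)[OF a(1) that(1)])
      have "rooted_iso a (nbhd (leaf x) r x)"
        using rooted_iso_sym[OF \<open>rooted_iso (nbhd (leaf x) r x) a\<close>]
          involution_graph.rooted_ball_nbhd[OF involution_graph_leafgraph, of x x r]
        by (simp add: rooted_ball_def)
      then show "rooted_iso a b" using that(2) by (rule rooted_iso_trans)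
    qed
    ultimately show "\<exists>!A. A \<in> \<A> \<and> rooted_iso (nbhd (leaf x) r x) A" using a(1) by blast
  qed
qed

text \<open>The ball of radius \<open>r\<close> around a root decides whether \<open>w\<close> fixes
  it. Hence the frequencies on both sides are sums of class frequencies over the same finite set
  \<open>AA\<close>, and the convergence is termwise.\<close>

lemma word_frequency_tendsto:
  assumes w: "w \<in> words d"
  shows "(\<lambda>i. real (card {v \<in> verts (G i). fold (st i) w v = v}) / real (card (verts (G i))))
    \<longlonglongrightarrow> measure X {x. fold T w x = x}"
proof -
  \<comment> \<open>The maximum covers the empty word: weak convergence is stated for radii at least
    one.\<close>
  define r where "r = max 1 (length w)"
  have r: "r \<ge> 1" "length w \<le> r" by (auto simp: r_def)
  obtain \<A> :: "nat rooted set" where A: "finite \<A>" "\<And>A. A \<in> \<A> \<Longrightarrow> rooted_ball r d A"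
    "\<And>i v. v \<in> verts (G i) \<Longrightarrow> \<exists>!A. A \<in> \<A> \<and> rooted_iso (nbhd (G i) r v) A"
    "\<And>x. \<exists>!A. A \<in> \<A> \<and> rooted_iso (nbhd (leaf x) r x) A"
    using ball_representatives[of r] by blast
  \<comment> \<open>A class counts as fixed when \<open>w\<close> fixes some root of that class in
    some graph or leaf; \<open>fixG\<close> and \<open>fixX\<close> show that \<open>w\<close> then
    fixes all its roots, in both worlds.\<close>
  define QG where "QG A \<longleftrightarrow> (\<exists>i v. v \<in> verts (G i) \<and> rooted_iso (nbhd (G i) r v) A \<and> fold (st i) w v = v)" for A :: "nat rooted"
  define QX where "QX A \<longleftrightarrow> (\<exists>x. rooted_iso (nbhd (leaf x) r x) A \<and> fold T w x = x)" for A :: "nat rooted"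
  define AA where "AA = {A \<in> \<A>. QG A \<or> QX A}"
  have finAA: "finite AA" using A(1) by (simp add: AA_def)
  have symG: "rooted_iso A (nbhd (G i) r v)" if "v \<in> verts (G i)" "rooted_iso (nbhd (G i) r v) A" for i v and A :: "nat rooted"
    using rooted_iso_sym[OF that(2)] involution_graph.rooted_ball_nbhd[OF G_inv that(1), of r] by (simp add: rooted_ball_def)
  have symX: "rooted_iso A (nbhd (leaf x) r x)" if "rooted_iso (nbhd (leaf x) r x) A" for x and A :: "nat rooted"
    using rooted_iso_sym[OF that] involution_graph.rooted_ball_nbhd[OF involution_graph_leafgraph, of x x r] by (simp add: rooted_ball_def)
  have fixG: "fold (st i) w v = v" if v: "v \<in> verts (G i)" and iso: "rooted_iso (nbhd (G i) r v) A" and Q: "QG A \<or> QX A" for i v A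
    using Q
  proof
    assume "QG A"
    then obtain j u where u: "u \<in> verts (G j)" "rooted_iso (nbhd (G j) r u) A" "fold (st j) w u = u" by (auto simp: QG_def)
    from rooted_iso_imp_word_fixed_iff[OF G_inv G_inv v u(1) rooted_iso_trans[OF iso symG[OF u(1,2)]] w r(2)] u(3)
    show ?thesis by simp
  next
    assume "QX A"
    then obtain x where u: "rooted_iso (nbhd (leaf x) r x) A" "fold T w x = x" by (auto simp: QX_def)
    from rooted_iso_imp_word_fixed_iff[OF G_inv involution_graph_leafgraph v _ rooted_iso_trans[OF iso symX[OF u(1)]] w r(2)] u(2)
    show ?thesis by simp
  qed
  have fixX: "fold T w x = x" if iso: "rooted_iso (nbhd (leaf x) r x) A" and Q: "QG A \<or> QX A" for x A
    using Q
  proof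
    assume "QG A"
    then obtain j u where u: "u \<in> verts (G j)" "rooted_iso (nbhd (G j) r u) A" "fold (st j) w u = u" by (auto simp: QG_def)
    from rooted_iso_imp_word_fixed_iff[OF involution_graph_leafgraph G_inv _ u(1) rooted_iso_trans[OF iso symG[OF u(1,2)]] w r(2)] u(3)
    show ?thesis by simp
  next
    assume "QX A"
    then obtain y where u: "rooted_iso (nbhd (leaf y) r y) A" "fold T w y = y" by (auto simp: QX_def)
    from rooted_iso_imp_word_fixed_iff[OF involution_graph_leafgraph involution_graph_leafgraph _ _ rooted_iso_trans[OF iso symX[OF u(1)]] w r(2)] u(2)
    show ?thesis by simp
  qed
  define VA where "VA i A = {v \<in> verts (G i). rooted_iso (nbhd (G i) r v) A}" for i and A :: "nat rooted"
  define XA where "XA A = {x. rooted_iso (nbhd (leaf x) r x) A}" for A :: "nat rooted"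
  have uniqG: "A = A'" if "A \<in> \<A>" "A' \<in> \<A>" "v \<in> VA i A" "v \<in> VA i A'" for i A A' v
    using A(3)[of v i] that by (auto simp: VA_def)
  have uniqX: "A = A'" if "A \<in> \<A>" "A' \<in> \<A>" "x \<in> XA A" "x \<in> XA A'" for A A' x
    using A(4)[of x] that by (auto simp: XA_def)
  have setG: "{v \<in> verts (G i). fold (st i) w v = v} = (\<Union>A\<in>AA. VA i A)" for i
  proof (intro set_eqI iffI)
    fix v assume v: "v \<in> {v \<in> verts (G i). fold (st i) w v = v}"
    then obtain B where "B \<in> \<A>" "rooted_iso (nbhd (G i) r v) B" using A(3)[of v i] by blast
    moreover from this v have "QG B" unfolding QG_def by blast
    ultimately show "v \<in> (\<Union>A\<in>AA. VA i A)" using v by (intro UN_I[of B]) (simp_all add: AA_def VA_def)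
  next
    fix v assume "v \<in> (\<Union>A\<in>AA. VA i A)"
    then show "v \<in> {v \<in> verts (G i). fold (st i) w v = v}" using fixG by (auto simp: AA_def VA_def)
  qed
  have setX: "{x. fold T w x = x} = (\<Union>A\<in>AA. XA A)"
  proof (intro set_eqI iffI)
    fix x assume x: "x \<in> {x. fold T w x = x}"
    then obtain B where "B \<in> \<A>" "rooted_iso (nbhd (leaf x) r x) B" using A(4)[of x] by blast
    moreover from this x have "QX B" unfolding QX_def by blast
    ultimately show "x \<in> (\<Union>A\<in>AA. XA A)" using x by (intro UN_I[of B]) (simp_all add: AA_def XA_def)
  next
    fix x assume "x \<in> (\<Union>A\<in>AA. XA A)"
    then show "x \<in> {x. fold T w x = x}" using fixX by (auto simp: AA_def XA_def)
  qed
  have "card {v \<in> verts (G i). fold (st i) w v = v} = (\<Sum>A\<in>AA. card (VA i A))" for i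
    unfolding setG
  proof (rule card_UN_disjoint[OF finAA])
    show "\<forall>A\<in>AA. finite (VA i A)" using finite_G by (auto simp: VA_def)
    show "\<forall>A\<in>AA. \<forall>A'\<in>AA. A \<noteq> A' \<longrightarrow> VA i A \<inter> VA i A' = {}" using uniqG unfolding AA_def by blast
  qed
  then have fr: "real (card {v \<in> verts (G i). fold (st i) w v = v}) / real (card (verts (G i))) = (\<Sum>A\<in>AA. ball_freq (G i) r A)" for i
    by (simp add: ball_freq_def VA_def sum_divide_distrib)
  have "measure X {x. fold T w x = x} = (\<Sum>A\<in>AA. measure X (XA A))"
    unfolding setX
  proof (rule finite_measure_finite_Union[OF finAA])
    show "XA ` AA \<subseteq> events" using iso_class_borel by (auto simp: XA_def sets_X)
    show "disjoint_family_on XA AA" using uniqX unfolding AA_def disjoint_family_on_def by blast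
  qed
  also have "\<dots> = (\<Sum>A\<in>AA. graphing_freq d \<G> r A)"
    by (simp add: graphing_freq_def XA_def)
  finally have mu: "measure X {x. fold T w x = x} = \<dots>" .
  show ?thesis unfolding fr mu
    by (intro tendsto_sum) (use conv A(2) r(1) in \<open>auto simp: weakly_converges_def AA_def\<close>)
qed

end

section \<open>Convergence of the moments and of the measures\<close>

locale converging_spectral = converging_graphs d \<G> G + spectral_graphing d \<G> E Tr
  for d and \<G> :: "'a::{metric_space, second_countable_topology} graphing"
    and G :: "nat \<Rightarrow> 'v cgraph" and E Tr +
  fixes l :: real
  assumes spectrum: "\<And>i. op_spectrum (count_space (verts (G i))) (graph_laplacian (G i)) \<subseteq> of_real ` {0..l}"
begin

lemma walk_trace: "(LINT t|m. (real N - t) ^ k) = (\<Sum>w | w \<in> words d \<and> length w = k. measure X {x. fold T w x = x})"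
proof -
  have k: "poly_kernel (monom 1 k) (x, x) = (\<Sum>w | w \<in> words d \<and> length w = k. of_real (indicator {x. fold T w x = x} x))" for x
  proof -
    have "poly_kernel (monom 1 k) (x, x) = (walk N R2 ^^ k) diag_ind (x, x)"
    proof -
      have "poly_op N R2 (monom 1 k) diag_ind (x, x) = (\<Sum>i\<le>k. of_real (coeff (monom 1 k) i) * (walk N R2 ^^ i) diag_ind (x, x))"
        by (rule poly_op_extend) (rule degree_monom_le)
      then show ?thesis by (simp add: poly_kernel_def if_distrib[of "\<lambda>x. of_real x * _"] cong: if_cong)
    qed
    also have "\<dots> = (\<Sum>w | w \<in> words d \<and> length w = k. diag_ind (x, fold T w x))"
      by (simp add: walk_pow_R2 walk_pow_words)
    also have "\<dots> = (\<Sum>w | w \<in> words d \<and> length w = k. of_real (indicator {x. fold T w x = x} x))"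
      by (rule sum.cong) (auto simp: diag_ind_def indicator_def)
    finally show ?thesis .
  qed
  have F: "{x. fold T w x = x} \<in> events" if "w \<in> words d" for w
    unfolding sets_X by (intro borel_closed closed_Collect_eq fold_T_cont that continuous_on_id)
  have i: "integrable X (\<lambda>x. complex_of_real (indicator {x. fold T w x = x} x))" if "w \<in> words d" for w
    using F[OF that] by (intro integrable_of_real integrable_real_indicator) (auto simp: less_top[symmetric])
  have "(LINT t|m. (real N - t) ^ k) = Re (LINT x|X. poly_kernel (monom 1 k) (x, x))"
    using m_moment[of "monom 1 k"] by (simp add: poly_monom)
  also have "(LINT x|X. poly_kernel (monom 1 k) (x, x)) =
      (\<Sum>w | w \<in> words d \<and> length w = k. LINT x|X. complex_of_real (indicator {x. fold T w x = x} x))"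
    unfolding k by (rule Bochner_Integration.integral_sum) (use i in auto)
  also have "\<dots> = of_real (\<Sum>w | w \<in> words d \<and> length w = k. measure X {x. fold T w x = x})"
    using F by (simp add: integral_complex_of_real)
  finally show ?thesis by simp
qed

lemma eigenvalue_averages:
  obtains S :: "nat \<Rightarrow> ('v \<Rightarrow> complex) set" and eg :: "nat \<Rightarrow> ('v \<Rightarrow> complex) \<Rightarrow> real"
  where "\<And>i. finite (S i)" "\<And>i. card (S i) = card (verts (G i))"
    "\<And>i b. b \<in> S i \<Longrightarrow> 0 \<le> eg i b \<and> eg i b \<le> l"
    "\<And>i f. (LINT t:{0..l}|graph_spectral_measure (G i). f t) = (\<Sum>b\<in>S i. f (eg i b)) / real (card (verts (G i)))"
    "\<And>k. (\<lambda>i. (\<Sum>b\<in>S i. (real N - eg i b) ^ k) / real (card (verts (G i)))) \<longlonglongrightarrow> (LINT t|m. (real N - t) ^ k)"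
proof -
  define Q where "Q i S eg \<longleftrightarrow> finite S \<and> (\<forall>b\<in>S. \<exists>v\<in>verts (G i). b v \<noteq> 0) \<and>
      (\<forall>b\<in>S. \<forall>v\<in>verts (G i). graph_laplacian (G i) b v = of_real (eg b) * b v) \<and>
      (\<forall>t. laplacian_mult (G i) t = card {b \<in> S. eg b = t}) \<and>
      (\<forall>k. (\<Sum>b\<in>S. (real N - eg b) ^ k) =
        (\<Sum>w | w \<in> words d \<and> length w = k. real (card {v \<in> verts (G i). fold (st i) w v = v})))"
    for i :: nat and S :: "('v \<Rightarrow> complex) set" and eg
  have "\<exists>S eg. Q i S eg" for i
  proof (rule involution_graph.laplacian_spectrum[OF G_inv finite_G, of i])
    fix S eg
    assume "finite S" "\<And>b. b \<in> S \<Longrightarrow> \<exists>v\<in>verts (G i). b v \<noteq> 0"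
      "\<And>b v. b \<in> S \<Longrightarrow> v \<in> verts (G i) \<Longrightarrow> graph_laplacian (G i) b v = of_real (eg b) * b v"
      "\<And>t. laplacian_mult (G i) t = card {b \<in> S. eg b = t}"
      "\<And>k. (\<Sum>b\<in>S. (real N - eg b) ^ k) =
        (\<Sum>w | w \<in> words d \<and> length w = k. real (card {v \<in> verts (G i). fold (st i) w v = v}))"
    then have "Q i S eg" unfolding Q_def by (intro conjI ballI allI)
    then show ?thesis by blast
  qed
  then obtain S eg where SQ: "\<And>i. Q i (S i) (eg i)" by metis
  have S: "\<And>i. finite (S i)" "\<And>i b. b \<in> S i \<Longrightarrow> \<exists>v\<in>verts (G i). b v \<noteq> 0"
      "\<And>i b v. b \<in> S i \<Longrightarrow> v \<in> verts (G i) \<Longrightarrow> graph_laplacian (G i) b v = of_real (eg i b) * b v"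
      "\<And>i t. laplacian_mult (G i) t = card {b \<in> S i. eg i b = t}"
      "\<And>i k. (\<Sum>b\<in>S i. (real N - eg i b) ^ k) =
        (\<Sum>w | w \<in> words d \<and> length w = k. real (card {v \<in> verts (G i). fold (st i) w v = v}))"
    using SQ unfolding Q_def by simp_all
  have rng: "0 \<le> eg i b \<and> eg i b \<le> l" if b: "b \<in> S i" for i b
  proof -
    have "complex_of_real (eg i b) \<in> op_spectrum (count_space (verts (G i))) (graph_laplacian (G i))"
      by (rule eigenvalue_in_op_spectrum[where b = b and V = "verts (G i)", OF finite_G S(2)[OF b]])
         (rule S(3)[OF b])
    then have "complex_of_real (eg i b) \<in> of_real ` {0..l}" using spectrum by blast
    then show ?thesis by auto
  qed
  show ?thesis
  proof (rule that[of S eg])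
    show "finite (S i)" for i by (rule S(1))
    show "0 \<le> eg i b \<and> eg i b \<le> l" if "b \<in> S i" for i b using rng[OF that] .
    \<comment> \<open>The power sum of order zero counts the eigenvalues, and the empty word, the
      only one of length zero, fixes every vertex.\<close>
    have "{w \<in> words d. length w = 0} = {[]}" by auto
    then show "card (S i) = card (verts (G i))" for i using S(5)[of i 0] by simp
    show "(LINT t:{0..l}|graph_spectral_measure (G i). f t) = (\<Sum>b\<in>S i. f (eg i b)) / real (card (verts (G i)))" for i f
    proof -
      have "(LINT t:{0..l}|graph_spectral_measure (G i). f t) = (\<Sum>b\<in>S i. indicator {0..l} (eg i b) * f (eg i b)) / real (card (verts (G i)))"
        unfolding set_lebesgue_integral_def graph_spectral_measure_def S(4) real_scaleR_def
        by (rule integral_multiplicity_measure[OF S(1)])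
      also have "(\<Sum>b\<in>S i. indicator {0..l} (eg i b) * f (eg i b)) = (\<Sum>b\<in>S i. f (eg i b))"
        by (rule sum.cong) (use rng in auto)
      finally show ?thesis .
    qed
    fix k
    show "(\<lambda>i. (\<Sum>b\<in>S i. (real N - eg i b) ^ k) / real (card (verts (G i)))) \<longlonglongrightarrow> (LINT t|m. (real N - t) ^ k)"
      unfolding S(5) walk_trace sum_divide_distrib by (intro tendsto_sum word_frequency_tendsto) auto
  qed
qed

theorem spectral_measures_converge:
  "converge_weakly_on l (\<lambda>i. graph_spectral_measure (G i)) (KNS_measure Tr E)"
proof -
  interpret m: finite_borel_measure m by (rule m_finite_borel)
  have m1: "measure m UNIV = 1" by (simp add: spec.measure_\<mu>_UNIV[OF diag_ind_L2] l2_norm_diag_ind)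
  obtain S :: "nat \<Rightarrow> ('v \<Rightarrow> complex) set" and eg where fS: "\<And>i. finite (S i)" and cS: "\<And>i. card (S i) = card (verts (G i))"
    and rng: "\<And>i b. b \<in> S i \<Longrightarrow> 0 \<le> eg i b \<and> eg i b \<le> l"
    and int: "\<And>i f. (LINT t:{0..l}|graph_spectral_measure (G i). f t) = (\<Sum>b\<in>S i. f (eg i b)) / real (card (verts (G i)))"
    and mom: "\<And>k. (\<lambda>i. (\<Sum>b\<in>S i. (real N - eg i b) ^ k) / real (card (verts (G i)))) \<longlonglongrightarrow> (LINT t|m. (real N - t) ^ k)"
  proof (rule eigenvalue_averages, goal_cases)
    case (1 S eg)
    show ?case by (rule 1(1)[OF 1(2-6)])
  qed
  define avg where "avg i f = (\<Sum>b\<in>S i. f (eg i b)) / real (card (verts (G i)))" for i and f :: "real \<Rightarrow> real"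
  \<comment> \<open>\<open>[0, L]\<close> contains all eigenvalues and carries \<open>m\<close>, so
    one polynomial approximation serves both sides.\<close>
  define L where "L = max (2 * real N) l"
  have supp: "AE t in m. t \<in> {0..L}" using m_support by eventually_elim (auto simp: L_def)
  have l0: "0 \<le> l"
  proof -
    have "S 0 \<noteq> {}" using cS[of 0] card_G_pos[of 0] by auto
    then show ?thesis using rng[of _ 0] by fastforce
  qed
  have bint: "integrable m f" if f: "continuous_on UNIV f" for f :: "real \<Rightarrow> real"
  proof -
    have [measurable]: "f \<in> borel_measurable borel" by (rule borel_measurable_continuous_onI[OF f])
    have "compact (f ` {0..L})" by (intro compact_continuous_image continuous_on_subset[OF f]) auto
    then obtain C where "\<forall>y\<in>f ` {0..L}. norm y \<le> C" using compact_imp_bounded bounded_iff by metis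
    then have C: "norm (f t) \<le> C" if "t \<in> {0..L}" for t using that by blast
    have "AE t in m. norm (f t) \<le> C" using supp by eventually_elim (rule C)
    then show ?thesis by (rule m.integrable_const_bound) (simp add: measurable_cong_sets[OF spec.sets_\<mu> refl])
  qed
  have poly_conv: "(\<lambda>i. avg i (poly q)) \<longlonglongrightarrow> (LINT t|m. poly q t)" for q
  proof -
    \<comment> \<open>The moments are known in the variable \<open>N - t\<close> of the walk
      operator, so \<open>q\<close> is re-expanded in it.\<close>
    define p where "p = pcompose q [:real N, -1:]"
    have pq: "poly q t = (\<Sum>k\<le>degree p. coeff p k * (real N - t) ^ k)" for t
      by (simp add: poly_altdef[symmetric] p_def poly_pcompose)
    have "avg i (poly q) = (\<Sum>k\<le>degree p. coeff p k * ((\<Sum>b\<in>S i. (real N - eg i b) ^ k) / real (card (verts (G i)))))" for i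
    proof -
      have "(\<Sum>b\<in>S i. poly q (eg i b)) = (\<Sum>k\<le>degree p. coeff p k * (\<Sum>b\<in>S i. (real N - eg i b) ^ k))"
        unfolding pq by (subst sum.swap) (simp add: sum_distrib_left)
      then show ?thesis by (simp add: avg_def sum_divide_distrib[where A = "{..degree p}"])
    qed
    moreover have "(LINT t|m. poly q t) = (\<Sum>k\<le>degree p. coeff p k * (LINT t|m. (real N - t) ^ k))"
      unfolding pq
      by (subst Bochner_Integration.integral_sum) (auto intro!: integrable_mult_right bint continuous_intros)
    ultimately show ?thesis by (simp only:) (intro tendsto_intros mom)
  qed
  have conv: "(\<lambda>i. avg i f) \<longlonglongrightarrow> (LINT t|m. f t)" if f: "continuous_on UNIV f" for f
  proof (rule LIMSEQ_I)
    fix e :: real assume e: "0 < e"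
    obtain q where q: "\<And>t. t \<in> {0..L} \<Longrightarrow> \<bar>f t - poly q t\<bar> < e / 4"
      using Weierstrass_poly[of 0 L f "e / 4"] e continuous_on_subset[OF f] by auto
    have 1: "\<bar>avg i f - avg i (poly q)\<bar> \<le> e / 4" for i
    proof -
      have "\<bar>\<Sum>b\<in>S i. f (eg i b) - poly q (eg i b)\<bar> \<le> (\<Sum>b\<in>S i. e / 4)"
        by (rule order_trans[OF sum_abs sum_mono]) (use rng q in \<open>fastforce simp: L_def less_imp_le\<close>)
      then have "\<bar>\<Sum>b\<in>S i. f (eg i b) - poly q (eg i b)\<bar> / real (card (verts (G i))) \<le> e / 4"
        using card_G_pos[of i] by (simp add: cS field_simps)
      then show ?thesis by (simp add: avg_def diff_divide_distrib[symmetric] sum_subtractf)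
    qed
    have 2: "\<bar>(LINT t|m. f t) - (LINT t|m. poly q t)\<bar> \<le> e / 4"
    proof -
      have i: "integrable m (\<lambda>t. f t - poly q t)"
        by (intro bint continuous_intros f)
      have "\<bar>LINT t|m. f t - poly q t\<bar> \<le> (LINT t|m. \<bar>f t - poly q t\<bar>)" by (rule integral_abs_bound)
      also have "\<dots> \<le> (LINT t|m. e / 4)"
      proof (rule integral_mono_AE)
        show "AE t in m. \<bar>f t - poly q t\<bar> \<le> e / 4"
          using supp by eventually_elim (rule less_imp_le[OF q])
      qed (use i in auto)
      also have "\<dots> = e / 4" by (simp add: m1)
      finally show ?thesis
        by (subst (asm) Bochner_Integration.integral_diff) (auto intro!: bint continuous_intros f)
    qed
    obtain n0 where n0: "\<And>i. i \<ge> n0 \<Longrightarrow> norm (avg i (poly q) - (LINT t|m. poly q t)) < e / 4"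
      using LIMSEQ_D[OF poly_conv, of "e / 4" q] e by auto
    have "norm (avg i f - (LINT t|m. f t)) < e" if "i \<ge> n0" for i
      using 1[of i] 2 n0[OF that] e unfolding real_norm_def by linarith
    then show "\<exists>n0. \<forall>i\<ge>n0. norm (avg i f - (LINT t|m. f t)) < e" by blast
  qed
  \<comment> \<open>The test function \<open>max 0 (t - l)\<close> vanishes at all eigenvalues, so
    its averages are zero and so is its integral against the limit; hence \<open>m\<close> has no
    mass above \<open>l\<close>.\<close>
  have supp_l: "AE t in m. t \<in> {0..l}"
  proof -
    let ?f = "\<lambda>t. max 0 (t - l)"
    have cf: "continuous_on UNIV ?f" by (intro continuous_intros)
    have "avg i ?f = 0" for i unfolding avg_def using rng by (auto intro!: sum.neutral)
    then have "(LINT t|m. ?f t) = 0" using conv[OF cf] LIMSEQ_unique[OF _ tendsto_const[of 0]] by simp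
    then have "AE t in m. ?f t = 0" using integral_nonneg_eq_0_iff_AE[OF bint[OF cf]] by auto
    then show ?thesis using supp by eventually_elim (auto simp: max_def split: if_splits)
  qed
  show ?thesis
    unfolding converge_weakly_on_def KNS_measure_eq
  proof (intro allI impI)
    fix f :: "real \<Rightarrow> real" assume f: "continuous_on {0..l} f"
    \<comment> \<open>Continuity of \<open>f\<close> is given on \<open>{0..l}\<close> only;
      clamping the argument extends \<open>f\<close> continuously to the line without changing it
      there.\<close>
    define g where "g t = f (max 0 (min l t))" for t
    have g: "continuous_on UNIV g"
      unfolding g_def by (intro continuous_on_compose2[OF f] continuous_intros) (use l0 in auto)
    have [measurable]: "g \<in> borel_measurable borel" by (rule borel_measurable_continuous_onI[OF g])
    have fg: "f t = g t" if "t \<in> {0..l}" for t using that by (simp add: g_def)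
    have "(LINT t:{0..l}|graph_spectral_measure (G i). f t) = avg i g" for i
      unfolding int avg_def using rng fg by (auto intro!: arg_cong[where f = "\<lambda>x. x / _"] sum.cong)
    moreover have "(LINT t:{0..l}|m. f t) = (LINT t|m. g t)"
    proof -
      have "(LINT t:{0..l}|m. f t) = (LINT t|m. indicator {0..l} t * g t)"
        unfolding set_lebesgue_integral_def by (rule Bochner_Integration.integral_cong) (auto simp: fg indicator_def)
      also have "\<dots> = (LINT t|m. g t)"
      proof (rule integral_cong_AE)
        show "AE t in m. indicator {0..l} t * g t = g t" using supp_l by eventually_elim simp
      qed (simp_all add: measurable_cong_sets[OF spec.sets_\<mu> refl])
      finally show ?thesis .
    qed
    ultimately show "(\<lambda>i. LINT t:{0..l}|graph_spectral_measure (G i). f t) \<longlonglongrightarrow> (LINT t:{0..l}|m. f t)"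
      using conv[OF g] by simp
  qed
qed

end

theorem theorem3:
  fixes d :: nat and l :: real
    and G :: "nat \<Rightarrow> 'v cgraph"
    and \<G> :: "'a::{metric_space, second_countable_topology} graphing"
    and E :: "real set \<Rightarrow> ('a \<times> 'a) oper"
    and Tr :: "('a \<times> 'a) oper \<Rightarrow> complex"
  assumes "\<And>i. finite (verts (G i)) \<and> coloured_dgraph d (G i) \<and> gconnected (G i)"
    and "filterlim (\<lambda>i. card (verts (G i))) at_top sequentially"
    and "is_graphing d \<G>"
    and "weakly_converges d G \<G>"
    and "is_graphing_trace d \<G> Tr"
    and "is_spectral_measure_of (rel_measure d \<G>) (graphing_laplacian d \<G>) E"
    and "\<And>i. op_spectrum (count_space (verts (G i))) (graph_laplacian (G i)) \<subseteq> of_real ` {0..l}"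
    and "op_spectrum (rel_measure d \<G>) (graphing_laplacian d \<G>) \<subseteq> of_real ` {0..l}"
  shows "converge_weakly_on l (\<lambda>i. graph_spectral_measure (G i)) (KNS_measure Tr E)"
proof -
  interpret converging_spectral d \<G> G E Tr l
    by unfold_locales (use assms in auto)
  show ?thesis by (rule spectral_measures_converge)
qed

end
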